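(* Let $(X,T)$ be a topological dynamical system, and let $n\geq 1$ be an integer. If $\dim(X,T)<\frac n2$, then the set $$\bigl\{f\in C(X,[0,1]^n): I_f\text{ is a topological embedding}\bigr\}$$ is a dense $G_\delta$ subset of $C(X,[0,1]^n)$. In particular, $(X,T)$ embeds equivariantly into $(([0,1]^n)^{\mathbb Z},\sigma)$.
   Context: A topological dynamical system $(X,T)$ consists of a nonempty compact metrizable space $X$ and a homeomorphism $T\colon X\to X$. The space $C(X,[0,1]^n)$ of continuous maps carries the uniform topology (norm $\|f-g\|_\infty=\sup_{x}\max_{1\le c\le n}|f_c(x)-g_c(x)|$). The shift on $([0,1]^n)^{\mathbb Z}$ (product topology) is $(\sigma z)_k=z_{k+1}$. For $f\in C(X,[0,1]^n)$ the orbit map is $I_f\colon X\to([0,1]^n)^{\mathbb Z}$, $I_f(x)=(f(T^kx))_{k\in\mathbb Z}$. An equivariant embedding of $(X,T)$ into $(([0,1]^n)^{\mathbb Z},\sigma)$ is a topological embedding $F$ with $F\circ T=\sigma\circ F$. Dynamical dimension (Meyerovitch): let $\mathrm{Cov}(X)$ be the set of finite open covers of $X$, and $\mathrm{Prob}(X,T)$ the set of $T$-invariant Borel probability measures on $X$. For $\mathcal V\in\mathrm{Cov}(X)$ put $\mathrm{ord}(\mathcal V,x)=\#\{V\in\mathcal V:x\in V\}-1$ and $\mathrm{ord}(\mathcal V,T)=\sup_{\mu\in\mathrm{Prob}(X,T)}\int_X\mathrm{ord}(\mathcal V,x)\,d\mu(x)$. Write $\mathcal V\succeq\mathcal U$ if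 every $V\in\mathcal V$ is contained in some $U\in\mathcal U$. Then $$\dim(\mathcal U,T)=\inf_{\mathcal V\in\mathrm{Cov}(X),\ \mathcal V\succeq\mathcal U}\mathrm{ord}(\mathcal V,T),\qquad \dim(X,T)=\sup_{\mathcal U\in\mathrm{Cov}(X)}\dim(\mathcal U,T)\in[0,\infty].$$ *)

theory Defs
  imports "HOL-Probability.Probability"
begin

definition tds :: "'a topology \<Rightarrow> ('a \<Rightarrow> 'a) \<Rightarrow> bool" where
  "tds X T \<longleftrightarrow> topspace X \<noteq> {} \<and> compact_space X \<and> metrizable_space X \<and> homeomorphic_map X X T"

text \<open>Only the values of \<open>T\<close> on \<open>topspace X\<close> matter; for negative \<open>k\<close> the inverse is therefore
  taken relative to \<open>topspace X\<close>.\<close>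

definition ziter :: "'a topology \<Rightarrow> ('a \<Rightarrow> 'a) \<Rightarrow> int \<Rightarrow> 'a \<Rightarrow> 'a" where
  "ziter X T k = (if 0 \<le> k then T ^^ nat k else (inv_into (topspace X) T) ^^ nat (- k))"


subsection \<open>Dynamical dimension\<close>

definition inv_prob :: "'a topology \<Rightarrow> ('a \<Rightarrow> 'a) \<Rightarrow> 'a measure set" where
  "inv_prob X T = {\<mu>. prob_space \<mu> \<and> space \<mu> = topspace X \<and>
      sets \<mu> = sigma_sets (topspace X) {U. openin X U} \<and>
      (\<forall>A\<in>sets \<mu>. emeasure \<mu> (T -` A \<inter> topspace X) = emeasure \<mu> A)}"

definition open_covers :: "'a topology \<Rightarrow> 'a set set set" where
  "open_covers X = {\<U>. finite \<U> \<and> (\<forall>U\<in>\<U>. openin X U) \<and> \<Union>\<U> = topspace X}"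

definition refines :: "'a set set \<Rightarrow> 'a set set \<Rightarrow> bool" where
  "refines \<V> \<U> \<longleftrightarrow> (\<forall>V\<in>\<V>. \<exists>U\<in>\<U>. V \<subseteq> U)"

definition cover_ord :: "'a set set \<Rightarrow> 'a \<Rightarrow> real" where
  "cover_ord \<V> x = real (card {V \<in> \<V>. x \<in> V}) - 1"

text \<open>On \<open>topspace X\<close> the order of a cover is nonnegative, so \<open>ennreal\<close> truncates nothing in
  the following integral.\<close>

definition cover_ord_dyn :: "'a topology \<Rightarrow> ('a \<Rightarrow> 'a) \<Rightarrow> 'a set set \<Rightarrow> ennreal" where
  "cover_ord_dyn X T \<V> = (SUP \<mu>\<in>inv_prob X T. \<integral>\<^sup>+x. ennreal (cover_ord \<V> x) \<partial>\<mu>)"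

definition cover_dim :: "'a topology \<Rightarrow> ('a \<Rightarrow> 'a) \<Rightarrow> 'a set set \<Rightarrow> ennreal" where
  "cover_dim X T \<U> = (INF \<V>\<in>{\<V> \<in> open_covers X. refines \<V> \<U>}. cover_ord_dyn X T \<V>)"

definition dyn_dim :: "'a topology \<Rightarrow> ('a \<Rightarrow> 'a) \<Rightarrow> ennreal" where
  "dyn_dim X T = (SUP \<U>\<in>open_covers X. cover_dim X T \<U>)"


subsection \<open>Maps into the cube and the shift\<close>

text \<open>The dimension \<open>n\<close> is \<open>CARD('n)\<close>.\<close>

definition cube :: "(real ^ 'n) set" where
  "cube = {v. \<forall>c. v $ c \<in> {0..1}}"

definition cube_maps :: "'a topology \<Rightarrow> ('a \<Rightarrow> real ^ 'n) set" where
  "cube_maps X = {f \<in> extensional (topspace X). continuous_map X (top_of_set cube) f}"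

text \<open>The default value off \<open>cube_maps X\<close> is there because \<open>Metric_space\<close> requires the distance
  to be nonnegative on the whole type, where the supremum may be unbounded.\<close>

definition unif_dist :: "'a topology \<Rightarrow> ('a \<Rightarrow> real ^ 'n) \<Rightarrow> ('a \<Rightarrow> real ^ 'n) \<Rightarrow> real" where
  "unif_dist X f g =
     (if f \<in> cube_maps X \<and> g \<in> cube_maps X
      then SUP x\<in>topspace X. MAX c. \<bar>f x $ c - g x $ c\<bar> else 0)"

definition unif_topology :: "'a topology \<Rightarrow> ('a \<Rightarrow> real ^ 'n) topology" where
  "unif_topology X = Metric_space.mtopology (cube_maps X) (unif_dist X)"

definition cube_shift_space :: "(int \<Rightarrow> real ^ 'n) topology" where
  "cube_shift_space = product_topology (\<lambda>_. top_of_set cube) UNIV"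

definition zshift :: "(int \<Rightarrow> 'b) \<Rightarrow> int \<Rightarrow> 'b" where
  "zshift z = (\<lambda>k. z (k + 1))"

definition orbit_map :: "'a topology \<Rightarrow> ('a \<Rightarrow> 'a) \<Rightarrow> ('a \<Rightarrow> 'b) \<Rightarrow> 'a \<Rightarrow> int \<Rightarrow> 'b" where
  "orbit_map X T f x = (\<lambda>k. f (ziter X T k x))"

lemma Metric_space_cube_maps:
  assumes "topspace X \<noteq> {}"
  shows "Metric_space (cube_maps X) (unif_dist X :: ('a \<Rightarrow> real ^ 'n) \<Rightarrow> _)"
proof -
  let ?m = "\<lambda>(f :: 'a \<Rightarrow> real ^ 'n) g x. MAX c. \<bar>f x $ c - g x $ c\<bar>"
  have in_cube: "f x $ c \<in> {0..1}" if "f \<in> cube_maps X" "x \<in> topspace X"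
    for f :: "'a \<Rightarrow> real ^ 'n" and x c
    using that by (auto simp: cube_maps_def continuous_map_def cube_def Pi_iff)
  have m_ge: "\<bar>f x $ c - g x $ c\<bar> \<le> ?m f g x" for f g x c
    by (rule Max_ge) auto
  have m_nonneg: "0 \<le> ?m f g x" for f g x
    using m_ge[of f x undefined g] by linarith
  have m_le: "?m f g x \<le> b" if "\<And>c. \<bar>f x $ c - g x $ c\<bar> \<le> b" for f g x b
    using that by (subst Max_le_iff) auto
  have bdd: "bdd_above (?m f g ` topspace X)" if "f \<in> cube_maps X" "g \<in> cube_maps X" for f g
  proof (rule bdd_aboveI2)
    fix x assume x: "x \<in> topspace X"
    show "?m f g x \<le> 1"
    proof (rule m_le)
      fix c
      show "\<bar>f x $ c - g x $ c\<bar> \<le> 1"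
        using in_cube[OF that(1) x, of c] in_cube[OF that(2) x, of c] by auto
    qed
  qed
  have d_ge: "?m f g x \<le> unif_dist X f g"
    if "f \<in> cube_maps X" "g \<in> cube_maps X" "x \<in> topspace X" for f g x
    using cSUP_upper[OF that(3) bdd[OF that(1,2)]] that by (simp add: unif_dist_def)
  have d_le: "unif_dist X f g \<le> b"
    if "f \<in> cube_maps X" "g \<in> cube_maps X" "\<And>x. x \<in> topspace X \<Longrightarrow> ?m f g x \<le> b" for f g b
    using cSUP_least[OF assms that(3)] that by (simp add: unif_dist_def)
  obtain x0 where x0: "x0 \<in> topspace X" using assms by blast
  show ?thesis
  proof
    fix f g :: "'a \<Rightarrow> real ^ 'n"
    show "unif_dist X f g = unif_dist X g f"
      by (auto simp: unif_dist_def abs_minus_commute)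
    show "0 \<le> unif_dist X f g"
    proof (cases "f \<in> cube_maps X \<and> g \<in> cube_maps X")
      case True
      then show ?thesis using m_nonneg[of f x0 g] d_ge[of f g x0] x0 by linarith
    qed (auto simp: unif_dist_def)
  next
    fix f g :: "'a \<Rightarrow> real ^ 'n"
    assume fg: "f \<in> cube_maps X" "g \<in> cube_maps X"
    show "unif_dist X f g = 0 \<longleftrightarrow> f = g"
    proof
      assume 0: "unif_dist X f g = 0"
      show "f = g"
      proof (rule extensionalityI)
        show "f \<in> extensional (topspace X)" "g \<in> extensional (topspace X)"
          using fg by (auto simp: cube_maps_def)
        fix x assume x: "x \<in> topspace X"
        have "\<bar>f x $ c - g x $ c\<bar> \<le> 0" for c
          using m_ge[of f x c g] d_ge[OF fg x] 0 by linarith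
        then show "f x = g x" by (simp add: vec_eq_iff)
      qed
    next
      assume "f = g"
      then show "unif_dist X f g = 0" using assms by (simp add: unif_dist_def)
    qed
  next
    fix f g h :: "'a \<Rightarrow> real ^ 'n"
    assume fgh: "f \<in> cube_maps X" "g \<in> cube_maps X" "h \<in> cube_maps X"
    show "unif_dist X f h \<le> unif_dist X f g + unif_dist X g h"
    proof (rule d_le[OF fgh(1,3)], rule m_le)
      fix x c assume x: "x \<in> topspace X"
      show "\<bar>f x $ c - h x $ c\<bar> \<le> unif_dist X f g + unif_dist X g h"
        using m_ge[of f x c g] m_ge[of g x c h] d_ge[OF fgh(1,2) x] d_ge[OF fgh(2,3) x]
        by linarith
    qed
  qed
qed

end

theory Submission
  imports Defs
begin

text \<open>By Baire's theorem it suffices that, for every finite open cover \<open>\<U>\<close>, the maps whose orbit map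
  only identifies points lying in a common member of \<open>\<U>\<close> are open and dense. For the density,
  choose a fine refinement \<open>\<V>\<close> with \<open>ord(\<V>, T) < n/2\<close> and a subordinate partition of
  unity \<open>\<phi>\<close>, and replace \<open>f\<close> by a map \<open>g(x) = A \<phi>(x) + \<tau> (\<Sum>l\<le>L. B\<^sub>l \<phi>(T\<^sup>l x))\<close> that is linear in
  \<open>\<phi>\<close>. If \<open>x\<close> and \<open>y\<close> have the same image then \<open>w\<^sub>k = \<phi>(T\<^sup>k x) - \<phi>(T\<^sup>k y)\<close> solves a linear
  Toeplitz system with \<open>n\<close> equations per time step, and \<open>w\<^sub>k\<close> ranges over an affine space of dimension
  at most \<open>ord(\<V>, T\<^sup>k x) + ord(\<V>, T\<^sup>k y)\<close>. As empirical measures accumulate only at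
  invariant measures, these dimensions average to less than \<open>n\<close> over long time intervals. With Gaussian
  coefficients \<open>B\<^sub>l\<close> the perturbing part alone is injective on a suitable finite window around
  time \<open>0\<close>, so for each of the countably many patterns of supports only finitely many \<open>\<tau>\<close> are bad.
  For all other \<open>\<tau>\<close> we get \<open>w\<^sub>0 = 0\<close>, and \<open>x\<close> and \<open>y\<close> lie in a common member of \<open>\<V>\<close>.\<close>

subsection \<open>Gaussian Toeplitz systems\<close>

text \<open>One map has to treat all pairs \<open>x\<close>, \<open>y\<close> at once, while the
  dimension is bounded only on average in time: a single time may carry far more unknowns than
  equations. Its surplus must be determined by equations at earlier times, so the perturbation looks
  up to \<open>L\<close> steps ahead. The linear system of a pair depends on the pair only through
  the supports, and there are countably many support patterns on finite windows; hence a single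
  scalar \<open>\<tau>\<close> can serve all pairs, provided that one fixed filter works for every
  pattern. Powers of a small number with squared distances as exponents do: by convexity of the
  square the order preserving matching of unknowns with equations dominates, whichever unknowns
  occur. As the filter looks only forward, times before the window never enter; only the right end
  needs care, and the end of the window is chosen for it. The bound \<open>n/2\<close> arises
  because a pair contributes the orders of both of its points. Disjoint supports add one unknown, a
  common scale, which the strictness of the inequality absorbs.\<close>

lemma sum_power_int_dist_le:
  fixes t :: real and x :: int
  assumes "finite Z" "x \<notin> Z" "0 < t" "t < 1"
  shows "(\<Sum>z\<in>Z. t ^ nat \<bar>z - x\<bar>) \<le> 2 * t / (1 - t)"
proof -
  \<comment> \<open>On one side of \<open>x\<close> the distances are distinct positive integers, so
    the sum is part of the geometric series starting at \<open>t\<close>.\<close>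
  have half: "(\<Sum>z\<in>A. t ^ nat \<bar>z - x\<bar>) \<le> t / (1 - t)"
    if A: "finite A" "x \<notin> A" and inj: "inj_on (\<lambda>z. nat \<bar>z - x\<bar>) A" for A
  proof -
    let ?h = "\<lambda>z. nat \<bar>z - x\<bar> - 1"
    have pos: "nat \<bar>z - x\<bar> = Suc (?h z)" if "z \<in> A" for z
      using that A(2) by (cases "z = x") auto
    have inj': "inj_on ?h A"
      using inj pos by (metis (mono_tags, lifting) inj_on_def)
    have "(\<Sum>z\<in>A. t ^ nat \<bar>z - x\<bar>) = (\<Sum>z\<in>A. t * t ^ ?h z)"
      using pos by (intro sum.cong refl) (metis power_Suc)
    also have "\<dots> = t * (\<Sum>i\<in>?h ` A. t ^ i)"
      unfolding sum.reindex[OF inj'] sum_distrib_left comp_def ..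
    also have "(\<Sum>i\<in>?h ` A. t ^ i) \<le> (\<Sum>i. t ^ i)"
      using assms A by (intro sum_le_suminf summable_geometric) auto
    also have "\<dots> = 1 / (1 - t)"
      using assms by (intro suminf_geometric) auto
    finally show ?thesis using assms by (simp add: mult_left_mono)
  qed
  have "(\<Sum>z\<in>Z. t ^ nat \<bar>z - x\<bar>) = (\<Sum>z\<in>{z\<in>Z. z < x}. t ^ nat \<bar>z - x\<bar>) + (\<Sum>z\<in>{z\<in>Z. z > x}. t ^ nat \<bar>z - x\<bar>)"
  proof (subst sum.union_disjoint[symmetric])
    have "Z = {z \<in> Z. z < x} \<union> {z \<in> Z. x < z}" using assms(2) by (auto simp: not_less) (metis le_less)
    then show "(\<Sum>z\<in>Z. t ^ nat \<bar>z - x\<bar>) = (\<Sum>z\<in>{z \<in> Z. z < x} \<union> {z \<in> Z. x < z}. t ^ nat \<bar>z - x\<bar>)" by simp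
  qed (use assms in auto)
  also have "\<dots> \<le> t / (1 - t) + t / (1 - t)"
    using assms by (intro add_mono half) (auto simp: inj_on_def)
  finally show ?thesis by simp
qed

text \<open>Each unknown \<open>x \<in> X\<close> is matched monotonically with the equation at \<open>Y (rank of x)\<close>. Since
  \<open>(z - y)\<^sup>2\<close> has strictly increasing differences, there is a potential \<open>q\<close> such that
  \<open>(z - y)\<^sup>2 - q z\<close> has its strict minimum at the matched unknown; hence the equation matched with a
  maximiser of \<open>\<bar>w x\<bar> * t powi q x\<close> is diagonally dominant. Unknowns outside \<open>X\<close> do no harm because
  \<open>q\<close> is increasing.\<close>

lemma gaussian_toeplitz_injective:
  fixes X Z :: "int set" and Y :: "nat \<Rightarrow> int" and K :: "int \<Rightarrow> nat \<Rightarrow> real" and w :: "int \<Rightarrow> real"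
  assumes fin: "finite Z" "X \<subseteq> Z" and Y: "strict_mono Y"
    and le: "\<And>x. x \<in> X \<Longrightarrow> Y (card {x'\<in>X. x' < x}) \<le> x"
    and t: "0 < t" "t < 1" and C: "1 \<le> C" "2 * C * t < 1 - t"
    and dom: "\<And>z. z \<in> Z \<Longrightarrow> w z \<noteq> 0 \<Longrightarrow> \<exists>x\<in>X. x \<le> z \<and> \<bar>w z\<bar> \<le> C * \<bar>w x\<bar>"
    and K_le: "\<And>z r. z \<in> Z \<Longrightarrow> \<bar>K z r\<bar> \<le> t ^ nat ((z - Y r)\<^sup>2)"
    and K_eq: "\<And>x. x \<in> X \<Longrightarrow> K x (card {x'\<in>X. x' < x}) = t ^ nat ((x - Y (card {x'\<in>X. x' < x}))\<^sup>2)"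
    and eqs: "\<And>x. x \<in> X \<Longrightarrow> (\<Sum>z\<in>Z. K z (card {x'\<in>X. x' < x}) * w z) = 0"
    and z: "z \<in> Z"
  shows "w z = 0"
proof (cases "X = {}")
  case True
  then show ?thesis using dom z by blast
next
  case False
  have finX: "finite X" using fin finite_subset by blast
  define rk where "rk x = card {x'\<in>X. x' < x}" for x
  define cnt where "cnt z = card {x\<in>X. x \<le> z}" for z
  define yv where "yv z = Y (cnt z - 1)" for z
  define x0 where "x0 = Min X"
  \<comment> \<open>A discrete integral: \<open>yv z\<close> is the equation matched with the last
    element of \<open>X\<close> up to \<open>z\<close>, and with this increment the step from
    \<open>z\<close> to \<open>z + 1\<close> changes \<open>(z - Y r)\<^sup>2 - q z\<close> by
    \<open>2 * (yv z - Y r) + 1\<close>.\<close>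
  define q where "q z = (\<Sum>i\<in>{x0..<z}. 2 * (i - yv i))" for z
  have x0: "x0 \<in> X" "\<And>x. x \<in> X \<Longrightarrow> x0 \<le> x"
    using False finX by (auto simp: x0_def)
  have cnt_pos: "cnt z \<ge> 1" if "z \<ge> x0" for z
  proof -
    have "card {x0} \<le> cnt z" unfolding cnt_def using finX that x0 by (intro card_mono) auto
    then show ?thesis by simp
  qed
  have cnt_eq: "cnt x = Suc (rk x)" if "x \<in> X" for x
  proof -
    have "{x'\<in>X. x' \<le> x} = insert x {x'\<in>X. x' < x}" using that by auto
    then show ?thesis unfolding cnt_def rk_def using finX by simp
  qed
  have cnt_mono: "cnt z \<le> cnt z'" if "z \<le> z'" for z z'
    unfolding cnt_def using finX that by (intro card_mono) auto
  have cnt_less: "cnt z \<le> rk x" if "z < x" for z x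
    unfolding cnt_def rk_def using finX that by (intro card_mono) auto
  have Ymono: "Y a \<le> Y b" if "a \<le> b" for a b
    using Y that strict_mono_less_eq by blast
  have yv_le: "yv z \<le> z" if "x0 \<le> z" for z
  proof -
    define x where "x = Max {x\<in>X. x \<le> z}"
    have ne: "{x\<in>X. x \<le> z} \<noteq> {}" using that x0 by auto
    have x: "x \<in> X" "x \<le> z" using Max_in[OF _ ne] finX by (auto simp: x_def)
    have "{x'\<in>X. x' \<le> z} = {x'\<in>X. x' \<le> x}"
    proof (intro Collect_cong conj_cong refl iffI)
      fix x' assume "x' \<in> X" "x' \<le> z"
      then show "x' \<le> x" unfolding x_def using finX by (intro Max_ge) auto
    qed (use x in auto)
    then have "cnt z = Suc (rk x)" using cnt_eq[OF x(1)] by (simp add: cnt_def)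
    then show ?thesis using le[OF x(1)] x(2) by (simp add: yv_def rk_def)
  qed
  have q_Suc: "q (z + 1) = q z + 2 * (z - yv z)" if "x0 \<le> z" for z
  proof -
    have "{x0..<z+1} = insert z {x0..<z}" using that by auto
    then show ?thesis unfolding q_def by simp
  qed
  have q_mono: "q z \<le> q z'" if "x0 \<le> z" "z \<le> z'" for z z'
    using that(2)
  proof (induction z' rule: int_ge_induct)
    case (step i)
    then show ?case using q_Suc[of i] yv_le[of i] that(1) by auto
  qed simp
  define D where "D r z = (z - Y r)\<^sup>2 - q z" for r z
  have D_Suc: "D r (z + 1) = D r z + 2 * (yv z - Y r) + 1" if "x0 \<le> z" for r z
    unfolding D_def q_Suc[OF that] by (simp add: power2_eq_square algebra_simps)
  \<comment> \<open>From \<open>x\<close> on, \<open>yv\<close> is at least \<open>Y (rk x)\<close>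
    and the increments are at least \<open>1\<close>. Before \<open>x\<close>, the integer
    \<open>yv\<close> is smaller by at least one and the increments are at most \<open>- 1\<close>.
    This slope turns the off-diagonal terms into a geometric series.\<close>
  have D_ge: "D (rk x) x + \<bar>z - x\<bar> \<le> D (rk x) z" if x: "x \<in> X" and z: "x0 \<le> z" for x z
  proof (cases "x \<le> z")
    case True
    then show ?thesis
    proof (induction z rule: int_ge_induct)
      case (step i)
      have "Y (rk x) \<le> yv i"
        unfolding yv_def using cnt_mono[OF step.hyps] cnt_eq[OF x] by (intro Ymono) auto
      then show ?case using step D_Suc[of i "rk x"] x0(2)[OF x] by auto
    qed simp
  next
    case False
    then have "z \<le> x" by simp
    then show ?thesis using z
    proof (induction z rule: int_le_induct)
      case (step i)
      have "cnt (i - 1) - 1 < rk x"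
        using cnt_less[of "i-1" x] cnt_pos[of "i-1"] step by auto
      then have "yv (i - 1) < Y (rk x)" unfolding yv_def using Y strict_mono_less by blast
      then show ?case using step D_Suc[of "i-1" "rk x"] by auto
    qed simp
  qed
  define M where "M = Max ((\<lambda>x. \<bar>w x\<bar> * t powi q x) ` X)"
  have "M \<in> (\<lambda>x. \<bar>w x\<bar> * t powi q x) ` X"
    unfolding M_def using finX False by (intro Max_in) auto
  then obtain x where x: "x \<in> X" "M = \<bar>w x\<bar> * t powi q x" by blast
  have M_ge: "\<bar>w x'\<bar> * t powi q x' \<le> M" if "x' \<in> X" for x'
    unfolding M_def using finX that by (intro Max_ge) auto
  have M0: "0 \<le> M" using x t by simp
  \<comment> \<open>Domination by an earlier unknown survives the weights: \<open>q\<close> is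
    monotone and \<open>t < 1\<close>, so \<open>t powi (- q z)\<close> does not decrease to the
    right. The second conjunct excludes the positions below \<open>x0\<close>, which
    \<open>D_ge\<close> does not cover.\<close>
  have w_le: "\<bar>w z\<bar> \<le> C * M * t powi (- q z) \<and> (w z \<noteq> 0 \<longrightarrow> x0 \<le> z)" if "z \<in> Z" for z
  proof (cases "w z = 0")
    case True
    then show ?thesis using C M0 t by simp
  next
    case False
    from dom[OF that this] obtain x' where x': "x' \<in> X" "x' \<le> z" "\<bar>w z\<bar> \<le> C * \<bar>w x'\<bar>" by blast
    have "\<bar>w x'\<bar> \<le> M * t powi (- q x')"
      using M_ge[OF x'(1)] t by (simp add: power_int_minus field_simps)
    also have "\<dots> \<le> M * t powi (- q z)"
      using q_mono[of x' z] x' x0 t M0 by (intro mult_left_mono power_int_decreasing) auto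
    finally have "C * \<bar>w x'\<bar> \<le> C * (M * t powi (- q z))" using C by (intro mult_left_mono) auto
    then show ?thesis using x' x0(2)[OF x'(1)] by (simp add: mult.assoc)
  qed
  have sq: "t ^ nat ((z - Y r)\<^sup>2) = t powi ((z - Y r)\<^sup>2)" for z r
    by (simp add: power_int_def)
  define r where "r = rk x"
  have "M * t powi (D r x) = K x r * \<bar>w x\<bar>"
    using K_eq[OF x(1)] t unfolding r_def rk_def[symmetric] sq x(2) D_def
    by (simp add: power_int_diff)
  also have "\<dots> = \<bar>K x r * w x\<bar>"
    using K_eq[OF x(1)] t unfolding r_def rk_def[symmetric] by (simp add: abs_mult)
  also have "K x r * w x = - (\<Sum>z\<in>Z - {x}. K z r * w z)"
    using eqs[OF x(1)] fin x(1) unfolding r_def rk_def[symmetric]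
    by (subst (asm) sum.remove[of _ x]) auto
  also have "\<bar>- (\<Sum>z\<in>Z - {x}. K z r * w z)\<bar> \<le> (\<Sum>z\<in>Z - {x}. \<bar>K z r * w z\<bar>)"
    by (simp add: sum_abs)
  also have "\<dots> \<le> (\<Sum>z\<in>Z - {x}. (C * M * t powi D r x) * t ^ nat \<bar>z - x\<bar>)"
  proof (rule sum_mono)
    fix z assume z: "z \<in> Z - {x}"
    show "\<bar>K z r * w z\<bar> \<le> (C * M * t powi D r x) * t ^ nat \<bar>z - x\<bar>"
    proof (cases "w z = 0")
      case True
      then show ?thesis using C M0 t by simp
    next
      case False
      then have z0: "x0 \<le> z" using w_le z by blast
      have "\<bar>K z r * w z\<bar> \<le> t powi ((z - Y r)\<^sup>2) * (C * M * t powi (- q z))"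
        unfolding abs_mult using K_le[of z r] w_le[of z] z t by (intro mult_mono) (auto simp: sq)
      also have "\<dots> = C * M * t powi D r z"
        using t by (simp add: D_def power_int_diff power_int_minus field_simps)
      also have "\<dots> \<le> C * M * t powi (D r x + \<bar>z - x\<bar>)"
        using D_ge[OF x(1) z0] t C M0 by (intro mult_left_mono power_int_decreasing) (auto simp: r_def)
      also have "\<dots> = (C * M * t powi D r x) * t ^ nat \<bar>z - x\<bar>"
        using t by (simp add: power_int_add power_int_def[of t "\<bar>z - x\<bar>"])
      finally show ?thesis .
    qed
  qed
  also have "\<dots> \<le> (C * M * t powi D r x) * (2 * t / (1 - t))"
    unfolding sum_distrib_left[symmetric]
    using fin t C M0 by (intro mult_left_mono sum_power_int_dist_le) auto
  finally have "M * t powi (D r x) \<le> M * t powi (D r x) * (C * (2 * t / (1 - t)))"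
    by (simp add: mult_ac)
  moreover have "C * (2 * t / (1 - t)) < 1" using C t by (simp add: field_simps)
  ultimately have "M * t powi (D r x) \<le> 0"
    using M0 t by (smt (verit) mult_left_le mult_less_cancel_left2 power_int_not_zero zero_le_mult_iff zero_le_power_int)
  then have "M = 0" using M0 t by (simp add: mult_le_0_iff) (smt (verit) zero_less_power_int)
  then show ?thesis using w_le[OF z] by simp
qed

section \<open>Linear pencils with finitely many equations\<close>

lemma exists_nontrivial_combination:
  fixes v :: "'j \<Rightarrow> 'i \<Rightarrow> real"
  assumes "finite I" "finite J" "card I < card J"
  shows "\<exists>c. (\<exists>j\<in>J. c j \<noteq> 0) \<and> (\<forall>i\<in>I. (\<Sum>j\<in>J. c j * v j i) = 0)"
  using assms
proof (induction I arbitrary: J v rule: finite_induct)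
  case empty
  then have "J \<noteq> {}" by auto
  then show ?case by (intro exI[of _ "\<lambda>_. 1"]) auto
next
  case (insert i I)
  show ?case
  proof (cases "\<forall>j\<in>J. v j i = 0")
    case True
    obtain c where "\<exists>j\<in>J. c j \<noteq> 0" "\<forall>i\<in>I. (\<Sum>j\<in>J. c j * v j i) = 0"
      using insert.IH[of J v] insert.prems insert.hyps by auto
    then show ?thesis using True by (intro exI[of _ c]) auto
  next
    case False
    then obtain p where p: "p \<in> J" "v p i \<noteq> 0" by blast
    \<comment> \<open>Gaussian elimination: the pivot \<open>p\<close> clears coordinate
      \<open>i\<close> from the other vectors; the coefficient of \<open>p\<close> itself is then
      solved for in \<open>c'\<close>.\<close>
    define u where "u j i' = v j i' - v j i / v p i * v p i'" for j i'
    obtain c where c: "\<exists>j\<in>J - {p}. c j \<noteq> 0" "\<forall>i'\<in>I. (\<Sum>j\<in>J - {p}. c j * u j i') = 0"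
    proof -
      have "finite (J - {p})" "card I < card (J - {p})"
        using insert.prems insert.hyps p by auto
      from insert.IH[OF this, of u] show ?thesis using that by blast
    qed
    define c' where "c' j = (if j = p then - (\<Sum>j\<in>J - {p}. c j * v j i) / v p i else c j)" for j
    have sum_c': "(\<Sum>j\<in>J. c' j * v j i') = c' p * v p i' + (\<Sum>j\<in>J - {p}. c j * v j i')" for i'
      using p insert.prems by (subst sum.remove[of _ p]) (auto simp: c'_def intro!: sum.cong)
    have "(\<Sum>j\<in>J. c' j * v j i') = 0" if "i' \<in> insert i I" for i'
    proof (cases "i' = i")
      case True
      then show ?thesis using p by (simp add: sum_c') (simp add: c'_def)
    next
      case False
      then have "0 = (\<Sum>j\<in>J - {p}. c j * u j i')" using c that by auto
      also have "\<dots> = (\<Sum>j\<in>J - {p}. c j * v j i') - (\<Sum>j\<in>J - {p}. c j * v j i) / v p i * v p i'"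
        by (simp add: u_def algebra_simps sum_subtractf sum_distrib_left sum_distrib_right sum_divide_distrib)
      finally show ?thesis by (simp add: sum_c') (simp add: c'_def)
    qed
    moreover have "\<exists>j\<in>J. c' j \<noteq> 0" using c(1) by (auto simp: c'_def)
    ultimately show ?thesis by blast
  qed
qed

text \<open>Kernel vectors for distinct parameters behave like eigenvectors for distinct
  eigenvalues, so injectivity of \<open>T1\<close> bounds their number.\<close>

lemma finite_singular_parameters:
  fixes E :: "('z \<Rightarrow> real) set" and T0 T1 :: "('z \<Rightarrow> real) \<Rightarrow> nat \<Rightarrow> real"
  assumes comb: "\<And>w w' a b. w \<in> E \<Longrightarrow> w' \<in> E \<Longrightarrow> (\<lambda>z. a * w z + b * w' z) \<in> E"
    and lin0: "\<And>w w' a b r. T0 (\<lambda>z. a * w z + b * w' z) r = a * T0 w r + b * T0 w' r"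
    and lin1: "\<And>w w' a b r. T1 (\<lambda>z. a * w z + b * w' z) r = a * T1 w r + b * T1 w' r"
    and inj: "\<And>w. w \<in> E \<Longrightarrow> (\<And>r. r < R \<Longrightarrow> T1 w r = 0) \<Longrightarrow> w = (\<lambda>_. 0)"
  shows "finite {\<tau>. \<exists>w\<in>E. w \<noteq> (\<lambda>_. 0) \<and> (\<forall>r<R. T0 w r + \<tau> * T1 w r = 0)}"
proof (rule ccontr)
  assume "\<not> ?thesis"
  from infinite_arbitrarily_large[OF this, of "Suc R"] obtain J where
    J: "finite J" "card J = Suc R"
      "J \<subseteq> {\<tau>. \<exists>w\<in>E. w \<noteq> (\<lambda>_. 0) \<and> (\<forall>r<R. T0 w r + \<tau> * T1 w r = 0)}"
    by blast
  have "\<forall>\<tau>\<in>J. \<exists>w. w\<in>E \<and> w \<noteq> (\<lambda>_. 0) \<and> (\<forall>r<R. T0 w r + \<tau> * T1 w r = 0)"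
    using J(3) by blast
  then obtain w where "\<forall>\<tau>\<in>J. w \<tau> \<in> E \<and> w \<tau> \<noteq> (\<lambda>_. 0) \<and> (\<forall>r<R. T0 (w \<tau>) r + \<tau> * T1 (w \<tau>) r = 0)"
    by metis
  then have w: "\<And>\<tau>. \<tau> \<in> J \<Longrightarrow> w \<tau> \<in> E" "\<And>\<tau>. \<tau> \<in> J \<Longrightarrow> w \<tau> \<noteq> (\<lambda>_. 0)"
      "\<And>\<tau> r. \<tau> \<in> J \<Longrightarrow> r < R \<Longrightarrow> T0 (w \<tau>) r + \<tau> * T1 (w \<tau>) r = 0"
    by auto
  \<comment> \<open>There are \<open>Suc R\<close> kernel vectors, but their images under
    \<open>T1\<close> have only \<open>R\<close> coordinates.\<close>
  obtain c where c: "\<exists>\<tau>\<in>J. c \<tau> \<noteq> 0" "\<forall>r\<in>{..<R}. (\<Sum>\<tau>\<in>J. c \<tau> * T1 (w \<tau>) r) = 0"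
    using exists_nontrivial_combination[of "{..<R}" J "\<lambda>\<tau>. T1 (w \<tau>)"] J by auto
  have T_zero: "T0 (\<lambda>_. 0) r = 0" "T1 (\<lambda>_. 0) r = 0" for r
    using lin0[of 0 _ 0 _ r] lin1[of 0 _ 0 _ r] by auto
  have sumE: "(\<lambda>z. \<Sum>\<tau>\<in>A. d \<tau> * w \<tau> z) \<in> E
      \<and> T0 (\<lambda>z. \<Sum>\<tau>\<in>A. d \<tau> * w \<tau> z) r = (\<Sum>\<tau>\<in>A. d \<tau> * T0 (w \<tau>) r)
      \<and> T1 (\<lambda>z. \<Sum>\<tau>\<in>A. d \<tau> * w \<tau> z) r = (\<Sum>\<tau>\<in>A. d \<tau> * T1 (w \<tau>) r)"
    if A: "A \<subseteq> J" for A d r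
  proof -
    have "finite A" using A J finite_subset by blast
    then show ?thesis using A
    proof (induction A rule: finite_induct)
      case empty
      obtain \<tau> where "\<tau> \<in> J" using J by fastforce
      then show ?case using comb[OF w(1) w(1), of \<tau> \<tau> 0 0] T_zero by simp
    next
      case (insert \<tau> A)
      have IH: "(\<lambda>z. \<Sum>\<tau>\<in>A. d \<tau> * w \<tau> z) \<in> E"
        "T0 (\<lambda>z. \<Sum>\<tau>\<in>A. d \<tau> * w \<tau> z) r = (\<Sum>\<tau>\<in>A. d \<tau> * T0 (w \<tau>) r)"
        "T1 (\<lambda>z. \<Sum>\<tau>\<in>A. d \<tau> * w \<tau> z) r = (\<Sum>\<tau>\<in>A. d \<tau> * T1 (w \<tau>) r)"
        using insert by auto
      have eq: "(\<lambda>z. \<Sum>\<tau>\<in>insert \<tau> A. d \<tau> * w \<tau> z) = (\<lambda>z. d \<tau> * w \<tau> z + 1 * (\<Sum>\<tau>\<in>A. d \<tau> * w \<tau> z))"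
        using insert by auto
      show ?case unfolding eq lin0 lin1 using insert comb[OF w(1)[of \<tau>] IH(1), of "d \<tau>" 1] IH by auto
    qed
  qed
  \<comment> \<open>Induction on \<open>k\<close>: if the images under \<open>T1\<close> cancel with
    weights \<open>c \<tau> * \<tau> ^ k\<close>, injectivity makes the combination itself vanish,
    hence also its image under \<open>T0\<close>. The kernel equation replaces \<open>T0\<close> by
    \<open>- \<tau> * T1\<close>, which raises the power by one.\<close>
  have zero: "(\<Sum>\<tau>\<in>J. c \<tau> * \<tau> ^ k * w \<tau> z) = 0" for k z
  proof -
    have step: "(\<lambda>z. \<Sum>\<tau>\<in>J. (c \<tau> * \<tau> ^ k) * w \<tau> z) = (\<lambda>_. 0)"
      if "\<And>r. r < R \<Longrightarrow> (\<Sum>\<tau>\<in>J. c \<tau> * \<tau> ^ k * T1 (w \<tau>) r) = 0" for k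
      using sumE[of J "\<lambda>\<tau>. c \<tau> * \<tau> ^ k"] that by (intro inj) auto
    have "(\<Sum>\<tau>\<in>J. c \<tau> * \<tau> ^ k * T1 (w \<tau>) r) = 0" if "r < R" for k r
      using that
    proof (induction k arbitrary: r)
      case 0
      then show ?case using c by simp
    next
      case (Suc k)
      have "(\<lambda>z. \<Sum>\<tau>\<in>J. (c \<tau> * \<tau> ^ k) * w \<tau> z) = (\<lambda>_. 0)"
        using Suc.IH by (rule step)
      then have "0 = T0 (\<lambda>z. \<Sum>\<tau>\<in>J. (c \<tau> * \<tau> ^ k) * w \<tau> z) r"
        by (simp only: T_zero)
      also have "\<dots> = (\<Sum>\<tau>\<in>J. (c \<tau> * \<tau> ^ k) * T0 (w \<tau>) r)"
        by (rule sumE[THEN conjunct2, THEN conjunct1]) simp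
      also have "\<dots> = (\<Sum>\<tau>\<in>J. - (c \<tau> * \<tau> ^ Suc k * T1 (w \<tau>) r))"
      proof (intro sum.cong refl)
        fix \<tau> assume "\<tau> \<in> J"
        then have "T0 (w \<tau>) r = - (\<tau> * T1 (w \<tau>) r)" using w(3) Suc.prems by force
        then show "(c \<tau> * \<tau> ^ k) * T0 (w \<tau>) r = - (c \<tau> * \<tau> ^ Suc k * T1 (w \<tau>) r)" by simp
      qed
      finally show ?case by (simp add: sum_negf)
    qed
    from fun_cong[OF step[OF this], of k z] show ?thesis by simp
  qed
  \<comment> \<open>From powers of \<open>\<tau>\<close> to polynomials: as in Lagrange
    interpolation, the product over \<open>J - {\<tau>}\<close> will isolate a single kernel
    vector.\<close>
  have prod_zero: "(\<Sum>\<tau>\<in>J. c \<tau> * \<tau> ^ k * (\<Prod>\<sigma>\<in>A. \<tau> - \<sigma>) * w \<tau> z) = 0" if "finite A" for A k z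
    using that
  proof (induction A arbitrary: k rule: finite_induct)
    case empty
    then show ?case using zero by simp
  next
    case (insert \<sigma> A)
    have "(\<Sum>\<tau>\<in>J. c \<tau> * \<tau> ^ k * (\<Prod>\<sigma>\<in>insert \<sigma> A. \<tau> - \<sigma>) * w \<tau> z)
        = (\<Sum>\<tau>\<in>J. c \<tau> * \<tau> ^ Suc k * (\<Prod>\<sigma>\<in>A. \<tau> - \<sigma>) * w \<tau> z)
          - \<sigma> * (\<Sum>\<tau>\<in>J. c \<tau> * \<tau> ^ k * (\<Prod>\<sigma>\<in>A. \<tau> - \<sigma>) * w \<tau> z)"
      unfolding sum_distrib_left sum_subtractf[symmetric]
      using insert.hyps by (intro sum.cong refl) (simp add: algebra_simps)
    then show ?case using insert.IH[of k] insert.IH[of "Suc k"] by simp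
  qed
  obtain \<tau> where \<tau>: "\<tau> \<in> J" "c \<tau> \<noteq> 0" using c by blast
  have "w \<tau> z = 0" for z
  proof -
    have "(\<Sum>\<tau>'\<in>J. c \<tau>' * (\<Prod>\<sigma>\<in>J - {\<tau>}. \<tau>' - \<sigma>) * w \<tau>' z)
        = c \<tau> * (\<Prod>\<sigma>\<in>J - {\<tau>}. \<tau> - \<sigma>) * w \<tau> z"
      using J(1) \<tau>(1) by (subst sum.remove[of _ \<tau>]) (auto intro!: sum.neutral)
    moreover have "(\<Prod>\<sigma>\<in>J - {\<tau>}. \<tau> - \<sigma>) \<noteq> 0" using J(1) by auto
    ultimately show ?thesis using prod_zero[of "J - {\<tau>}" 0 z] J(1) \<tau>(2) by auto
  qed
  then show False using w(2)[OF \<tau>(1)] by blast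
qed

subsection \<open>Differences of sequences of barycentric coordinates\<close>

text \<open>The unknown \<open>(k, i)\<close> (coordinate \<open>i < m\<close> at time \<open>k\<close>) and the equation \<open>r\<close> (component
  \<open>r mod n\<close> at time \<open>r div n\<close>) are placed on one integer line, in blocks of length \<open>n + m\<close> that
  list the \<open>n\<close> equations before the \<open>m\<close> unknowns of the same time. The filter coefficient is
  then a power of \<open>1 / (8 * m)\<close> with exponent the squared distance of the two positions.\<close>

definition unknown_pos :: "nat \<Rightarrow> nat \<Rightarrow> nat \<Rightarrow> nat \<Rightarrow> int" where
  "unknown_pos n m k i = int (k * (n + m) + n + i)"

definition equation_pos :: "nat \<Rightarrow> nat \<Rightarrow> nat \<Rightarrow> int" where
  "equation_pos n m r = int ((r div n) * (n + m) + r mod n)"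

definition filter_coeff :: "nat \<Rightarrow> nat \<Rightarrow> nat \<Rightarrow> nat \<Rightarrow> nat \<Rightarrow> real" where
  "filter_coeff n m l c i = (1 / (8 * real m)) ^ nat ((int (l * (n + m) + n + i) - int c)\<^sup>2)"

definition filtered :: "nat \<Rightarrow> nat \<Rightarrow> nat \<Rightarrow> (nat \<Rightarrow> nat \<Rightarrow> real) \<Rightarrow> nat \<Rightarrow> nat \<Rightarrow> real" where
  "filtered n m L w k c = (\<Sum>l\<le>L. \<Sum>i<m. filter_coeff n m l c i * w (k + l) i)"

text \<open>\<open>S k\<close> and \<open>S' k\<close> are the supports of two probability vectors \<open>u k\<close> and \<open>v k\<close>, and
  \<open>diff_space S S' W\<close> contains the scalar multiples of all sequences \<open>u - v\<close> with these supports
  on the window \<open>k < W\<close>. If the supports are disjoint then the two partial sums of \<open>u k - v k\<close> are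
  \<open>1\<close> and \<open>- 1\<close>; the scalar multiple \<open>\<gamma>\<close> is common to all times, so it costs one free coordinate
  in total, which \<open>free_coords\<close> places at the first time with disjoint supports.\<close>

definition free_coords :: "(nat \<Rightarrow> nat set) \<Rightarrow> (nat \<Rightarrow> nat set) \<Rightarrow> nat \<Rightarrow> nat set" where
  "free_coords S S' k =
    (if S k \<inter> S' k \<noteq> {} then (S k \<union> S' k) - {Max (S k \<union> S' k)}
     else (S k - {Max (S k)}) \<union> (S' k - {Max (S' k)}) \<union>
       (if \<forall>k'<k. S k' \<inter> S' k' \<noteq> {} then {min (Max (S k)) (Max (S' k))} else {}))"

definition diff_space :: "(nat \<Rightarrow> nat set) \<Rightarrow> (nat \<Rightarrow> nat set) \<Rightarrow> nat \<Rightarrow> (nat \<Rightarrow> nat \<Rightarrow> real) set" where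
  "diff_space S S' W = {w. (\<forall>k i. w k i \<noteq> 0 \<longrightarrow> k < W \<and> i \<in> S k \<union> S' k) \<and>
     (\<exists>\<gamma>. \<forall>k<W. if S k \<inter> S' k \<noteq> {} then (\<Sum>i\<in>S k \<union> S' k. w k i) = 0
                 else (\<Sum>i\<in>S k. w k i) = \<gamma> \<and> (\<Sum>i\<in>S' k. w k i) = - \<gamma>)}"

text \<open>Pigeonhole: a sum of at most \<open>K\<close> terms is at most \<open>K\<close> times
  its largest term in absolute value; \<open>a \<noteq> 0\<close> excludes the empty sum.\<close>

lemma exists_large_summand:
  fixes f :: "'i \<Rightarrow> real"
  assumes "finite A" "real (card A) \<le> K" "a \<noteq> 0" "\<bar>a\<bar> \<le> b * \<bar>\<Sum>j\<in>A. f j\<bar>" "0 \<le> b"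
  shows "\<exists>j\<in>A. \<bar>a\<bar> \<le> b * K * \<bar>f j\<bar>"
proof (rule ccontr)
  assume "\<not> ?thesis"
  then have less: "b * K * \<bar>f j\<bar> < \<bar>a\<bar>" if "j \<in> A" for j using that by force
  have ne: "A \<noteq> {}" using assms by auto
  have K: "0 < K" using assms ne by (metis card_gt_0_iff less_le_trans of_nat_0_less_iff)
  have "K * \<bar>a\<bar> \<le> (\<Sum>j\<in>A. b * K * \<bar>f j\<bar>)"
  proof -
    have "K * \<bar>a\<bar> \<le> K * (b * (\<Sum>j\<in>A. \<bar>f j\<bar>))"
      using assms(4,5) K sum_abs[of f A]
      by (intro mult_left_mono) (auto intro: order_trans mult_left_mono)
    then show ?thesis by (simp add: sum_distrib_left mult_ac)
  qed
  also have "\<dots> < (\<Sum>j\<in>A. \<bar>a\<bar>)" using less ne assms by (intro sum_strict_mono) auto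
  also have "\<dots> \<le> K * \<bar>a\<bar>" using assms(2) by (simp add: mult_right_mono)
  finally show False by simp
qed

text \<open>If the supports meet, the union loses one element to the overlap and one to the sum
  condition. If they are disjoint, each has a sum condition of its own, and the extra coordinate
  stands for \<open>\<gamma>\<close>. Thus free coordinates are counted by the two orders, plus one
  at a single time.\<close>

lemma card_free_coords_le:
  assumes "finite (S k)" "finite (S' k)" "S k \<noteq> {}" "S' k \<noteq> {}"
  shows "card (free_coords S S' k) \<le> (card (S k) - 1) + (card (S' k) - 1)
    + (if S k \<inter> S' k = {} \<and> (\<forall>k'<k. S k' \<inter> S' k' \<noteq> {}) then 1 else 0)"
proof (cases "S k \<inter> S' k = {}")
  case True
  have Un3: "card (A \<union> B \<union> C) \<le> card A + card B + card C" for A B C :: "nat set"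
    using card_Un_le[of "A \<union> B" C] card_Un_le[of A B] by linarith
  have "free_coords S S' k = (S k - {Max (S k)}) \<union> (S' k - {Max (S' k)}) \<union>
      (if \<forall>k'<k. S k' \<inter> S' k' \<noteq> {} then {min (Max (S k)) (Max (S' k))} else {})"
    using True by (simp add: free_coords_def)
  then have "card (free_coords S S' k) \<le> card (S k - {Max (S k)}) + card (S' k - {Max (S' k)})
      + card (if \<forall>k'<k. S k' \<inter> S' k' \<noteq> {} then {min (Max (S k)) (Max (S' k))} else {})"
    by (simp only: Un3)
  then show ?thesis using assms True by (auto split: if_splits)
next
  case False
  have "card (S k \<inter> S' k) \<ge> 1" using False assms by (simp add: Suc_le_eq card_gt_0_iff)
  moreover have "card (S k \<union> S' k) + card (S k \<inter> S' k) = card (S k) + card (S' k)"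
    using card_Un_Int[of "S k" "S' k"] assms by simp
  moreover have "card (S k) \<ge> 1" "card (S' k) \<ge> 1"
    using assms by (simp_all add: Suc_le_eq card_gt_0_iff)
  moreover have "card (free_coords S S' k) = card (S k \<union> S' k) - 1"
    using False assms Max_in[of "S k \<union> S' k"] by (simp add: free_coords_def card_Diff_singleton)
  ultimately show ?thesis using False by auto
qed

text \<open>A removed coordinate is recovered from a sum condition; being a maximum, it comes after
  the free coordinates used for it. The scale \<open>\<gamma>\<close> is read off at the first time
  \<open>k0\<close> with disjoint supports, from the support with the smaller maximum:
  \<open>free_coords\<close> has put this maximum back, so the whole support is free, and it lies
  below the maximum of the other one. The factor \<open>2\<close> accounts for the two
  contributions, scale and remaining summands.\<close>

lemma diff_space_dominated:
  assumes fin: "\<And>k. k < W \<Longrightarrow> S k \<subseteq> {..<m} \<and> S k \<noteq> {} \<and> S' k \<subseteq> {..<m} \<and> S' k \<noteq> {}"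
    and w: "w \<in> diff_space S S' W" and nz: "w k i \<noteq> 0"
  shows "\<exists>k'\<le>k. \<exists>i'\<in>free_coords S S' k'. (k' = k \<longrightarrow> i' \<le> i) \<and> \<bar>w k i\<bar> \<le> 2 * real m * \<bar>w k' i'\<bar>"
proof -
  from w nz have k: "k < W" and i: "i \<in> S k \<union> S' k" unfolding diff_space_def by auto
  have fS: "finite (S k)" "finite (S' k)" if "k < W" for k
    using fin[OF that] finite_subset[OF _ finite_lessThan[of m]] by auto
  have cS: "real (card A) \<le> real m" if "k < W" "A \<subseteq> S k \<union> S' k" for k A
    using fin[OF that(1)] that(2) card_mono[of "{..<m}" A] by auto
  have m: "m \<ge> 1" using fin[OF k] by (cases m) auto
  from w obtain \<gamma> where \<gamma>: "\<And>k. k < W \<Longrightarrow> if S k \<inter> S' k \<noteq> {} then (\<Sum>i\<in>S k \<union> S' k. w k i) = 0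
                 else (\<Sum>i\<in>S k. w k i) = \<gamma> \<and> (\<Sum>i\<in>S' k. w k i) = - \<gamma>"
    unfolding diff_space_def by blast
  show ?thesis
  proof (cases "i \<in> free_coords S S' k")
    case True
    have "1 * \<bar>w k i\<bar> \<le> 2 * real m * \<bar>w k i\<bar>" using m by (intro mult_right_mono) auto
    then show ?thesis using True by auto
  next
    case nfree: False
    show ?thesis
    proof (cases "S k \<inter> S' k = {}")
      case meet: False
      have iM: "i = Max (S k \<union> S' k)" using nfree i meet by (auto simp: free_coords_def)
      have "w k i = - (\<Sum>j\<in>S k \<union> S' k - {i}. w k j)"
        using \<gamma>[OF k] meet fS[OF k] sum.remove[OF _ i, of "w k"] by simp
      then obtain j where j: "j \<in> S k \<union> S' k - {i}" "\<bar>w k i\<bar> \<le> 1 * real m * \<bar>w k j\<bar>"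
        using exists_large_summand[of "S k \<union> S' k - {i}" "real m" "w k i" 1 "w k"] fS[OF k] nz
          cS[OF k, of "S k \<union> S' k - {i}"] by auto
      have "j \<in> free_coords S S' k" using j meet iM by (auto simp: free_coords_def)
      moreover have "j \<le> i" unfolding iM using j fS[OF k] by (intro Max_ge) auto
      moreover have "\<bar>w k i\<bar> \<le> 2 * real m * \<bar>w k j\<bar>" using j(2) by (simp add: order_trans)
      ultimately show ?thesis by auto
    next
      case disj: True
      define k0 where "k0 = (LEAST k. S k \<inter> S' k = {})"
      have k0: "S k0 \<inter> S' k0 = {}" unfolding k0_def using disj by (rule LeastI[of "\<lambda>k. S k \<inter> S' k = {}"])
      have k0_le: "k0 \<le> k" unfolding k0_def using disj by (rule Least_le[of "\<lambda>k. S k \<inter> S' k = {}"])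
      have k0_first: "S k' \<inter> S' k' \<noteq> {}" if "k' < k0" for k'
        using not_less_Least[of k' "\<lambda>k. S k \<inter> S' k = {}"] that unfolding k0_def by simp
      have k0W: "k0 < W" using k0_le k by simp
      define i0 where "i0 = min (Max (S k0)) (Max (S' k0))"
      define A where "A = (if Max (S k0) \<le> Max (S' k0) then S k0 else S' k0)"
      have A: "A \<subseteq> S k0 \<union> S' k0" "i0 = Max A" "\<bar>\<Sum>j\<in>A. w k0 j\<bar> = \<bar>\<gamma>\<bar>" "finite A"
        using \<gamma>[OF k0W] k0 fS[OF k0W] by (auto simp: A_def i0_def)
      have A_free: "A \<subseteq> free_coords S S' k0"
        using k0 k0_first by (auto simp: A_def free_coords_def min_def)
      define B where "B = (if i \<in> S k then S k else S' k)"
      have B: "i \<in> B" "i = Max B" "\<bar>\<Sum>j\<in>B. w k j\<bar> = \<bar>\<gamma>\<bar>" "finite B" "B \<subseteq> S k \<union> S' k"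
          "B - {i} \<subseteq> free_coords S S' k"
        using \<gamma>[OF k] disj fS[OF k] i nfree by (auto simp: B_def free_coords_def)
      have "w k i = (\<Sum>j\<in>B. w k j) - (\<Sum>j\<in>B - {i}. w k j)"
        using sum.remove[OF B(4,1), of "w k"] by simp
      then have "\<bar>w k i\<bar> \<le> \<bar>\<gamma>\<bar> + \<bar>\<Sum>j\<in>B - {i}. w k j\<bar>" using B(3) by linarith
      then consider "\<bar>w k i\<bar> \<le> 2 * \<bar>\<Sum>j\<in>A. w k0 j\<bar>" | "\<bar>w k i\<bar> \<le> 2 * \<bar>\<Sum>j\<in>B - {i}. w k j\<bar>"
        using A(3) by linarith
      then show ?thesis
      proof cases
        case 1
        from exists_large_summand[OF A(4) cS[OF k0W A(1)] nz this] obtain j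
          where j: "j \<in> A" "\<bar>w k i\<bar> \<le> 2 * real m * \<bar>w k0 j\<bar>" by auto
        have "j \<le> i" if "k0 = k"
        proof -
          have "j \<le> i0" using j A by simp
          also have "i0 \<le> Max B" unfolding i0_def B_def using that by auto
          also have "Max B = i" by (rule B(2)[symmetric])
          finally show ?thesis .
        qed
        then show ?thesis using j A_free k0_le by blast
      next
        case 2
        have Bi: "finite (B - {i})" "B - {i} \<subseteq> S k \<union> S' k" using B(4,5) by auto
        from exists_large_summand[OF Bi(1) cS[OF k Bi(2)] nz 2] obtain j
          where j: "j \<in> B - {i}" "\<bar>w k i\<bar> \<le> 2 * real m * \<bar>w k j\<bar>" by auto
        have "j \<le> Max B" using j(1) B(4) by simp
        then have "j \<le> i" using B(2) by simp
        then show ?thesis using j B(6) by blast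
      qed
    qed
  qed
qed

text \<open>An instance of \<open>gaussian_toeplitz_injective\<close> with the free coordinates as
  \<open>X\<close>. The counting conditions place the equation matched with an unknown of time
  \<open>k\<close> between the times \<open>k - L\<close> and \<open>k\<close>: \<open>start\<close>
  keeps it to the left of the unknown, \<open>band\<close> keeps the unknown within reach of the
  filter.\<close>

lemma filtered_injective:
  assumes n: "n \<ge> 1"
    and fin: "\<And>k. k < W \<Longrightarrow> S k \<subseteq> {..<m} \<and> S k \<noteq> {} \<and> S' k \<subseteq> {..<m} \<and> S' k \<noteq> {}"
    and w: "w \<in> diff_space S S' W"
    and start: "\<And>k. k < W \<Longrightarrow> (\<Sum>k'\<le>k. card (free_coords S S' k')) \<le> n * (k + 1)"
    and band: "\<And>k r. k < W \<Longrightarrow> (\<Sum>k'<k. card (free_coords S S' k')) \<le> r \<Longrightarrow> k \<le> r div n + L"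
    and eqs: "\<And>r. r < (\<Sum>k<W. card (free_coords S S' k)) \<Longrightarrow> filtered n m L w (r div n) (r mod n) = 0"
  shows "w = (\<lambda>_ _. 0)"
proof -
  define B where "B = n + m"
  define t where "t = 1 / (8 * real m)"
  let ?pos = "unknown_pos n m" and ?Y = "equation_pos n m" and ?fr = "free_coords S S'"
  have frm: "?fr k \<subseteq> {..<m}" if "k < W" for k
  proof -
    have f: "finite (S k)" "finite (S' k)" using fin[OF that] finite_subset[OF _ finite_lessThan[of m]] by auto
    have "Max (S k) \<in> S k" "Max (S' k) \<in> S' k" using f fin[OF that] Max_in by auto
    then have "Max (S k) < m" "Max (S' k) < m" using fin[OF that] by auto
    then show ?thesis using fin[OF that] by (auto simp: free_coords_def split: if_splits)
  qed
  \<comment> \<open>\<open>kap\<close> and \<open>idx\<close> decode a position: the number of its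
    block, and the offset after the \<open>n\<close> equations of that block.\<close>
  define kap where "kap z = nat z div B" for z
  define idx where "idx z = nat z mod B - n" for z
  have kap_pos [simp]: "kap (?pos k i) = k" and idx_pos [simp]: "idx (?pos k i) = i" if "i < m" for k i
  proof -
    have "nat (?pos k i) = (n + i) + B * k"
      unfolding unknown_pos_def nat_int B_def by (simp add: algebra_simps)
    moreover have "n + i < B" using that by (simp add: B_def)
    ultimately show "kap (?pos k i) = k" "idx (?pos k i) = i" by (simp_all add: kap_def idx_def)
  qed
  have pos_less: "?pos k i < ?pos k' i'" if "k < k'" "i < m" for k i k' i'
  proof -
    have "k * B + n + i < (k + 1) * B" using that(2) by (simp add: B_def)
    also have "\<dots> \<le> k' * B" using that(1) by (intro mult_right_mono) auto
    also have "\<dots> \<le> k' * B + n + i'" by simp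
    finally show ?thesis unfolding unknown_pos_def B_def by (simp only: of_nat_less_iff)
  qed
  define P where "P k = ?pos k ` ?fr k" for k
  define X where "X K = (\<Union>k<K. P k)" for K
  define Z where "Z = (\<Union>k<W. ?pos k ` {..<m})"
  have finfr: "finite (?fr k)" if "k < W" for k using frm[OF that] by (rule finite_subset) simp
  have card_X: "card (X K) = (\<Sum>k<K. card (?fr k))" if "K \<le> W" for K
  proof -
    have "card (X K) = (\<Sum>k<K. card (P k))"
      unfolding X_def
    proof (rule card_UN_disjoint)
      show "\<forall>k\<in>{..<K}. finite (P k)" using finfr that by (auto simp: P_def)
      show "\<forall>k\<in>{..<K}. \<forall>k'\<in>{..<K}. k \<noteq> k' \<longrightarrow> P k \<inter> P k' = {}"
      proof (intro ballI impI)
        fix k k' assume kk: "k \<in> {..<K}" "k' \<in> {..<K}" "k \<noteq> k'"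
        then have "?fr k \<subseteq> {..<m}" "?fr k' \<subseteq> {..<m}" using frm that by auto
        then have "kap ` P k \<subseteq> {k}" "kap ` P k' \<subseteq> {k'}" by (auto simp: P_def)
        then show "P k \<inter> P k' = {}" using kk(3) by blast
      qed
    qed simp
    also have "\<dots> = (\<Sum>k<K. card (?fr k))"
      unfolding P_def by (intro sum.cong refl card_image) (auto simp: inj_on_def unknown_pos_def)
    finally show ?thesis .
  qed
  have finX: "finite (X K)" if "K \<le> W" for K using finfr that by (auto simp: X_def P_def)
  define rk where "rk x = card {x'\<in>X W. x' < x}" for x
  have rk: "(\<Sum>k'<k. card (?fr k')) \<le> rk (?pos k i)" "rk (?pos k i) < (\<Sum>k'\<le>k. card (?fr k'))"
    if k: "k < W" and i: "i \<in> ?fr k" for k i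
  proof -
    have im: "i < m" using frm[OF k] i by auto
    have "X k \<subseteq> {x'\<in>X W. x' < ?pos k i}"
    proof
      fix x' assume "x' \<in> X k"
      then obtain k' i' where k': "k' < k" "i' \<in> ?fr k'" "x' = ?pos k' i'"
        unfolding X_def P_def by auto
      have "i' < m" using frm[of k'] k' k by auto
      then have "x' < ?pos k i" using pos_less[of k' k i' i] k' by simp
      moreover have "x' \<in> X W" using k' k by (auto simp: X_def P_def)
      ultimately show "x' \<in> {x'\<in>X W. x' < ?pos k i}" by simp
    qed
    moreover have "finite {x'\<in>X W. x' < ?pos k i}" using finX[of W] by simp
    ultimately have "card (X k) \<le> rk (?pos k i)" unfolding rk_def by (intro card_mono)
    then show "(\<Sum>k'<k. card (?fr k')) \<le> rk (?pos k i)" using card_X[of k] k by simp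
    have "{x'\<in>X W. x' < ?pos k i} \<subset> X (Suc k)"
    proof
      show "{x'\<in>X W. x' < ?pos k i} \<subseteq> X (Suc k)"
      proof
        fix x' assume x': "x' \<in> {x'\<in>X W. x' < ?pos k i}"
        then obtain k' i' where k': "k' < W" "i' \<in> ?fr k'" "x' = ?pos k' i'"
          unfolding X_def P_def by auto
        have "\<not> k < k'" using pos_less[of k k' i i'] im x' k'(3) by auto
        then show "x' \<in> X (Suc k)" using k' by (auto simp: X_def P_def)
      qed
      show "{x'\<in>X W. x' < ?pos k i} \<noteq> X (Suc k)" using i by (auto simp: X_def P_def)
    qed
    then have "rk (?pos k i) < card (X (Suc k))"
      unfolding rk_def using finX[of "Suc k"] k by (intro psubset_card_mono) auto
    then show "rk (?pos k i) < (\<Sum>k'\<le>k. card (?fr k'))"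
      using card_X[of "Suc k"] k by (simp add: lessThan_Suc_atMost)
  qed
  have rk_div: "rk (?pos k i) div n \<le> k" "k \<le> rk (?pos k i) div n + L" "rk (?pos k i) < (\<Sum>k<W. card (?fr k))"
    if k: "k < W" and i: "i \<in> ?fr k" for k i
  proof -
    have "rk (?pos k i) < n * (k + 1)" using rk(2)[OF k i] start[OF k] by simp
    then show "rk (?pos k i) div n \<le> k" using n by (simp add: less_mult_imp_div_less mult.commute flip: less_Suc_eq_le)
    show "k \<le> rk (?pos k i) div n + L" using band[OF k rk(1)[OF k i]] .
    show "rk (?pos k i) < (\<Sum>k<W. card (?fr k))"
    proof -
      have "(\<Sum>k'\<le>k. card (?fr k')) \<le> (\<Sum>k<W. card (?fr k))"
        using k by (intro sum_mono2) auto
      then show ?thesis using rk(2)[OF k i] by simp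
    qed
  qed
  \<comment> \<open>The filter sees only \<open>L\<close> steps ahead, so the Gaussian kernel is cut
    off to this band. Matched pairs lie inside the band and keep their full entry.\<close>
  define K where "K z r = (if r div n \<le> kap z \<and> kap z \<le> r div n + L
    then t ^ nat ((z - ?Y r)\<^sup>2) else 0)" for z r
  define wz where "wz z = w (kap z) (idx z)" for z
  have w0: "w k i = 0" if "\<not> (k < W \<and> i < m)" for k i
  proof (rule ccontr)
    assume "w k i \<noteq> 0"
    then have "k < W \<and> i \<in> S k \<union> S' k" using w unfolding diff_space_def by blast
    then show False using fin[of k] that by auto
  qed
  have m: "m \<ge> 1" if "W > 0" using fin[OF that] by (cases m) auto
  have coeff: "filter_coeff n m l (r mod n) i = t ^ nat ((?pos (r div n + l) i - ?Y r)\<^sup>2)" for l r i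
  proof -
    have "?pos (a + l) i - int (a * (n + m) + c) = int (l * (n + m) + n + i) - int c" for a c
      by (simp add: unknown_pos_def algebra_simps)
    then show ?thesis by (simp only: filter_coeff_def t_def equation_pos_def)
  qed
  have sumZ: "(\<Sum>z\<in>Z. K z r * wz z) = filtered n m L w (r div n) (r mod n)" for r
  proof -
    have "(\<Sum>z\<in>Z. K z r * wz z) = (\<Sum>k<W. \<Sum>z\<in>?pos k ` {..<m}. K z r * wz z)"
      unfolding Z_def
    proof (rule sum.UNION_disjoint)
      show "\<forall>k\<in>{..<W}. \<forall>k'\<in>{..<W}. k \<noteq> k' \<longrightarrow> ?pos k ` {..<m} \<inter> ?pos k' ` {..<m} = {}"
      proof (intro ballI impI)
        fix k k' :: nat assume "k \<noteq> k'"
        moreover have "kap z = k" if "z \<in> ?pos k ` {..<m}" for z k using that by auto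
        ultimately show "?pos k ` {..<m} \<inter> ?pos k' ` {..<m} = {}" by (metis disjoint_iff)
      qed
    qed auto
    also have "\<dots> = (\<Sum>k<W. \<Sum>i<m. K (?pos k i) r * w k i)"
    proof (intro sum.cong refl)
      fix k
      have "inj_on (?pos k) {..<m}" by (simp add: inj_on_def unknown_pos_def)
      then show "(\<Sum>z\<in>?pos k ` {..<m}. K z r * wz z) = (\<Sum>i<m. K (?pos k i) r * w k i)"
        by (simp add: sum.reindex wz_def)
    qed
    also have "\<dots> = (\<Sum>k\<in>{r div n..r div n + L}. \<Sum>i<m. K (?pos k i) r * w k i)"
    proof -
      have "(\<Sum>k<W. \<Sum>i<m. K (?pos k i) r * w k i) = (\<Sum>k\<in>{..<W} \<inter> {r div n..r div n + L}. \<Sum>i<m. K (?pos k i) r * w k i)"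
      proof (rule sum.mono_neutral_right)
        show "\<forall>k\<in>{..<W} - {..<W} \<inter> {r div n..r div n + L}. (\<Sum>i<m. K (?pos k i) r * w k i) = 0"
          by (intro ballI sum.neutral) (auto simp: K_def)
      qed auto
      also have "\<dots> = (\<Sum>k\<in>{r div n..r div n + L}. \<Sum>i<m. K (?pos k i) r * w k i)"
      proof (rule sum.mono_neutral_left)
        show "\<forall>k\<in>{r div n..r div n + L} - {..<W} \<inter> {r div n..r div n + L}. (\<Sum>i<m. K (?pos k i) r * w k i) = 0"
          by (intro ballI sum.neutral) (auto simp: w0)
      qed auto
      finally show ?thesis .
    qed
    also have "\<dots> = (\<Sum>l\<in>{0..L}. \<Sum>i<m. K (?pos (r div n + l) i) r * w (r div n + l) i)"
      using sum.shift_bounds_cl_nat_ivl[of "\<lambda>k. \<Sum>i<m. K (?pos k i) r * w k i" 0 "r div n" L]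
      by (simp only: add_0 add_0_right add.commute[of _ "r div n"])
    also have "\<dots> = filtered n m L w (r div n) (r mod n)"
      unfolding filtered_def atMost_atLeast0
    proof (intro sum.cong refl)
      fix l i assume "l \<in> {0..L}" "i \<in> {..<m}"
      then have "K (?pos (r div n + l) i) r = filter_coeff n m l (r mod n) i"
        unfolding coeff K_def by simp
      then show "K (?pos (r div n + l) i) r * w (r div n + l) i = filter_coeff n m l (r mod n) i * w (r div n + l) i"
        by simp
    qed
    finally show ?thesis .
  qed
  have "wz z = 0" if z: "z \<in> Z" for z
  proof (rule gaussian_toeplitz_injective[of Z "X W" ?Y t "2 * real m" wz K])
    have W: "W > 0" using z by (cases W) (auto simp: Z_def)
    show "finite Z" by (simp add: Z_def)
    show "X W \<subseteq> Z" using frm by (auto simp: X_def P_def Z_def)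
    show "strict_mono ?Y"
      unfolding strict_mono_Suc_iff
    proof
      fix r
      show "?Y r < ?Y (Suc r)"
      proof (cases "Suc (r mod n) = n")
        case True
        then have "Suc r mod n = 0" "Suc r div n = Suc (r div n)" by (simp_all add: mod_Suc div_Suc)
        moreover have "r mod n < n" using n by simp
        ultimately show ?thesis by (simp add: equation_pos_def)
      next
        case False
        then have "Suc r mod n = Suc (r mod n)" "Suc r div n = r div n" by (simp_all add: mod_Suc div_Suc)
        then show ?thesis by (simp add: equation_pos_def)
      qed
    qed
    show "0 < t" "t < 1" "1 \<le> 2 * real m" using m[OF W] by (auto simp: t_def field_simps)
    \<comment> \<open>The left side is \<open>1 / 2\<close> and \<open>t\<close> is at most
      \<open>1 / 8\<close>; this is the purpose of the \<open>8\<close> in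
      \<open>filter_coeff\<close>.\<close>
    show "2 * (2 * real m) * t < 1 - t" using m[OF W] by (simp add: t_def field_simps)
    show "z \<in> Z" by fact
    show "\<bar>K z r\<bar> \<le> t ^ nat ((z - ?Y r)\<^sup>2)" for z r by (simp add: K_def t_def)
    fix x assume "x \<in> X W"
    then obtain k i where x: "k < W" "i \<in> ?fr k" "x = ?pos k i" by (auto simp: X_def P_def)
    have "i < m" using frm[OF x(1)] x(2) by auto
    show "?Y (card {x'\<in>X W. x' < x}) \<le> x"
    proof -
      have "rk x div n * B \<le> k * B" using rk_div(1)[OF x(1,2)] x(3) by (intro mult_right_mono) auto
      moreover have "rk x mod n < n" using n by simp
      ultimately have "rk x div n * B + rk x mod n \<le> k * B + n + i" by linarith
      then have "int (rk x div n * B + rk x mod n) \<le> int (k * B + n + i)" by (simp only: of_nat_le_iff)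
      also have "\<dots> = x" by (simp only: x(3) unknown_pos_def B_def)
      finally show ?thesis unfolding rk_def[symmetric] by (simp only: equation_pos_def B_def)
    qed
    show "K x (card {x'\<in>X W. x' < x}) = t ^ nat ((x - ?Y (card {x'\<in>X W. x' < x}))\<^sup>2)"
      unfolding rk_def[symmetric] using rk_div[OF x(1,2)] x(3) \<open>i < m\<close> by (simp add: K_def)
    show "(\<Sum>z\<in>Z. K z (card {x'\<in>X W. x' < x}) * wz z) = 0"
      unfolding rk_def[symmetric] sumZ x(3) using rk_div(3)[OF x(1,2)] by (rule eqs)
  next
    fix z assume z: "z \<in> Z" "wz z \<noteq> 0"
    then obtain k i where ki: "k < W" "i < m" "z = ?pos k i" by (auto simp: Z_def)
    then have "w k i \<noteq> 0" using z by (simp add: wz_def)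
    from diff_space_dominated[OF fin w this] obtain k' i' where
      k': "k' \<le> k" "i' \<in> ?fr k'" "k' = k \<longrightarrow> i' \<le> i" "\<bar>w k i\<bar> \<le> 2 * real m * \<bar>w k' i'\<bar>" by auto
    have "k' < W" using k' ki by simp
    then have i'm: "i' < m" using frm[of k'] k'(2) by auto
    have "?pos k' i' \<le> ?pos k i"
    proof (cases "k' = k")
      case True
      then show ?thesis using k' by (simp add: unknown_pos_def)
    next
      case False
      then show ?thesis using pos_less[of k' k i' i] k' i'm by simp
    qed
    moreover have "?pos k' i' \<in> X W" using k' ki by (auto simp: X_def P_def)
    ultimately show "\<exists>x\<in>X W. x \<le> z \<and> \<bar>wz z\<bar> \<le> 2 * real m * \<bar>wz x\<bar>"
      using k' ki i'm by (intro bexI[of _ "?pos k' i'"]) (auto simp: wz_def)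
  qed
  then have Z0: "\<And>z. z \<in> Z \<Longrightarrow> wz z = 0" .
  have "w k i = 0" if "k < W" "i < m" for k i
  proof -
    have "?pos k i \<in> Z" using that by (auto simp: Z_def)
    from Z0[OF this] show ?thesis using that by (simp add: wz_def)
  qed
  then show ?thesis using w0 by (intro ext) blast
qed

subsection \<open>Singular parameters of the perturbation\<close>

text \<open>The strict inequality is one between integers, so each block falls short of
  \<open>b\<close> by at least one. The total gain \<open>q\<close> can later absorb any bounded
  error.\<close>

lemma block_sum_le:
  fixes e :: "int \<Rightarrow> nat"
  assumes "\<And>k. (\<Sum>j<N. e (k + int j)) < b"
  shows "(\<Sum>j<q * N. e (k + int j)) + q \<le> q * b"
proof (induction q)
  case (Suc q)
  have "(\<Sum>j<Suc q * N. e (k + int j)) = (\<Sum>j<q * N. e (k + int j)) + (\<Sum>j<N. e (k + int (j + q * N)))"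
    using sum.nat_group[of "\<lambda>j. e (k + int j)" N "Suc q", symmetric] sum.nat_group[of "\<lambda>j. e (k + int j)" N q, symmetric]
      sum.shift_bounds_nat_ivl[of "\<lambda>j. e (k + int j)" 0 "q * N" N]
    by (simp add: mult.commute add.commute atLeast0LessThan[symmetric])
  moreover have "(\<Sum>j<N. e (k + int (j + q * N))) < b"
    using assms[of "k + int (q * N)"] by (simp add: add_ac)
  ultimately show ?case using Suc by simp
qed simp

text \<open>The last maximum of the partial sums of \<open>e - n\<close> is a starting point from which all
  partial sums are negative.\<close>

lemma exists_good_start:
  fixes e :: "int \<Rightarrow> nat"
  assumes N: "N \<ge> 1" and avg: "\<And>k. (\<Sum>j<N. e (k + int j)) < n * N" and D: "\<And>k. e k \<le> D"
  defines "R \<equiv> N * (D * N + 1)"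
  shows "\<exists>s. - int R \<le> s \<and> s \<le> 0 \<and> (\<forall>p. (\<Sum>j\<le>p. e (s + int j)) + 1 \<le> n * (p + 1))"
proof -
  define h where "h t = (\<Sum>j<t. int (e (- int R + int j)) - int n)" for t :: nat
  \<comment> \<open>More than \<open>R\<close> steps contain at least \<open>D * N + 1\<close>
    complete blocks, each gaining one, while the incomplete last block costs at most
    \<open>D * N\<close>. This explains the value of \<open>R\<close>; since \<open>h 0 = 0\<close>,
    no later time can compete for the maximum.\<close>
  have h_neg: "h t < 0" if "t > R" for t
  proof -
    define q where "q = t div N"
    define r where "r = t mod N"
    have t: "t = q * N + r" "r < N" using N by (auto simp: q_def r_def)
    have q: "D * N + 1 \<le> q" using that N unfolding R_def q_def by (simp add: less_eq_div_iff_mult_less_eq mult.commute)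
    have "h t = int (\<Sum>j<t. e (- int R + int j)) - int (n * t)"
      by (simp add: h_def sum_subtractf mult.commute)
    moreover have "(\<Sum>j<t. e (- int R + int j)) \<le> (\<Sum>j<q * N. e (- int R + int j)) + D * N"
    proof -
      have "(\<Sum>j<t. e (- int R + int j)) = (\<Sum>j<q * N. e (- int R + int j)) + (\<Sum>j\<in>{q * N..<t}. e (- int R + int j))"
        using t by (subst sum.union_disjoint[symmetric]) (auto intro!: sum.cong)
      moreover have "(\<Sum>j\<in>{q * N..<t}. e (- int R + int j)) \<le> (\<Sum>j\<in>{q * N..<t}. D)" by (intro sum_mono D)
      moreover have "(\<Sum>j\<in>{q * N..<t}. D) = D * r" using t by simp
      moreover have "D * r \<le> D * N" using t by (intro mult_left_mono) auto
      ultimately show ?thesis by linarith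
    qed
    moreover have "(\<Sum>j<q * N. e (- int R + int j)) + q \<le> q * (n * N)"
      using block_sum_le[of e N "n * N" "- int R" q] avg by blast
    moreover have "q * (n * N) \<le> n * t" using t by (simp add: algebra_simps)
    ultimately have "h t \<le> int (n * t) - int q + int (D * N) - int (n * t)" by linarith
    also have "\<dots> < 0"
    proof -
      have "int (D * N) < int q" using q by (simp only: of_nat_less_iff)
      then show ?thesis by linarith
    qed
    finally show ?thesis .
  qed
  define M where "M = Max (h ` {..R})"
  define t0 where "t0 = Max {t. t \<le> R \<and> h t = M}"
  have "M \<in> h ` {..R}" unfolding M_def by (intro Max_in) auto
  then have "{t. t \<le> R \<and> h t = M} \<noteq> {}" by auto
  from Max_in[OF _ this] have t0: "t0 \<le> R" "h t0 = M" by (auto simp: t0_def)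
  have M: "h t \<le> M" if "t \<le> R" for t using that unfolding M_def by (intro Max_ge) auto
  have less: "h t < h t0" if "t > t0" for t
  proof (cases "t \<le> R")
    case True
    have "h t \<noteq> M"
    proof
      assume "h t = M"
      then have "t \<le> t0" unfolding t0_def using True by (intro Max_ge) auto
      then show False using that by simp
    qed
    then show ?thesis using M[OF True] t0 by simp
  next
    case False
    then have "h t < 0" using h_neg by simp
    also have "0 = h 0" by (simp add: h_def)
    also have "\<dots> \<le> h t0" using M[of 0] t0 by simp
    finally show ?thesis .
  qed
  \<comment> \<open>Beyond the last maximum the integer \<open>h\<close> is strictly smaller. This
    yields the \<open>+ 1\<close>, which will pay for the coordinate of the common scale.\<close>
  have "(\<Sum>j\<le>p. e (- int R + int t0 + int j)) + 1 \<le> n * (p + 1)" for p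
  proof -
    have "h (t0 + (p + 1)) = h t0 + (\<Sum>j<p + 1. int (e (- int R + int t0 + int j)) - int n)"
      unfolding h_def
    proof -
      have "(\<Sum>j<t0 + q. g j) = (\<Sum>j<t0. g j) + (\<Sum>j<q. g (t0 + j))" for g :: "nat \<Rightarrow> int" and q
        by (induction q) auto
      then show "(\<Sum>j<t0 + (p + 1). int (e (- int R + int j)) - int n) = (\<Sum>j<t0. int (e (- int R + int j)) - int n)
          + (\<Sum>j<p + 1. int (e (- int R + int t0 + int j)) - int n)"
        by (simp only: of_nat_add add.assoc)
    qed
    then have "(\<Sum>j<p + 1. int (e (- int R + int t0 + int j)) - int n) < 0" using less[of "t0 + (p + 1)"] by simp
    then have "int (\<Sum>j<p+1. e (- int R + int t0 + int j)) < int (n * (p + 1))"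
      by (simp add: sum_subtractf algebra_simps)
    then have "(\<Sum>j<p+1. e (- int R + int t0 + int j)) < n * (p + 1)" by (simp only: of_nat_less_iff)
    then show ?thesis by (simp add: lessThan_Suc_atMost)
  qed
  then show ?thesis using t0 by (intro exI[of _ "- int R + int t0"]) auto
qed

text \<open>The points of the system enter only through the supports \<open>S\<close>,
  \<open>S'\<close> on the window and not through the actual coordinates; this reduces uncountably
  many pairs to countably many conditions on \<open>\<tau>\<close>.\<close>

definition singular_parameters ::
  "(nat \<Rightarrow> nat \<Rightarrow> real) \<Rightarrow> nat \<Rightarrow> nat \<Rightarrow> nat \<Rightarrow> (nat \<Rightarrow> nat set) \<Rightarrow> (nat \<Rightarrow> nat set) \<Rightarrow> nat \<Rightarrow> nat \<Rightarrow> real set" where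
  "singular_parameters a n m L S S' W R =
    {\<tau>. \<exists>w\<in>diff_space S S' W. w \<noteq> (\<lambda>_ _. 0) \<and>
      (\<forall>r<R. (\<Sum>i<m. a (r mod n) i * w (r div n) i) + \<tau> * filtered n m L w (r div n) (r mod n) = 0)}"

lemma diff_space_cong:
  assumes "\<And>k. k < W \<Longrightarrow> S k = P k \<and> S' k = P' k"
  shows "diff_space S S' W = diff_space P P' W"
proof -
  have "(\<forall>k i. w k i \<noteq> 0 \<longrightarrow> k < W \<and> i \<in> S k \<union> S' k) \<longleftrightarrow> (\<forall>k i. w k i \<noteq> 0 \<longrightarrow> k < W \<and> i \<in> P k \<union> P' k)" for w :: "nat \<Rightarrow> nat \<Rightarrow> real"
    using assms by blast
  moreover have "(\<forall>k<W. if S k \<inter> S' k \<noteq> {} then (\<Sum>i\<in>S k \<union> S' k. w k i) = 0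
        else (\<Sum>i\<in>S k. w k i) = g \<and> (\<Sum>i\<in>S' k. w k i) = - g) \<longleftrightarrow>
      (\<forall>k<W. if P k \<inter> P' k \<noteq> {} then (\<Sum>i\<in>P k \<union> P' k. w k i) = 0
        else (\<Sum>i\<in>P k. w k i) = g \<and> (\<Sum>i\<in>P' k. w k i) = - g)" for w and g :: real
    by (intro all_cong1 imp_cong refl) (simp add: assms)
  ultimately show ?thesis unfolding diff_space_def by simp
qed

text \<open>The scales combine in the same way as the sequences. With a fixed scale,
  \<open>diff_space\<close> would only be affine, and the pencil argument could not be
  applied.\<close>

lemma diff_space_combination:
  assumes "w \<in> diff_space S S' W" "w' \<in> diff_space S S' W"
  shows "(\<lambda>k i. a * w k i + b * w' k i) \<in> diff_space S S' W"
proof -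
  from assms obtain g g' where
    g: "\<forall>k<W. if S k \<inter> S' k \<noteq> {} then (\<Sum>i\<in>S k \<union> S' k. w k i) = 0
         else (\<Sum>i\<in>S k. w k i) = g \<and> (\<Sum>i\<in>S' k. w k i) = - g" and
    g': "\<forall>k<W. if S k \<inter> S' k \<noteq> {} then (\<Sum>i\<in>S k \<union> S' k. w' k i) = 0
         else (\<Sum>i\<in>S k. w' k i) = g' \<and> (\<Sum>i\<in>S' k. w' k i) = - g'"
    unfolding diff_space_def by auto
  have "\<forall>k<W. if S k \<inter> S' k \<noteq> {} then (\<Sum>i\<in>S k \<union> S' k. a * w k i + b * w' k i) = 0
         else (\<Sum>i\<in>S k. a * w k i + b * w' k i) = a * g + b * g'
           \<and> (\<Sum>i\<in>S' k. a * w k i + b * w' k i) = - (a * g + b * g')"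
    using g g' by (auto simp: sum.distrib simp flip: sum_distrib_left)
  moreover have "k < W \<and> i \<in> S k \<union> S' k" if "a * w k i + b * w' k i \<noteq> 0" for k i
  proof -
    have "w k i \<noteq> 0 \<or> w' k i \<noteq> 0" using that by auto
    then show ?thesis using assms unfolding diff_space_def by auto
  qed
  ultimately show ?thesis unfolding diff_space_def by blast
qed

lemma filtered_combination:
  "filtered n m L (\<lambda>k i. a * w k i + b * w' k i) k c = a * filtered n m L w k c + b * filtered n m L w' k c"
  unfolding filtered_def by (simp add: sum_distrib_left sum.distrib[symmetric] algebra_simps)

lemma finite_singular_parameters_pattern:
  assumes inj: "\<And>w. w \<in> diff_space S S' W \<Longrightarrow>
      (\<And>r. r < R \<Longrightarrow> filtered n m L w (r div n) (r mod n) = 0) \<Longrightarrow> w = (\<lambda>_ _. 0)"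
  shows "finite (singular_parameters a n m L S S' W R)"
proof -
  define E where "E = {w. curry w \<in> diff_space S S' W}"
  define T0 where "T0 w r = (\<Sum>i<m. a (r mod n) i * w (r div n, i))" for w :: "nat \<times> nat \<Rightarrow> real" and r
  define T1 where "T1 w r = filtered n m L (curry w) (r div n) (r mod n)" for w :: "nat \<times> nat \<Rightarrow> real" and r
  have "finite {\<tau>. \<exists>w\<in>E. w \<noteq> (\<lambda>_. 0) \<and> (\<forall>r<R. T0 w r + \<tau> * T1 w r = 0)}"
  proof (rule finite_singular_parameters)
    fix w w' :: "nat \<times> nat \<Rightarrow> real" and a b
    have "curry (\<lambda>z. a * w z + b * w' z) = (\<lambda>k i. a * curry w k i + b * curry w' k i)"
      by (simp add: curry_def)
    then show "(\<lambda>z. a * w z + b * w' z) \<in> E" if "w \<in> E" "w' \<in> E"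
      using that diff_space_combination[of "curry w" S S' W "curry w'" a b] by (simp add: E_def)
  next
    fix w w' :: "nat \<times> nat \<Rightarrow> real" and b b' r
    show "T0 (\<lambda>z. b * w z + b' * w' z) r = b * T0 w r + b' * T0 w' r"
      unfolding T0_def by (simp add: sum_distrib_left sum.distrib[symmetric] algebra_simps)
    show "T1 (\<lambda>z. b * w z + b' * w' z) r = b * T1 w r + b' * T1 w' r"
      unfolding T1_def using filtered_combination[of n m L b "curry w" b' "curry w'"] by (simp add: curry_def)
  next
    fix w assume w: "w \<in> E" "\<And>r. r < R \<Longrightarrow> T1 w r = 0"
    then have "curry w = (\<lambda>_ _. 0)" by (intro inj) (auto simp: E_def T1_def)
    then have "curry w k i = 0" for k i by simp
    then show "w = (\<lambda>_. 0)" by (auto simp: fun_eq_iff)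
  qed
  moreover have "singular_parameters a n m L S S' W R
      \<subseteq> {\<tau>. \<exists>w\<in>E. w \<noteq> (\<lambda>_. 0) \<and> (\<forall>r<R. T0 w r + \<tau> * T1 w r = 0)}"
  proof
    fix \<tau> assume "\<tau> \<in> singular_parameters a n m L S S' W R"
    then obtain w where w: "w \<in> diff_space S S' W" "w \<noteq> (\<lambda>_ _. 0)"
      "\<forall>r<R. (\<Sum>i<m. a (r mod n) i * w (r div n) i) + \<tau> * filtered n m L w (r div n) (r mod n) = 0"
      unfolding singular_parameters_def by blast
    have "case_prod w \<in> E" using w by (simp add: E_def)
    moreover have "case_prod w \<noteq> (\<lambda>_. 0)"
    proof
      assume "case_prod w = (\<lambda>_. 0)"
      then have "w k i = 0" for k i by (metis case_prod_conv)
      then show False using w(2) by blast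
    qed
    moreover have "\<forall>r<R. T0 (case_prod w) r + \<tau> * T1 (case_prod w) r = 0" using w(3) by (simp add: T0_def T1_def)
    ultimately show "\<tau> \<in> {\<tau>. \<exists>w\<in>E. w \<noteq> (\<lambda>_. 0) \<and> (\<forall>r<R. T0 w r + \<tau> * T1 w r = 0)}" by blast
  qed
  ultimately show ?thesis by (rule rev_finite_subset)
qed

definition barycentric :: "nat \<Rightarrow> (nat \<Rightarrow> real) \<Rightarrow> bool" where
  "barycentric m u \<longleftrightarrow> (\<forall>i. u i \<noteq> 0 \<longrightarrow> i < m) \<and> (\<Sum>i<m. u i) = 1"

text \<open>The window starts at a good starting point \<open>s \<in> [- L, 0]\<close> and ends at the first time at which the
  number of free coordinates seen by the equations so far does not exceed the number of
  equations. Then the \<open>r\<close>-th free coordinate can be matched with the \<open>r\<close>-th equation.\<close>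

lemma pair_singular_parameter:
  fixes u v :: "int \<Rightarrow> nat \<Rightarrow> real"
  assumes n: "n \<ge> 1" and N: "N \<ge> 1" and L: "N * (2 * m * N + 1) \<le> L"
    and u: "\<And>k. barycentric m (u k)" and v: "\<And>k. barycentric m (v k)"
    and avg: "\<And>k. (\<Sum>j<N. (card {i. u (k + int j) i \<noteq> 0} - 1) + (card {i. v (k + int j) i \<noteq> 0} - 1)) < n * N"
    and eqs: "\<And>k c. c < n \<Longrightarrow> (\<Sum>i<m. a c i * (u k i - v k i))
       + \<tau> * (\<Sum>l\<le>L. \<Sum>i<m. filter_coeff n m l c i * (u (k + int l) i - v (k + int l) i)) = 0"
    and neq: "u 0 \<noteq> v 0"
  shows "\<exists>S S' W R. (\<forall>k<W. S k \<subseteq> {..<m} \<and> S' k \<subseteq> {..<m}) \<and>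
    finite (singular_parameters a n m L S S' W R) \<and> \<tau> \<in> singular_parameters a n m L S S' W R"
proof -
  define e where "e k = (card {i. u k i \<noteq> 0} - 1) + (card {i. v k i \<noteq> 0} - 1)" for k
  have supp: "{i. u k i \<noteq> 0} \<subseteq> {..<m}" "{i. v k i \<noteq> 0} \<subseteq> {..<m}" for k
    using u v by (auto simp: barycentric_def)
  have supp_ne: "{i. u k i \<noteq> 0} \<noteq> {}" "{i. v k i \<noteq> 0} \<noteq> {}" for k
    using u[of k] v[of k] by (auto simp: barycentric_def)
  have e_le: "e k \<le> 2 * m" for k
    using card_mono[OF finite_lessThan supp(1)[of k]] card_mono[OF finite_lessThan supp(2)[of k]] by (simp add: e_def)
  have e_avg: "(\<Sum>j<N. e (k + int j)) < n * N" for k using avg[of k] by (simp add: e_def)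
  obtain s where s: "- int (N * (2 * m * N + 1)) \<le> s" "s \<le> 0"
      "\<And>p. (\<Sum>j\<le>p. e (s + int j)) + 1 \<le> n * (p + 1)"
    using exists_good_start[OF N e_avg e_le] by auto
  define S where "S k = {i. u (s + int k) i \<noteq> 0}" for k :: nat
  define S' where "S' k = {i. v (s + int k) i \<noteq> 0}" for k :: nat
  have SS: "S k \<subseteq> {..<m} \<and> S k \<noteq> {} \<and> S' k \<subseteq> {..<m} \<and> S' k \<noteq> {}" for k
    using supp supp_ne unfolding S_def S'_def by simp
  have finS: "finite (S k)" "finite (S' k)" for k
    using SS[of k] finite_subset[OF _ finite_lessThan[of m]] by auto
  define f where "f k = card (free_coords S S' k)" for k
  define \<Phi> where "\<Phi> p = (\<Sum>k\<le>p. f k)" for p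
  define first where "first k \<longleftrightarrow> S k \<inter> S' k = {} \<and> (\<forall>k'<k. S k' \<inter> S' k' \<noteq> {})" for k
  have f_le: "f k \<le> e (s + int k) + (if first k then 1 else 0)" for k
    using card_free_coords_le[of S k S'] finS SS[of k] unfolding f_def e_def first_def S_def S'_def by simp
  \<comment> \<open>The scale costs one unit over the whole window, exactly the spare unit provided
    by the choice of \<open>s\<close>.\<close>
  have first_sum: "(\<Sum>k\<le>p. if first k then 1 else 0 :: nat) \<le> 1" for p
  proof (cases "\<exists>k. first k")
    case True
    then obtain k0 where "first k0" by blast
    then have "first k \<longleftrightarrow> k = k0" for k unfolding first_def by (metis linorder_neqE_nat)
    then show ?thesis by simp
  qed simp
  have \<Phi>_le: "\<Phi> p \<le> (\<Sum>j\<le>p. e (s + int j)) + 1" for p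
  proof -
    have "\<Phi> p \<le> (\<Sum>k\<le>p. e (s + int k) + (if first k then 1 else 0))"
      unfolding \<Phi>_def by (intro sum_mono f_le)
    then show ?thesis using first_sum[of p] by (simp add: sum.distrib del: sum.delta sum.delta')
  qed
  have \<Phi>_start: "\<Phi> p \<le> n * (p + 1)" for p using \<Phi>_le[of p] s(3)[of p] by simp
  have ex: "\<exists>\<kappa>. \<Phi> (\<kappa> + L) \<le> n * (\<kappa> + 1)"
  proof -
    define q where "q = n * L + L + 2"
    define \<kappa> where "\<kappa> = q * N - L - 1"
    have "q \<le> q * N" using N by simp
    then have qN: "q * N = \<kappa> + L + 1" unfolding \<kappa>_def q_def by linarith
    have "(\<Sum>j\<le>\<kappa> + L. e (s + int j)) = (\<Sum>j<q * N. e (s + int j))"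
      unfolding qN by (simp add: lessThan_Suc_atMost)
    moreover have "(\<Sum>j<q * N. e (s + int j)) + q \<le> q * (n * N)"
      using block_sum_le[of e N "n * N" s q] e_avg by blast
    moreover have "q * (n * N) = n * (\<kappa> + 1) + n * L" using qN by (metis (no_types, lifting) add.assoc add.commute distrib_left mult.left_commute)
    ultimately have "\<Phi> (\<kappa> + L) + q \<le> n * (\<kappa> + 1) + n * L + 1" using \<Phi>_le[of "\<kappa> + L"] by linarith
    then have "\<Phi> (\<kappa> + L) \<le> n * (\<kappa> + 1)" unfolding q_def by linarith
    then show ?thesis by blast
  qed
  \<comment> \<open>The defining inequality supplies enough equations for all unknowns up to time
    \<open>\<kappa> + L\<close>. Minimality gives the band condition: if at most \<open>r\<close>
    free coordinates precede time \<open>k\<close> and \<open>k > r div n + L\<close>, the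
    inequality already holds at \<open>r div n\<close>, so \<open>\<kappa> \<le> r div n\<close> and
    \<open>k\<close> is outside the window.\<close>
  define \<kappa> where "\<kappa> = (LEAST \<kappa>. \<Phi> (\<kappa> + L) \<le> n * (\<kappa> + 1))"
  have \<kappa>: "\<Phi> (\<kappa> + L) \<le> n * (\<kappa> + 1)" unfolding \<kappa>_def by (rule LeastI_ex[OF ex])
  have \<kappa>_least: "\<kappa> \<le> k" if "\<Phi> (k + L) \<le> n * (k + 1)" for k
    unfolding \<kappa>_def by (rule Least_le[of "\<lambda>\<kappa>. \<Phi> (\<kappa> + L) \<le> n * (\<kappa> + 1)"]) (rule that)
  define W where "W = \<kappa> + L + 1"
  define R where "R = (\<Sum>k<W. f k)"
  have R: "R \<le> n * (\<kappa> + 1)" using \<kappa> by (simp add: R_def W_def \<Phi>_def lessThan_Suc_atMost)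
  have "finite (singular_parameters a n m L S S' W R)"
  proof (rule finite_singular_parameters_pattern)
    fix w assume w: "w \<in> diff_space S S' W"
      "\<And>r. r < R \<Longrightarrow> filtered n m L w (r div n) (r mod n) = 0"
    show "w = (\<lambda>_ _. 0)"
    proof (rule filtered_injective[OF n SS w(1)])
      show "(\<Sum>k'\<le>k. card (free_coords S S' k')) \<le> n * (k + 1)" for k
        using \<Phi>_start[of k] by (simp add: \<Phi>_def f_def)
      show "filtered n m L w (r div n) (r mod n) = 0" if "r < (\<Sum>k<W. card (free_coords S S' k))" for r
        using w(2) that by (simp add: R_def f_def)
      fix k r assume k: "k < W" and r: "(\<Sum>k'<k. card (free_coords S S' k')) \<le> r"
      show "k \<le> r div n + L"
      proof (rule ccontr)
        assume "\<not> ?thesis"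
        then have less: "r div n + L < k" by simp
        have "\<Phi> (r div n + L) \<le> (\<Sum>k'<k. f k')"
          unfolding \<Phi>_def using less by (intro sum_mono2) auto
        also have "\<dots> \<le> r" using r by (simp add: f_def)
        also have "r \<le> n * (r div n + 1)"
          using dividend_less_times_div[of n r] n by simp
        finally have "\<kappa> \<le> r div n" by (rule \<kappa>_least)
        then show False using less k by (simp add: W_def)
      qed
    qed
  qed
  moreover have "\<tau> \<in> singular_parameters a n m L S S' W R"
  proof -
    \<comment> \<open>Truncation does not affect the equations \<open>r < R\<close>: they belong to
      times up to \<open>\<kappa>\<close>, and the filter then reads times up to
      \<open>\<kappa> + L < W\<close>. The scale of this sequence is \<open>1\<close>.\<close>
    define w where "w k i = (if k < W then u (s + int k) i - v (s + int k) i else 0)" for k i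
    have sums: "(\<Sum>i\<in>A. u (s + int k) i) = 1" if "S k \<subseteq> A" "A \<subseteq> {..<m}" for A k
    proof -
      have "(\<Sum>i\<in>A. u (s + int k) i) = (\<Sum>i<m. u (s + int k) i)"
        using that by (intro sum.mono_neutral_left) (auto simp: S_def)
      then show ?thesis using u[of "s + int k"] by (simp add: barycentric_def)
    qed
    have sums': "(\<Sum>i\<in>A. v (s + int k) i) = 1" if "S' k \<subseteq> A" "A \<subseteq> {..<m}" for A k
    proof -
      have "(\<Sum>i\<in>A. v (s + int k) i) = (\<Sum>i<m. v (s + int k) i)"
        using that by (intro sum.mono_neutral_left) (auto simp: S'_def)
      then show ?thesis using v[of "s + int k"] by (simp add: barycentric_def)
    qed
    have "w \<in> diff_space S S' W"
    proof -
      have "if S k \<inter> S' k \<noteq> {} then (\<Sum>i\<in>S k \<union> S' k. w k i) = 0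
             else (\<Sum>i\<in>S k. w k i) = 1 \<and> (\<Sum>i\<in>S' k. w k i) = - 1" if k: "k < W" for k
      proof (cases "S k \<inter> S' k = {}")
        case True
        have "(\<Sum>i\<in>S k. v (s + int k) i) = 0" using True by (intro sum.neutral) (auto simp: S'_def)
        moreover have "(\<Sum>i\<in>S' k. u (s + int k) i) = 0" using True by (intro sum.neutral) (auto simp: S_def)
        ultimately show ?thesis using True k SS[of k] sums[of k "S k"] sums'[of k "S' k"]
          by (simp add: w_def sum_subtractf)
      next
        case False
        then show ?thesis using k SS[of k] sums[of k "S k \<union> S' k"] sums'[of k "S k \<union> S' k"]
          by (simp add: w_def sum_subtractf)
      qed
      moreover have "k < W \<and> i \<in> S k \<union> S' k" if "w k i \<noteq> 0" for k i
        using that by (auto simp: w_def S_def S'_def split: if_splits)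
      ultimately show ?thesis unfolding diff_space_def by blast
    qed
    moreover have "w \<noteq> (\<lambda>_ _. 0)"
    proof -
      \<comment> \<open>Time \<open>0\<close> has index \<open>- s\<close> in the window, and the
        lower bound on \<open>L\<close> keeps it inside.\<close>
      have "nat (- s) \<le> N * (2 * m * N + 1)" unfolding nat_le_iff using s(1) by linarith
      then have "nat (- s) < W" using L unfolding W_def by linarith
      moreover obtain i where "u 0 i \<noteq> v 0 i" using neq by blast
      ultimately have "w (nat (- s)) i \<noteq> 0" using s by (simp add: w_def)
      then show ?thesis by metis
    qed
    moreover have "(\<Sum>i<m. a (r mod n) i * w (r div n) i) + \<tau> * filtered n m L w (r div n) (r mod n) = 0"
      if r: "r < R" for r
    proof -
      have "r < (\<kappa> + 1) * n" using r R by (simp add: mult.commute)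
      then have "r div n < \<kappa> + 1" using n by (simp add: less_mult_imp_div_less)
      then have rW: "r div n + l < W" if "l \<le> L" for l using that by (simp add: W_def)
      have "filtered n m L w (r div n) (r mod n) = (\<Sum>l\<le>L. \<Sum>i<m. filter_coeff n m l (r mod n) i
          * (u (s + int (r div n) + int l) i - v (s + int (r div n) + int l) i))"
        unfolding filtered_def
        by (intro sum.cong refl) (use rW in \<open>simp add: w_def add.assoc del: of_nat_add; simp add: add.assoc\<close>)
      moreover have "(\<Sum>i<m. a (r mod n) i * w (r div n) i)
          = (\<Sum>i<m. a (r mod n) i * (u (s + int (r div n)) i - v (s + int (r div n)) i))"
        using rW[of 0] by (simp add: w_def)
      ultimately show ?thesis using eqs[of "r mod n" "s + int (r div n)"] n by simp
    qed
    ultimately show ?thesis unfolding singular_parameters_def by blast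
  qed
  ultimately show ?thesis using SS by blast
qed

text \<open>By \<open>diff_space_cong\<close> only the first \<open>W\<close> entries of a pattern
  matter, so patterns can be coded by finite lists of pairs of subsets of \<open>{..<m}\<close>.
  Each code contributes a finite set.\<close>

lemma countable_singular_parameters:
  "countable {\<tau>. \<exists>S S' W R. (\<forall>k<W. S k \<subseteq> {..<m} \<and> S' k \<subseteq> {..<m}) \<and>
    finite (singular_parameters a n m L S S' W R) \<and> \<tau> \<in> singular_parameters a n m L S S' W R}"
proof -
  define B where "B p R = singular_parameters a n m L (\<lambda>k. fst (p ! k)) (\<lambda>k. snd (p ! k)) (length p) R" for p R
  define PP where "PP = lists (Pow {..<m} \<times> Pow {..<m :: nat}) \<times> (UNIV :: nat set)"
  have "countable PP" unfolding PP_def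
    by (rule countable_SIGMA[OF countable_lists]) (simp_all add: countable_finite)
  then have "countable (\<Union>(p, R)\<in>PP. if finite (B p R) then B p R else {})"
    by (intro countable_UN) (auto intro: countable_finite)
  moreover have "{\<tau>. \<exists>S S' W R. (\<forall>k<W. S k \<subseteq> {..<m} \<and> S' k \<subseteq> {..<m}) \<and>
    finite (singular_parameters a n m L S S' W R) \<and> \<tau> \<in> singular_parameters a n m L S S' W R}
    \<subseteq> (\<Union>(p, R)\<in>PP. if finite (B p R) then B p R else {})"
  proof safe
    fix \<tau> S S' W R assume SS: "\<forall>k<W. S k \<subseteq> {..<m} \<and> S' k \<subseteq> {..<m}"
      and fin: "finite (singular_parameters a n m L S S' W R)"
      and \<tau>: "\<tau> \<in> singular_parameters a n m L S S' W R"
    define p where "p = map (\<lambda>k. (S k, S' k)) [0..<W]"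
    have "diff_space (\<lambda>k. fst (p ! k)) (\<lambda>k. snd (p ! k)) (length p) = diff_space S S' W"
      unfolding p_def by (simp, intro diff_space_cong) simp
    then have "B p R = singular_parameters a n m L S S' W R"
      by (simp add: B_def singular_parameters_def)
    moreover have "(p, R) \<in> PP"
    proof -
      have "(S k, S' k) \<in> Pow {..<m} \<times> Pow {..<m}" if "k < W" for k using SS that by blast
      then have "\<forall>x\<in>set p. x \<in> Pow {..<m} \<times> Pow {..<m}" unfolding p_def by simp
      then show ?thesis by (simp add: PP_def in_lists_conv_set)
    qed
    ultimately show "\<tau> \<in> (\<Union>(p, R)\<in>PP. if finite (B p R) then B p R else {})"
      using fin \<tau> by (intro UN_I[of "(p, R)"]) auto
  qed
  ultimately show ?thesis by (rule countable_subset[rotated])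
qed

subsection \<open>Invariant measures as limits of empirical measures\<close>

text \<open>Tychonoff: the closures of the tails are nested in a compact cube. The cube is indexed
  by arbitrary sets, so a cluster point is used instead of a convergent subsequence; it is
  approximated on finitely many sets at a time.\<close>

lemma exists_cluster_function:
  fixes \<mu> :: "nat \<Rightarrow> 'b \<Rightarrow> real"
  assumes "\<And>N A. \<mu> N A \<in> {0..1}"
  obtains m where "\<And>A. m A \<in> {0..1}"
    and "\<And>F \<epsilon> n. finite F \<Longrightarrow> 0 < \<epsilon> \<Longrightarrow> \<exists>N\<ge>n. \<forall>A\<in>F. \<bar>\<mu> N A - m A\<bar> < \<epsilon>"
proof -
  define P where "P = product_topology (\<lambda>_ :: 'b. top_of_set {0..1::real}) UNIV"
  have P: "compact_space P" unfolding P_def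
    by (simp add: compact_space_product_topology compact_space_subtopology compactin_euclidean_iff)
  have top: "topspace P = {h. \<forall>A. h A \<in> {0..1}}"
    by (auto simp: P_def PiE_UNIV_domain Pi_iff)
  define C where "C n = P closure_of (\<mu> ` {n..})" for n
  have "(\<Inter>n. C n) \<noteq> {}"
  proof (rule compact_space_imp_nest[OF P])
    show "closedin P (C n)" for n by (simp add: C_def)
    show "C n \<noteq> {}" for n
    proof -
      have "\<mu> ` {n..} \<subseteq> topspace P" using assms by (auto simp: top)
      from closure_of_subset[OF this] show ?thesis unfolding C_def by fastforce
    qed
    show "decseq C" unfolding C_def decseq_def by (auto intro!: closure_of_mono image_mono)
  qed
  then obtain m where m: "\<And>n. m \<in> C n" by blast
  show ?thesis
  proof
    show m01: "m A \<in> {0..1}" for A using m[of 0] closure_of_subset_topspace[of P] unfolding C_def top by auto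
    fix F :: "'b set" and \<epsilon> :: real and n :: nat assume F: "finite F" "0 < \<epsilon>"
    define U :: "'b \<Rightarrow> real set" where "U A = (if A \<in> F then {0..1} \<inter> ball (m A) \<epsilon> else {0..1})" for A
    have "openin P (PiE UNIV U)"
      unfolding P_def openin_PiE_gen
    proof (rule disjI2, intro conjI ballI)
      show "finite {A \<in> UNIV. U A \<noteq> topspace (top_of_set {0..1::real})}"
        using F by (rule_tac finite_subset[of _ F]) (auto simp: U_def)
      show "openin (top_of_set {0..1}) (U A)" for A
        by (auto simp: U_def)
    qed
    moreover have "m \<in> PiE UNIV U" using m01 F by (auto simp: U_def PiE_UNIV_domain)
    ultimately obtain h where "h \<in> \<mu> ` {n..}" "h \<in> PiE UNIV U"
      using m[of n] unfolding C_def in_closure_of by blast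
    then show "\<exists>N\<ge>n. \<forall>A\<in>F. \<bar>\<mu> N A - m A\<bar> < \<epsilon>"
      by (force simp: U_def PiE_UNIV_domain Pi_iff dist_real_def split: if_splits)
  qed
qed

text \<open>A finitely additive probability on all subsets of a compact normal space is regularised to a
  Borel probability measure that is not smaller on closed sets.\<close>

locale probability_content =
  fixes X :: "'a topology" and m :: "'a set \<Rightarrow> real"
  assumes compact: "compact_space X" and normal: "normal_space X"
    and m_nonneg: "\<And>A. 0 \<le> m A"
    and m_add: "\<And>A B. A \<inter> B = {} \<Longrightarrow> m (A \<union> B) = m A + m B"
    and m_space: "m (topspace X) = 1"
begin

text \<open>Meant for open \<open>U\<close>: inner regularity gives the values on open sets, and
  outer regularity then extends them to all sets in \<open>outer_content\<close>.\<close>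

definition inner_content :: "'a set \<Rightarrow> ennreal" where
  "inner_content U = (SUP K\<in>{K. closedin X K \<and> K \<subseteq> U}. ennreal (m K))"

definition outer_content :: "'a set \<Rightarrow> ennreal" where
  "outer_content A = (INF U\<in>{U. openin X U \<and> A \<subseteq> U}. inner_content U)"

lemma m_mono: "A \<subseteq> B \<Longrightarrow> m A \<le> m B"
  using m_add[of A "B - A"] m_nonneg[of "B - A"] by (simp add: Un_absorb1)

lemma m_empty: "m {} = 0"
  using m_add[of "{}" "{}"] by simp

lemma m_Un_le: "m (A \<union> B) \<le> m A + m B"
  using m_add[of A "B - A"] m_mono[of "B - A" B] by simp

lemma inner_ge: "closedin X K \<Longrightarrow> K \<subseteq> U \<Longrightarrow> ennreal (m K) \<le> inner_content U"
  unfolding inner_content_def by (intro SUP_upper) auto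

lemma inner_empty: "inner_content {} = 0"
proof -
  have "{K. closedin X K \<and> K \<subseteq> {}} = {{}}" by auto
  then show ?thesis unfolding inner_content_def by (simp add: m_empty)
qed

lemma outer_le: "openin X U \<Longrightarrow> A \<subseteq> U \<Longrightarrow> outer_content A \<le> inner_content U"
  unfolding outer_content_def by (intro INF_lower) auto

lemma outer_mono: "A \<subseteq> B \<Longrightarrow> outer_content A \<le> outer_content B"
  unfolding outer_content_def by (intro INF_superset_mono) auto

lemma outer_le_one: "A \<subseteq> topspace X \<Longrightarrow> outer_content A \<le> 1"
proof -
  assume "A \<subseteq> topspace X"
  then have "outer_content A \<le> inner_content (topspace X)" by (intro outer_le) auto
  also have "\<dots> \<le> 1" unfolding inner_content_def
    using m_mono[of _ "topspace X"] m_space by (intro SUP_least) auto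
  finally show ?thesis .
qed

lemma outer_space: "outer_content (topspace X) = 1"
proof (rule antisym)
  show "outer_content (topspace X) \<le> 1" by (simp add: outer_le_one)
  have "1 \<le> inner_content U" if "openin X U" "topspace X \<subseteq> U" for U
    using inner_ge[of "topspace X" U] that m_space by simp
  then show "1 \<le> outer_content (topspace X)" unfolding outer_content_def by (intro INF_greatest) auto
qed

lemma outer_closed_ge: "closedin X C \<Longrightarrow> ennreal (m C) \<le> outer_content C"
  unfolding outer_content_def by (intro INF_greatest inner_ge) auto

text \<open>Normality splits \<open>K\<close> into two closed pieces: a neighbourhood
  \<open>V\<close> of \<open>K - U n\<close> has its closure inside the first \<open>n\<close> sets,
  and \<open>K - V\<close> lies in \<open>U n\<close>.\<close>

lemma closed_le_sum_inner:
  fixes U :: "nat \<Rightarrow> 'a set"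
  assumes "\<And>i. openin X (U i)" "closedin X K" "K \<subseteq> (\<Union>i<n. U i)"
  shows "ennreal (m K) \<le> (\<Sum>i<n. inner_content (U i))"
  using assms(2,3)
proof (induction n arbitrary: K)
  case 0
  then show ?case by (simp add: m_empty)
next
  case (Suc n)
  have "closedin X (K - U n)" using Suc assms by (intro closedin_diff) auto
  moreover have "openin X (\<Union>i<n. U i)" using assms by (intro openin_Union) auto
  moreover have "K - U n \<subseteq> (\<Union>i<n. U i)" using Suc.prems(2) by (simp add: lessThan_Suc) blast
  ultimately obtain V where V: "openin X V" "K - U n \<subseteq> V" "X closure_of V \<subseteq> (\<Union>i<n. U i)"
    using normal unfolding normal_space_alt by metis
  have "m K \<le> m (K \<inter> X closure_of V) + m (K - V)"
  proof -
    have "V \<subseteq> X closure_of V" using V(1) by (intro closure_of_subset openin_subset)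
    then have "K \<subseteq> (K \<inter> X closure_of V) \<union> (K - V)" by blast
    then show ?thesis using m_mono m_Un_le order_trans by blast
  qed
  then have "ennreal (m K) \<le> ennreal (m (K \<inter> X closure_of V)) + ennreal (m (K - V))"
    using m_nonneg by (simp flip: ennreal_plus)
  also have "\<dots> \<le> (\<Sum>i<n. inner_content (U i)) + inner_content (U n)"
    using V Suc.prems by (intro add_mono Suc.IH inner_ge closedin_Int closedin_diff) auto
  finally show ?case by simp
qed

text \<open>A closed subset of the compact space needs only finitely many of the open sets.\<close>

lemma inner_UN_le:
  fixes U :: "nat \<Rightarrow> 'a set"
  assumes U: "\<And>i. openin X (U i)"
  shows "inner_content (\<Union>i. U i) \<le> (\<Sum>i. inner_content (U i))"
  unfolding inner_content_def[of "\<Union>i. U i"]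
proof (rule SUP_least, safe)
  fix K assume K: "closedin X K" "K \<subseteq> (\<Union>i. U i)"
  have "compactin X K" using K compact by (simp add: closedin_compact_space)
  then obtain \<F> where \<F>: "finite \<F>" "\<F> \<subseteq> range U" "K \<subseteq> \<Union>\<F>"
    using K(2) U unfolding compactin_def by (metis (no_types, lifting) image_iff)
  obtain I where I: "finite I" "\<F> = U ` I" using finite_subset_image[OF \<F>(1,2)] by blast
  obtain n where "I \<subseteq> {..<n}" using I(1) finite_nat_iff_bounded by blast
  then have "\<Union> (U ` I) \<subseteq> (\<Union>i<n. U i)" by (intro Union_mono image_mono)
  then have "K \<subseteq> (\<Union>i<n. U i)" using \<F>(3) I(2) by simp
  then have "ennreal (m K) \<le> (\<Sum>i<n. inner_content (U i))" using closed_le_sum_inner U K by blast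
  also have "\<dots> \<le> (\<Sum>i. inner_content (U i))" by (intro sum_le_suminf) auto
  finally show "ennreal (m K) \<le> (\<Sum>i. inner_content (U i))" .
qed

lemma outer_measure_space_outer: "outer_measure_space (Pow (topspace X)) outer_content"
  unfolding outer_measure_space_def
proof (intro conjI)
  have "outer_content {} \<le> inner_content {}" by (intro outer_le) auto
  then show "positive (Pow (topspace X)) outer_content" by (simp add: positive_def inner_empty)
  show "increasing (Pow (topspace X)) outer_content" by (simp add: increasing_def outer_mono)
  show "countably_subadditive (Pow (topspace X)) outer_content"
    unfolding countably_subadditive_def
  proof safe
    fix A :: "nat \<Rightarrow> 'a set" assume A: "range A \<subseteq> Pow (topspace X)"
    show "outer_content (\<Union> (range A)) \<le> (\<Sum>i. outer_content (A i))"
    proof (rule ennreal_le_epsilon)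
      fix e :: real assume e: "0 < e"
      have "\<exists>U. openin X U \<and> A i \<subseteq> U \<and> inner_content U < outer_content (A i) + ennreal (e * (1/2) ^ Suc i)" for i
      proof -
        have "outer_content (A i) < top" using outer_le_one[of "A i"] A
          by (metis Pow_iff ennreal_one_less_top le_less_trans range_subsetD)
        then have "outer_content (A i) < outer_content (A i) + ennreal (e * (1/2) ^ Suc i)" using e by simp
        then show ?thesis unfolding outer_content_def INF_less_iff by (auto simp flip: outer_content_def)
      qed
      then obtain U where U: "\<And>i. openin X (U i)" "\<And>i. A i \<subseteq> U i"
          "\<And>i. inner_content (U i) < outer_content (A i) + ennreal (e * (1/2) ^ Suc i)"
        by metis
      have "outer_content (\<Union> (range A)) \<le> inner_content (\<Union>i. U i)"
        using U by (intro outer_le openin_Union) auto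
      also have "\<dots> \<le> (\<Sum>i. inner_content (U i))" using U by (intro inner_UN_le)
      also have "\<dots> \<le> (\<Sum>i. outer_content (A i) + ennreal (e * (1/2) ^ Suc i))"
        using U(3) by (intro suminf_le summableI) (auto simp: less_imp_le)
      also have "\<dots> = (\<Sum>i. outer_content (A i)) + (\<Sum>i. ennreal (e * (1/2) ^ Suc i))"
        by (simp add: suminf_add[symmetric])
      also have "(\<Sum>i. ennreal (e * (1/2) ^ Suc i)) = ennreal e"
      proof -
        have "(\<lambda>i. e * (1/2) ^ Suc i) sums (e * 1)" by (intro sums_mult power_half_series)
        then show ?thesis using e by (intro suminf_ennreal_eq) auto
      qed
      finally show "outer_content (\<Union> (range A)) \<le> (\<Sum>i. outer_content (A i)) + ennreal e" .
    qed
  qed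
qed

text \<open>For open \<open>W\<close> containing \<open>A\<close>, a closed \<open>K\<close>
  approximates \<open>U \<inter> W\<close>; then \<open>W - K\<close> is an open neighbourhood of
  \<open>A - U\<close> and is approximated by a closed \<open>K'\<close>. As \<open>K\<close> and
  \<open>K'\<close> are disjoint, additivity of \<open>m\<close> bounds the sum by the content of
  \<open>W\<close>.\<close>

lemma openin_lambda_system:
  assumes U: "openin X U"
  shows "U \<in> lambda_system (topspace X) (Pow (topspace X)) outer_content"
proof -
  have Usub: "U \<subseteq> topspace X" using U by (rule openin_subset)
  have "outer_content (U \<inter> A) + outer_content ((topspace X - U) \<inter> A) = outer_content A" if A: "A \<subseteq> topspace X" for A
  proof (rule antisym)
    interpret sigma_algebra "topspace X" "Pow (topspace X)" by (rule sigma_algebra_Pow)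
    have "subadditive (Pow (topspace X)) outer_content"
      using outer_measure_space_outer
      by (intro countably_subadditive_subadditive) (auto simp: outer_measure_space_def)
    from subadditiveD[OF this, of "U \<inter> A" "(topspace X - U) \<inter> A"]
    have "outer_content ((U \<inter> A) \<union> ((topspace X - U) \<inter> A)) \<le> outer_content (U \<inter> A) + outer_content ((topspace X - U) \<inter> A)"
      using A by auto
    moreover have "(U \<inter> A) \<union> ((topspace X - U) \<inter> A) = A" using A by auto
    ultimately show "outer_content A \<le> outer_content (U \<inter> A) + outer_content ((topspace X - U) \<inter> A)" by simp
  next
    show "outer_content (U \<inter> A) + outer_content ((topspace X - U) \<inter> A) \<le> outer_content A"
      unfolding outer_content_def[of A]
    proof (rule INF_greatest, safe)
      fix W assume W: "openin X W" "A \<subseteq> W"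
      have "outer_content (U \<inter> A) \<le> inner_content (U \<inter> W)"
        using U W by (intro outer_le openin_Int) auto
      then have "outer_content (U \<inter> A) + outer_content ((topspace X - U) \<inter> A) \<le> inner_content (U \<inter> W) + outer_content ((topspace X - U) \<inter> A)"
        by (rule add_right_mono)
      also have "\<dots> = (SUP K\<in>{K. closedin X K \<and> K \<subseteq> U \<inter> W}. ennreal (m K) + outer_content ((topspace X - U) \<inter> A))"
        unfolding inner_content_def by (intro ennreal_SUP_add_left[symmetric]) auto
      also have "\<dots> \<le> inner_content W"
      proof (rule SUP_least, safe)
        fix K assume K: "closedin X K" "K \<subseteq> U \<inter> W"
        have "outer_content ((topspace X - U) \<inter> A) \<le> inner_content (W - K)"
          using W K by (intro outer_le openin_diff) auto
        then have "ennreal (m K) + outer_content ((topspace X - U) \<inter> A) \<le> ennreal (m K) + inner_content (W - K)"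
          by (rule add_left_mono)
        also have "\<dots> = (SUP K'\<in>{K'. closedin X K' \<and> K' \<subseteq> W - K}. ennreal (m K) + ennreal (m K'))"
          unfolding inner_content_def by (rule ennreal_SUP_add_right) auto
        also have "\<dots> \<le> inner_content W"
        proof (rule SUP_least, safe)
          fix K' assume K': "closedin X K'" "K' \<subseteq> W - K"
          have "K \<inter> K' = {}" using K' by auto
          then have "ennreal (m K) + ennreal (m K') = ennreal (m (K \<union> K'))"
            using m_nonneg by (simp add: m_add flip: ennreal_plus)
          also have "\<dots> \<le> inner_content W" using K K' by (intro inner_ge closedin_Un) auto
          finally show "ennreal (m K) + ennreal (m K') \<le> inner_content W" .
        qed
        finally show "ennreal (m K) + outer_content ((topspace X - U) \<inter> A) \<le> inner_content W" .
      qed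
      finally show "outer_content (U \<inter> A) + outer_content ((topspace X - U) \<inter> A) \<le> inner_content W" .
    qed
  qed
  then show ?thesis using Usub by (simp add: lambda_system_def)
qed

definition borel_ext :: "'a measure" where
  "borel_ext = measure_of (topspace X) (sigma_sets (topspace X) {U. openin X U}) outer_content"

lemma opens_Pow: "{U. openin X U} \<subseteq> Pow (topspace X)"
  using openin_subset by blast

lemma space_borel_ext: "space borel_ext = topspace X"
  and sets_borel_ext: "sets borel_ext = sigma_sets (topspace X) {U. openin X U}"
proof -
  have sub: "sigma_sets (topspace X) {U. openin X U} \<subseteq> Pow (topspace X)"
    using sigma_sets_into_sp[OF opens_Pow] by blast
  show "space borel_ext = topspace X" unfolding borel_ext_def using sub by (rule space_measure_of)
  show "sets borel_ext = sigma_sets (topspace X) {U. openin X U}"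
    unfolding borel_ext_def using sub by (simp add: sets_measure_of sigma_sets_sigma_sets_eq opens_Pow)
qed

lemma emeasure_borel_ext:
  assumes "A \<in> sigma_sets (topspace X) {U. openin X U}"
  shows "emeasure borel_ext A = outer_content A"
proof -
  interpret sigma_algebra "topspace X" "Pow (topspace X)" by (rule sigma_algebra_Pow)
  let ?L = "lambda_system (topspace X) (Pow (topspace X)) outer_content"
  have L: "measure_space (topspace X) ?L outer_content"
    using outer_measure_space_outer by (rule caratheodory_lemma)
  have sig: "sigma_algebra (topspace X) (sigma_sets (topspace X) {U. openin X U})"
    using opens_Pow by (rule sigma_algebra_sigma_sets)
  have "sigma_sets (topspace X) {U. openin X U} \<subseteq> ?L"
    using L openin_lambda_system unfolding measure_space_def
    by (intro sigma_algebra.sigma_sets_subset) auto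
  from measure_down[OF L sig this]
  have "measure_space (topspace X) (sigma_sets (topspace X) {U. openin X U}) outer_content" .
  then show ?thesis unfolding borel_ext_def
    using assms by (intro emeasure_measure_of_sigma) (auto simp: measure_space_def)
qed

lemma prob_space_borel_ext: "prob_space borel_ext"
proof
  have "topspace X \<in> sigma_sets (topspace X) {U. openin X U}" by (rule sigma_sets_top)
  then show "emeasure borel_ext (space borel_ext) = 1"
    by (simp add: space_borel_ext emeasure_borel_ext outer_space)
qed

lemma closedin_sigma_sets: "closedin X C \<Longrightarrow> C \<in> sigma_sets (topspace X) {U. openin X U}"
  by (metis closedin_def double_diff mem_Collect_eq order_refl sigma_sets.Basic sigma_sets.Compl)

text \<open>A homeomorphism permutes the closed sets and the open sets, so invariance of
  \<open>m\<close> passes through the supremum and then through the infimum.\<close>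

lemma outer_vimage:
  assumes T: "homeomorphic_map X X T" and inv: "\<And>A. m (T -` A \<inter> topspace X) = m A" and A: "A \<subseteq> topspace X"
  shows "outer_content (T -` A \<inter> topspace X) = outer_content A"
proof -
  let ?v = "\<lambda>A. T -` A \<inter> topspace X"
  have cont: "continuous_map X X T" using T by (rule homeomorphic_imp_continuous_map)
  have inj: "inj_on T (topspace X)" using T by (rule homeomorphic_imp_injective_map)
  have surj: "T ` topspace X = topspace X" using T by (rule homeomorphic_imp_surjective_map)
  have im: "?v (T ` B) = B" if "B \<subseteq> topspace X" for B
    using that inj by (auto simp: inj_on_def)
  have vop: "openin X (?v U)" if "openin X U" for U
    using openin_continuous_map_preimage[OF cont that] by (simp add: vimage_def Int_def conj_commute)
  have vcl: "closedin X (?v U)" if "closedin X U" for U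
    using closedin_continuous_map_preimage[OF cont that] by (simp add: vimage_def Int_def conj_commute)
  have vinner: "inner_content (?v U) = inner_content U" if U: "U \<subseteq> topspace X" for U
  proof (rule antisym)
    show "inner_content (?v U) \<le> inner_content U"
      unfolding inner_content_def[of "?v U"]
    proof (rule SUP_least, safe)
      fix K assume K: "closedin X K" "K \<subseteq> ?v U"
      have Ks: "K \<subseteq> topspace X" using K by auto
      have "closedin X (T ` K)" using homeomorphic_map_closedness[OF T Ks] K by simp
      moreover have "T ` K \<subseteq> U" using K by auto
      moreover have "m K = m (T ` K)" using inv[of "T ` K"] im[OF Ks] by simp
      ultimately show "ennreal (m K) \<le> inner_content U" using inner_ge by metis
    qed
    show "inner_content U \<le> inner_content (?v U)"
      unfolding inner_content_def[of U]
    proof (rule SUP_least, safe)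
      fix K assume K: "closedin X K" "K \<subseteq> U"
      have "ennreal (m (?v K)) \<le> inner_content (?v U)" using K vcl by (intro inner_ge) auto
      then show "ennreal (m K) \<le> inner_content (?v U)" by (simp add: inv)
    qed
  qed
  show ?thesis
  proof (rule antisym)
    show "outer_content (?v A) \<le> outer_content A"
      unfolding outer_content_def[of A]
    proof (rule INF_greatest, safe)
      fix U assume U: "openin X U" "A \<subseteq> U"
      have "outer_content (?v A) \<le> inner_content (?v U)" using U vop by (intro outer_le) auto
      then show "outer_content (?v A) \<le> inner_content U" using vinner openin_subset[OF U(1)] by simp
    qed
    show "outer_content A \<le> outer_content (?v A)"
      unfolding outer_content_def[of "?v A"]
    proof (rule INF_greatest, safe)
      fix V assume V: "openin X V" "?v A \<subseteq> V"
      have Vs: "V \<subseteq> topspace X" using V by (simp add: openin_subset)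
      have op: "openin X (T ` V)" using homeomorphic_map_openness[OF T Vs] V by simp
      have "A \<subseteq> T ` V"
      proof
        fix x assume x: "x \<in> A"
        then obtain y where "y \<in> topspace X" "x = T y" using A surj by blast
        then show "x \<in> T ` V" using x V(2) by auto
      qed
      then have "outer_content A \<le> inner_content (T ` V)" using op by (intro outer_le)
      also have "\<dots> = inner_content V" using vinner[of "T ` V"] im[OF Vs] op openin_subset by metis
      finally show "outer_content A \<le> inner_content V" .
    qed
  qed
qed

end

section \<open>Empirical averages and invariant measures\<close>

lemma sum_shift_diff_le:
  fixes g :: "nat \<Rightarrow> real"
  assumes "\<And>k. g k \<in> {0..1}"
  shows "\<bar>(\<Sum>k<n. g (Suc k)) - (\<Sum>k<n. g k)\<bar> \<le> 1"
proof -
  have "(\<Sum>k<n. g (Suc k)) - (\<Sum>k<n. g k) = g n - g 0"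
    by (simp add: sum_subtractf[symmetric] sum_lessThan_telescope)
  then show ?thesis using assms[of n] assms[of 0] by auto
qed

text \<open>Krylov-Bogolyubov argument with a starting point depending on \<open>N\<close>. The sets
  \<open>C i\<close> are closed because a lower bound on frequencies survives on closed sets:
  regularisation of the limit does not decrease their value.\<close>

lemma exists_invariant_measure:
  fixes C :: "'i \<Rightarrow> 'a set"
  assumes tds: "tds X T" and I: "finite I" and C: "\<And>i. i \<in> I \<Longrightarrow> closedin X (C i)"
    and avg: "\<And>N. N \<ge> 1 \<Longrightarrow> \<exists>x\<in>topspace X. c * real N \<le> (\<Sum>k<N. real (card {i\<in>I. (T ^^ k) x \<in> C i}))"
  shows "\<exists>\<mu>\<in>inv_prob X T. c \<le> (\<Sum>i\<in>I. measure \<mu> (C i))"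
proof -
  have comp: "compact_space X" and metr: "metrizable_space X" and hom: "homeomorphic_map X X T"
    using tds by (auto simp: tds_def)
  have cont: "continuous_map X X T" using hom by (rule homeomorphic_imp_continuous_map)
  have Tin: "(T ^^ k) x \<in> topspace X" if "x \<in> topspace X" for k x
    using that cont by (induction k) (auto simp: continuous_map_def)
  have "\<forall>N. \<exists>x. x \<in> topspace X \<and> c * real (Suc N) \<le> (\<Sum>k<Suc N. real (card {i\<in>I. (T ^^ k) x \<in> C i}))"
  proof
    fix N :: nat
    have "1 \<le> Suc N" by simp
    from avg[OF this] show "\<exists>x. x \<in> topspace X \<and> c * real (Suc N) \<le> (\<Sum>k<Suc N. real (card {i\<in>I. (T ^^ k) x \<in> C i}))"
      by blast
  qed
  from choice[OF this] obtain x where x': "\<forall>N. x N \<in> topspace X \<and>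
      c * real (Suc N) \<le> (\<Sum>k<Suc N. real (card {i\<in>I. (T ^^ k) (x N) \<in> C i}))" by blast
  then have x: "\<And>N. x N \<in> topspace X"
      "\<And>N. c * real (Suc N) \<le> (\<Sum>k<Suc N. real (card {i\<in>I. (T ^^ k) (x N) \<in> C i}))"
    by blast+
  note sum.lessThan_Suc [simp del]
  define fr where "fr N A = (\<Sum>k<Suc N. indicator A ((T ^^ k) (x N))) / real (Suc N)" for N and A :: "'a set"
  have fr01: "fr N A \<in> {0..1}" for N A
  proof -
    have "(\<Sum>k<Suc N. indicator A ((T ^^ k) (x N))) \<le> (\<Sum>k<Suc N. 1 :: real)"
      by (intro sum_mono) (auto simp: indicator_def)
    moreover have "0 \<le> (\<Sum>k<Suc N. indicator A ((T ^^ k) (x N)) :: real)" by (intro sum_nonneg) auto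
    ultimately show ?thesis by (simp add: fr_def field_simps)
  qed
  obtain m where m01: "\<And>A. m A \<in> {0..1}"
    and m: "\<And>F \<epsilon> n. finite F \<Longrightarrow> 0 < \<epsilon> \<Longrightarrow> \<exists>N\<ge>n. \<forall>A\<in>F. \<bar>fr N A - m A\<bar> < \<epsilon>"
    using exists_cluster_function[of fr, OF fr01] by blast
  have close: "a \<le> b" if "\<And>\<epsilon>. 0 < \<epsilon> \<Longrightarrow> a \<le> b + \<epsilon>" for a b :: real
    using that field_le_epsilon by blast
  have m_add: "m (A \<union> B) = m A + m B" if AB: "A \<inter> B = {}" for A B
  proof -
    have fr_add: "fr N (A \<union> B) = fr N A + fr N B" for N
      using AB unfolding fr_def add_divide_distrib[symmetric] sum.distrib[symmetric]
      by (intro arg_cong2[of _ _ _ _ "(/)"] sum.cong refl) (auto simp: indicator_def)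
    have "\<bar>m (A \<union> B) - (m A + m B)\<bar> \<le> 0"
    proof (rule close)
      fix \<epsilon> :: real assume "0 < \<epsilon>"
      then obtain N where N: "\<forall>D\<in>{A, B, A \<union> B}. \<bar>fr N D - m D\<bar> < \<epsilon> / 3"
        using m[of "{A, B, A \<union> B}" "\<epsilon> / 3" 0] by auto
      have "\<bar>fr N A - m A\<bar> < \<epsilon> / 3" "\<bar>fr N B - m B\<bar> < \<epsilon> / 3" "\<bar>fr N (A \<union> B) - m (A \<union> B)\<bar> < \<epsilon> / 3"
        using N by auto
      then show "\<bar>m (A \<union> B) - (m A + m B)\<bar> \<le> 0 + \<epsilon>" using fr_add[of N] by linarith
    qed
    then show ?thesis by simp
  qed
  have m_space: "m (topspace X) = 1"
  proof -
    have fr_space: "fr N (topspace X) = 1" for N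
      using Tin[OF x(1)[of N]] by (simp add: fr_def)
    have "\<bar>m (topspace X) - 1\<bar> \<le> 0"
    proof (rule close)
      fix \<epsilon> :: real assume "0 < \<epsilon>"
      then obtain N where "\<bar>fr N (topspace X) - m (topspace X)\<bar> < \<epsilon>"
        using m[of "{topspace X}" \<epsilon> 0] by auto
      then show "\<bar>m (topspace X) - 1\<bar> \<le> 0 + \<epsilon>" using fr_space[of N] by linarith
    qed
    then show ?thesis by simp
  qed
  have m_inv: "m (T -` A \<inter> topspace X) = m A" for A
  proof -
    let ?B = "T -` A \<inter> topspace X"
    \<comment> \<open>Shifting the orbit changes only the two end terms of the sum. To make this
      error vanish, the cluster property is used below with arbitrarily large
      \<open>N\<close>.\<close>
    have fr_inv: "\<bar>fr N ?B - fr N A\<bar> \<le> 1 / real (Suc N)" for N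
    proof -
      define g :: "nat \<Rightarrow> real" where "g k = indicator A ((T ^^ k) (x N))" for k
      have "fr N ?B = (\<Sum>k<Suc N. g (Suc k)) / real (Suc N)"
        unfolding fr_def g_def using Tin[OF x(1)[of N]]
        by (intro arg_cong2[of _ _ _ _ "(/)"] sum.cong refl) (auto simp: indicator_def)
      moreover have "fr N A = (\<Sum>k<Suc N. g k) / real (Suc N)" by (simp add: fr_def g_def)
      ultimately have "\<bar>fr N ?B - fr N A\<bar> = \<bar>(\<Sum>k<Suc N. g (Suc k)) - (\<Sum>k<Suc N. g k)\<bar> / real (Suc N)"
        by (simp only: diff_divide_distrib[symmetric] abs_divide abs_of_nat)
      also have "\<dots> \<le> 1 / real (Suc N)"
        by (intro divide_right_mono sum_shift_diff_le) (auto simp: g_def indicator_def)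
      finally show ?thesis .
    qed
    have "\<bar>m ?B - m A\<bar> \<le> 0"
    proof (rule close)
      fix \<epsilon> :: real assume e: "0 < \<epsilon>"
      then obtain n where n: "1 / real (Suc n) < \<epsilon> / 3" using nat_approx_posE[of "\<epsilon>/3"] by auto
      from e obtain N where N: "N \<ge> n" "\<forall>D\<in>{?B, A}. \<bar>fr N D - m D\<bar> < \<epsilon> / 3"
        using m[of "{?B, A}" "\<epsilon> / 3" n] by auto
      have "1 / real (Suc N) \<le> 1 / real (Suc n)" using N(1) by (simp add: frac_le)
      moreover have "\<bar>fr N ?B - m ?B\<bar> < \<epsilon> / 3" "\<bar>fr N A - m A\<bar> < \<epsilon> / 3" using N(2) by auto
      ultimately show "\<bar>m ?B - m A\<bar> \<le> 0 + \<epsilon>" using fr_inv[of N] n by linarith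
    qed
    then show ?thesis by simp
  qed
  have m_C: "c \<le> (\<Sum>i\<in>I. m (C i))"
  proof (rule close)
    fix \<epsilon> :: real assume e: "0 < \<epsilon>"
    define \<delta> where "\<delta> = \<epsilon> / (real (card I) + 1)"
    have d: "0 < \<delta>" "real (card I) * \<delta> \<le> \<epsilon>" using e by (auto simp: \<delta>_def field_simps)
    obtain N where N: "\<forall>D\<in>C ` I. \<bar>fr N D - m D\<bar> < \<delta>" using m[of "C ` I" \<delta> 0] I d by auto
    have "(\<Sum>i\<in>I. fr N (C i)) = (\<Sum>k<Suc N. \<Sum>i\<in>I. indicator (C i) ((T ^^ k) (x N))) / real (Suc N)"
      unfolding fr_def sum_divide_distrib[symmetric] by (subst sum.swap) simp
    also have "(\<Sum>k<Suc N. \<Sum>i\<in>I. indicator (C i) ((T ^^ k) (x N))) = (\<Sum>k<Suc N. real (card {i\<in>I. (T ^^ k) (x N) \<in> C i}))"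
      using I by (intro sum.cong refl) (simp add: indicator_def sum.If_cases Int_def conj_commute)
    finally have eq: "(\<Sum>i\<in>I. fr N (C i)) = (\<Sum>k<Suc N. real (card {i\<in>I. (T ^^ k) (x N) \<in> C i})) / real (Suc N)" .
    have "c \<le> (\<Sum>i\<in>I. fr N (C i))"
      unfolding eq using x(2)[of N] by (simp only: pos_le_divide_eq of_nat_0_less_iff zero_less_Suc)
    also have "\<dots> \<le> (\<Sum>i\<in>I. m (C i) + \<delta>)"
    proof (rule sum_mono)
      fix i assume "i \<in> I"
      then have "\<bar>fr N (C i) - m (C i)\<bar> < \<delta>" using N by simp
      then show "fr N (C i) \<le> m (C i) + \<delta>" by linarith
    qed
    also have "\<dots> \<le> (\<Sum>i\<in>I. m (C i)) + \<epsilon>" using d(2) by (simp add: sum.distrib)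
    finally show "c \<le> (\<Sum>i\<in>I. m (C i)) + \<epsilon>" .
  qed
  interpret probability_content X m
    using comp metrizable_imp_normal_space[OF metr] m01 m_add m_space by unfold_locales auto
  have meas: "T \<in> measurable borel_ext borel_ext"
  proof (rule measurable_sigma_sets[OF sets_borel_ext opens_Pow])
    show "T \<in> space borel_ext \<rightarrow> topspace X" using cont by (auto simp: space_borel_ext continuous_map_def)
    fix U assume "U \<in> {U. openin X U}"
    then have "openin X {x \<in> topspace X. T x \<in> U}" using openin_continuous_map_preimage[OF cont] by auto
    moreover have "T -` U \<inter> space borel_ext = {x \<in> topspace X. T x \<in> U}" by (auto simp: space_borel_ext)
    ultimately show "T -` U \<inter> space borel_ext \<in> sets borel_ext"
      by (auto simp: sets_borel_ext intro: sigma_sets.Basic)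
  qed
  have "borel_ext \<in> inv_prob X T"
  proof -
    have "emeasure borel_ext (T -` A \<inter> topspace X) = emeasure borel_ext A" if A: "A \<in> sets borel_ext" for A
    proof -
      have "T -` A \<inter> topspace X \<in> sets borel_ext" using measurable_sets[OF meas A] by (simp add: space_borel_ext)
      moreover have "A \<subseteq> topspace X" using sets.sets_into_space[OF A] by (simp add: space_borel_ext)
      ultimately show ?thesis using A outer_vimage[OF hom m_inv] emeasure_borel_ext by (simp add: sets_borel_ext)
    qed
    then show ?thesis using prob_space_borel_ext by (auto simp: inv_prob_def space_borel_ext sets_borel_ext)
  qed
  moreover have "c \<le> (\<Sum>i\<in>I. measure borel_ext (C i))"
  proof -
    interpret prob_space borel_ext by (rule prob_space_borel_ext)
    have "m (C i) \<le> measure borel_ext (C i)" if "i \<in> I" for i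
    proof -
      have "ennreal (m (C i)) \<le> emeasure borel_ext (C i)"
        using outer_closed_ge[OF C[OF that]] emeasure_borel_ext[OF closedin_sigma_sets[OF C[OF that]]] by simp
      then show ?thesis by (simp add: emeasure_eq_measure)
    qed
    then have "(\<Sum>i\<in>I. m (C i)) \<le> (\<Sum>i\<in>I. measure borel_ext (C i))" by (rule sum_mono)
    then show ?thesis using m_C by linarith
  qed
  ultimately show ?thesis by blast
qed

text \<open>Otherwise every \<open>N\<close> has an orbit segment with average at least
  \<open>b\<close>, and the limiting invariant measure contradicts the bound on
  \<open>cover_ord_dyn\<close>. The closed sets \<open>C V\<close> are counted in the limit; passing
  to the larger \<open>V\<close> is harmless for a lower bound on the integral.\<close>

lemma cover_ord_average_less:
  assumes tds: "tds X T" and V: "\<V> \<in> open_covers X"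
    and C: "\<And>V. V \<in> \<V> \<Longrightarrow> closedin X (C V) \<and> C V \<subseteq> V" and cov: "topspace X \<subseteq> (\<Union>V\<in>\<V>. C V)"
    and b: "cover_ord_dyn X T \<V> < ennreal b" "0 \<le> b"
  shows "\<exists>N\<ge>1. \<forall>x\<in>topspace X. real (\<Sum>k<N. card {V\<in>\<V>. (T ^^ k) x \<in> C V} - 1) < b * real N"
proof (rule ccontr)
  assume contra: "\<not> ?thesis"
  have fin: "finite \<V>" and op: "\<And>V. V \<in> \<V> \<Longrightarrow> openin X V" and un: "\<Union>\<V> = topspace X"
    using V by (auto simp: open_covers_def)
  have cont: "continuous_map X X T" using tds by (simp add: tds_def homeomorphic_imp_continuous_map)
  have Tin: "(T ^^ k) x \<in> topspace X" if "x \<in> topspace X" for k x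
    using that cont by (induction k) (auto simp: continuous_map_def)
  have pos: "card {V\<in>\<V>. x \<in> C V} \<ge> 1" if "x \<in> topspace X" for x
  proof -
    have "{V\<in>\<V>. x \<in> C V} \<noteq> {}" using cov that by auto
    then show ?thesis using fin by (simp add: Suc_le_eq card_gt_0_iff)
  qed
  \<comment> \<open>The measure lemma counts memberships without subtracting one, hence
    \<open>b + 1\<close>. The sets \<open>C V\<close> cover the space, so the natural subtraction in
    the order is exact.\<close>
  have "\<exists>x\<in>topspace X. (b + 1) * real N \<le> (\<Sum>k<N. real (card {V\<in>\<V>. (T ^^ k) x \<in> C V}))" if "N \<ge> 1" for N
  proof -
    have "\<exists>x\<in>topspace X. \<not> real (\<Sum>k<N. card {V\<in>\<V>. (T ^^ k) x \<in> C V} - 1) < b * real N"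
      using contra that by blast
    then obtain x where x: "x \<in> topspace X" "b * real N \<le> real (\<Sum>k<N. card {V\<in>\<V>. (T ^^ k) x \<in> C V} - 1)"
      unfolding not_less by blast
    have "real (\<Sum>k<N. card {V\<in>\<V>. (T ^^ k) x \<in> C V} - 1) = (\<Sum>k<N. real (card {V\<in>\<V>. (T ^^ k) x \<in> C V}) - 1)"
      using pos Tin[OF x(1)] by (simp add: of_nat_diff)
    then show ?thesis using x by (intro bexI[of _ x]) (simp_all add: sum_subtractf algebra_simps)
  qed
  then obtain \<mu> where \<mu>: "\<mu> \<in> inv_prob X T" "b + 1 \<le> (\<Sum>V\<in>\<V>. measure \<mu> (C V))"
    using exists_invariant_measure[OF tds fin, of C "b + 1"] C by blast
  have prob: "prob_space \<mu>" and space: "space \<mu> = topspace X"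
    and sets: "sets \<mu> = sigma_sets (topspace X) {U. openin X U}"
    using \<mu>(1) by (auto simp: inv_prob_def)
  interpret prob_space \<mu> by fact
  have Vm [measurable]: "V \<in> sets \<mu>" if "V \<in> \<V>" for V using op[OF that] by (auto simp: sets intro: sigma_sets.Basic)
  have card_eq: "real (card {V\<in>\<V>. x \<in> V}) = (\<Sum>V\<in>\<V>. indicator V x)" for x
    using fin by (simp add: indicator_def sum.If_cases Int_def conj_commute)
  have ord_meas: "(\<lambda>x. ennreal (cover_ord \<V> x)) \<in> borel_measurable \<mu>"
    unfolding cover_ord_def card_eq using Vm by measurable
  have "ennreal b + 1 = ennreal (b + 1)" using b by simp
  also have "\<dots> \<le> (\<Sum>V\<in>\<V>. ennreal (measure \<mu> (C V)))"
    using \<mu>(2) by (simp add: sum_ennreal ennreal_leI)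
  also have "\<dots> \<le> (\<Sum>V\<in>\<V>. emeasure \<mu> V)"
    using C Vm by (intro sum_mono) (auto simp: emeasure_eq_measure intro!: finite_measure_mono)
  also have "\<dots> = (\<Sum>V\<in>\<V>. \<integral>\<^sup>+x. indicator V x \<partial>\<mu>)" using Vm by (intro sum.cong refl) simp
  also have "\<dots> = (\<integral>\<^sup>+x. (\<Sum>V\<in>\<V>. indicator V x) \<partial>\<mu>)"
    using Vm by (intro nn_integral_sum[symmetric]) auto
  also have "\<dots> = (\<integral>\<^sup>+x. ennreal (cover_ord \<V> x) + 1 \<partial>\<mu>)"
  proof (rule nn_integral_cong)
    fix x assume "x \<in> space \<mu>"
    then have "x \<in> topspace X" by (simp add: space)
    moreover have "{V\<in>\<V>. x \<in> C V} \<subseteq> {V\<in>\<V>. x \<in> V}" using C by auto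
    ultimately have "1 \<le> card {V\<in>\<V>. x \<in> V}"
      using pos[of x] card_mono[of "{V\<in>\<V>. x \<in> V}" "{V\<in>\<V>. x \<in> C V}"] fin by simp
    then have "ennreal (cover_ord \<V> x) + 1 = ennreal (real (card {V\<in>\<V>. x \<in> V}))"
      by (simp add: cover_ord_def flip: ennreal_1 ennreal_plus)
    also have "\<dots> = (\<Sum>V\<in>\<V>. ennreal (indicator V x))" unfolding card_eq by (simp add: sum_ennreal)
    also have "\<dots> = (\<Sum>V\<in>\<V>. indicator V x)" by (simp add: ennreal_indicator)
    finally show "(\<Sum>V\<in>\<V>. indicator V x) = ennreal (cover_ord \<V> x) + 1" by simp
  qed
  also have "\<dots> = (\<integral>\<^sup>+x. ennreal (cover_ord \<V> x) \<partial>\<mu>) + 1"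
    using ord_meas by (simp add: nn_integral_add emeasure_space_1)
  finally have "ennreal b \<le> (\<integral>\<^sup>+x. ennreal (cover_ord \<V> x) \<partial>\<mu>)"
    by (simp add: ennreal_add_left_cancel_le add.commute)
  also have "\<dots> \<le> cover_ord_dyn X T \<V>" unfolding cover_ord_dyn_def using \<mu>(1) by (rule SUP_upper)
  finally show False using b(1) by simp
qed

subsection \<open>The space of maps into the cube\<close>

lemma ziter_0 [simp]: "ziter X T 0 x = x"
  by (simp add: ziter_def)

lemma ziter_in:
  assumes "tds X T" "x \<in> topspace X"
  shows "ziter X T k x \<in> topspace X"
proof -
  have surj: "T ` topspace X = topspace X"
    using assms(1) by (simp add: tds_def homeomorphic_imp_surjective_map)
  have "(T ^^ n) x \<in> topspace X" for n using assms(2) surj by (induction n) auto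
  moreover have "(inv_into (topspace X) T ^^ n) x \<in> topspace X" for n
    using assms(2) surj by (induction n) (auto intro: inv_into_into)
  ultimately show ?thesis by (simp add: ziter_def)
qed

text \<open>The first form moves along an orbit, the second gives equivariance of the orbit map. The
  delicate case is \<open>k = - 1\<close>, where the definition of \<open>ziter\<close> changes
  branch.\<close>

lemma ziter_Suc:
  assumes "tds X T" "x \<in> topspace X"
  shows "ziter X T (k + 1) x = T (ziter X T k x)" and "ziter X T (k + 1) x = ziter X T k (T x)"
proof -
  let ?S = "inv_into (topspace X) T"
  have hom: "homeomorphic_map X X T" using assms(1) by (simp add: tds_def)
  have surj: "T ` topspace X = topspace X" using hom by (rule homeomorphic_imp_surjective_map)
  have inj: "inj_on T (topspace X)" using hom by (rule homeomorphic_imp_injective_map)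
  have S_in: "(?S ^^ n) x \<in> topspace X" for n
    using assms(2) surj by (induction n) (auto intro: inv_into_into)
  have TS: "T (?S y) = y" if "y \<in> topspace X" for y
    using that surj by (auto intro: f_inv_into_f)
  have ST: "?S (T x) = x" using inj assms(2) by (rule inv_into_f_f)
  have "ziter X T (k + 1) x = T (ziter X T k x) \<and> ziter X T (k + 1) x = ziter X T k (T x)"
  proof (cases "0 \<le> k")
    case True
    then have "nat (k + 1) = Suc (nat k)" by simp
    then show ?thesis using True by (simp add: ziter_def funpow_swap1)
  next
    case False
    define n where "n = nat (- (k + 1))"
    have "nat (- k) = Suc n" using False unfolding n_def by arith
    then have "ziter X T k y = (?S ^^ Suc n) y" for y using False by (simp add: ziter_def del: funpow.simps)
    moreover have "ziter X T (k + 1) x = (?S ^^ n) x"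
      using False by (cases "0 \<le> k + 1") (auto simp: ziter_def n_def)
    ultimately show ?thesis
      using TS[OF S_in[of n]] ST funpow_swap1[of ?S n "T x"] by simp
  qed
  then show "ziter X T (k + 1) x = T (ziter X T k x)" "ziter X T (k + 1) x = ziter X T k (T x)" by auto
qed

lemma ziter_add_nat:
  assumes "tds X T" "x \<in> topspace X"
  shows "ziter X T (k + int j) x = (T ^^ j) (ziter X T k x)"
proof (induction j)
  case (Suc j)
  then show ?case using ziter_Suc(1)[OF assms, of "k + int j"] by (simp add: add_ac)
qed simp

lemma continuous_map_ziter:
  assumes "tds X T"
  shows "continuous_map X X (ziter X T k)"
proof -
  have hom: "homeomorphic_map X X T" using assms by (simp add: tds_def)
  have T: "continuous_map X X T" using hom by (rule homeomorphic_imp_continuous_map)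
  have inj: "inj_on T (topspace X)" using hom by (rule homeomorphic_imp_injective_map)
  have surj: "T ` topspace X = topspace X" using hom by (rule homeomorphic_imp_surjective_map)
  obtain S where S: "homeomorphic_maps X X T S" using hom homeomorphic_map_maps by blast
  have "continuous_map X X (inv_into (topspace X) T)"
  proof (rule continuous_map_eq)
    show "continuous_map X X S" using S by (simp add: homeomorphic_maps_def)
    fix y assume y: "y \<in> topspace X"
    have "S y \<in> topspace X" "T (S y) = y"
      using S y by (auto simp: homeomorphic_maps_def continuous_map_def)
    then show "S y = inv_into (topspace X) T y" using inj by (metis inv_into_f_f)
  qed
  then have "continuous_map X X (inv_into (topspace X) T ^^ n)" for n
    by (induction n) (auto simp: id_def intro: continuous_map_compose)
  moreover have "continuous_map X X (T ^^ n)" for n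
    using T by (induction n) (auto simp: id_def intro: continuous_map_compose)
  ultimately show ?thesis by (simp add: ziter_def)
qed

lemma cube_maps_iff:
  "f \<in> cube_maps X \<longleftrightarrow> f \<in> extensional (topspace X) \<and> (\<forall>c. continuous_map X euclideanreal (\<lambda>x. f x $ c))
     \<and> (\<forall>x\<in>topspace X. \<forall>c. 0 \<le> f x $ c \<and> f x $ c \<le> 1)"
proof -
  have "continuous_map X euclidean f \<longleftrightarrow> (\<forall>c. continuous_map X euclideanreal (\<lambda>x. f x $ c))"
    by (auto simp: continuous_map_atin intro: tendsto_vec_nth vec_tendstoI)
  then show ?thesis
    by (auto simp: cube_maps_def continuous_map_in_subtopology cube_def image_subset_iff)
qed

lemma unif_dist_ge:
  assumes "f \<in> cube_maps X" "g \<in> cube_maps X" "x \<in> topspace X"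
  shows "\<bar>f x $ c - g x $ c\<bar> \<le> unif_dist X f g"
proof -
  let ?m = "\<lambda>x. MAX c. \<bar>f x $ c - g x $ c\<bar>"
  have "\<bar>f y $ c - g y $ c\<bar> \<le> 1" if "y \<in> topspace X" for y c
  proof -
    have "0 \<le> f y $ c" "f y $ c \<le> 1" "0 \<le> g y $ c" "g y $ c \<le> 1"
      using assms that by (auto simp: cube_maps_iff)
    then show ?thesis by linarith
  qed
  then have "?m y \<le> 1" if "y \<in> topspace X" for y using that by (subst Max_le_iff) auto
  then have "bdd_above (?m ` topspace X)" by (intro bdd_aboveI2)
  with assms(3) have "?m x \<le> (SUP x\<in>topspace X. ?m x)" by (rule cSUP_upper)
  moreover have "unif_dist X f g = (SUP x\<in>topspace X. ?m x)" using assms(1,2) by (simp add: unif_dist_def)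
  moreover have "\<bar>f x $ c - g x $ c\<bar> \<le> ?m x" by (rule Max_ge) auto
  ultimately show ?thesis by linarith
qed

lemma unif_dist_le:
  assumes "f \<in> cube_maps X" "g \<in> cube_maps X" "topspace X \<noteq> {}"
    and "\<And>x c. x \<in> topspace X \<Longrightarrow> \<bar>f x $ c - g x $ c\<bar> \<le> b"
  shows "unif_dist X f g \<le> b"
proof -
  have "(MAX c. \<bar>f x $ c - g x $ c\<bar>) \<le> b" if "x \<in> topspace X" for x
    using assms(4)[OF that] by (subst Max_le_iff) auto
  then show ?thesis using assms(1-3) by (auto simp: unif_dist_def intro!: cSUP_least)
qed

text \<open>Completeness is what Baire's theorem requires; uniform limits are continuous and stay in
  the closed cube.\<close>

lemma mcomplete_cube_maps:
  assumes ne: "topspace X \<noteq> {}"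
  shows "Metric_space.mcomplete (cube_maps X) (unif_dist X :: ('a \<Rightarrow> real ^ 'n) \<Rightarrow> _)"
proof -
  interpret Metric_space "cube_maps X" "unif_dist X :: ('a \<Rightarrow> real ^ 'n) \<Rightarrow> _"
    using ne by (rule Metric_space_cube_maps)
  show ?thesis
    unfolding mcomplete_def
  proof (intro allI impI)
    fix \<sigma> :: "nat \<Rightarrow> 'a \<Rightarrow> real ^ 'n" assume C: "MCauchy \<sigma>"
    then have \<sigma>: "\<sigma> i \<in> cube_maps X" for i unfolding MCauchy_def by auto
    have Cau: "\<exists>N. \<forall>i\<ge>N. \<forall>j\<ge>N. unif_dist X (\<sigma> i) (\<sigma> j) < e" if "0 < e" for e
      using C that unfolding MCauchy_def by meson
    have conv: "convergent (\<lambda>i. \<sigma> i x $ c)" if x: "x \<in> topspace X" for x c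
    proof -
      have "Cauchy (\<lambda>i. \<sigma> i x $ c)"
        unfolding Cauchy_def
      proof (intro allI impI)
        fix e :: real assume "0 < e"
        then obtain N where "\<forall>i\<ge>N. \<forall>j\<ge>N. unif_dist X (\<sigma> i) (\<sigma> j) < e" using Cau by blast
        then show "\<exists>N. \<forall>i\<ge>N. \<forall>j\<ge>N. dist (\<sigma> i x $ c) (\<sigma> j x $ c) < e"
          using unif_dist_ge[OF \<sigma> \<sigma> x] unfolding dist_real_def by (meson le_less_trans)
      qed
      then show ?thesis by (rule Cauchy_convergent)
    qed
    define g where "g = restrict (\<lambda>x. \<chi> c. lim (\<lambda>i. \<sigma> i x $ c)) (topspace X)"
    have lim: "(\<lambda>i. \<sigma> i x $ c) \<longlonglongrightarrow> g x $ c" if "x \<in> topspace X" for x c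
      using conv[OF that, of c] that by (simp add: g_def convergent_LIMSEQ_iff)
    have unif: "\<exists>N. \<forall>i\<ge>N. \<forall>x\<in>topspace X. \<forall>c. \<bar>\<sigma> i x $ c - g x $ c\<bar> \<le> e" if e: "0 < e" for e
    proof -
      obtain N where N: "\<forall>i\<ge>N. \<forall>j\<ge>N. unif_dist X (\<sigma> i) (\<sigma> j) < e" using Cau[OF e] by blast
      have "\<bar>\<sigma> i x $ c - g x $ c\<bar> \<le> e" if "i \<ge> N" "x \<in> topspace X" for i x c
      proof (rule tendsto_upperbound)
        show "(\<lambda>j. \<bar>\<sigma> i x $ c - \<sigma> j x $ c\<bar>) \<longlonglongrightarrow> \<bar>\<sigma> i x $ c - g x $ c\<bar>"
          by (intro tendsto_rabs tendsto_diff tendsto_const lim[OF that(2)])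
        show "\<forall>\<^sub>F j in sequentially. \<bar>\<sigma> i x $ c - \<sigma> j x $ c\<bar> \<le> e"
          using N that unif_dist_ge[OF \<sigma> \<sigma> that(2)] unfolding eventually_sequentially
          by (meson le_less_trans less_imp_le)
      qed simp
      then show ?thesis by blast
    qed
    have g: "g \<in> cube_maps X"
      unfolding cube_maps_iff
    proof (intro conjI allI ballI)
      show "g \<in> extensional (topspace X)" by (simp add: g_def)
      fix c
      have "continuous_map X Met_TC.mtopology (\<lambda>x. g x $ c)"
      proof (rule Met_TC.continuous_map_uniform_limit[where F = sequentially and f = "\<lambda>i x. \<sigma> i x $ c"])
        show "\<forall>\<^sub>F i in sequentially. continuous_map X Met_TC.mtopology (\<lambda>x. \<sigma> i x $ c)"
          using \<sigma> by (simp add: cube_maps_iff)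
        fix e :: real assume "0 < e"
        then obtain N where "\<forall>i\<ge>N. \<forall>x\<in>topspace X. \<forall>c. \<bar>\<sigma> i x $ c - g x $ c\<bar> \<le> e / 2" using unif[of "e / 2"] by auto
        then have "dist (\<sigma> i x $ c) (g x $ c) \<le> e / 2" if "i \<ge> N" "x \<in> topspace X" for i x
          using that by (simp add: dist_real_def)
        moreover have "e / 2 < e" using \<open>0 < e\<close> by simp
        ultimately show "\<forall>\<^sub>F i in sequentially. \<forall>x\<in>topspace X. g x $ c \<in> UNIV \<and> dist (\<sigma> i x $ c) (g x $ c) < e"
          unfolding eventually_sequentially by (meson UNIV_I le_less_trans)
      qed simp
      then show "continuous_map X euclideanreal (\<lambda>x. g x $ c)" by simp
      fix x assume x: "x \<in> topspace X"
      have b: "0 \<le> \<sigma> i x $ c" "\<sigma> i x $ c \<le> 1" for i using \<sigma>[of i] x by (auto simp: cube_maps_iff)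
      show "0 \<le> g x $ c" using lim[OF x] b(1) by (intro tendsto_lowerbound[OF lim[OF x]]) auto
      show "g x $ c \<le> 1" using lim[OF x] b(2) by (intro tendsto_upperbound[OF lim[OF x]]) auto
    qed
    have "limitin mtopology \<sigma> g sequentially"
      unfolding limit_metric_sequentially
    proof (intro conjI allI impI g)
      fix e :: real assume e: "0 < e"
      then obtain N where "\<forall>i\<ge>N. \<forall>x\<in>topspace X. \<forall>c. \<bar>\<sigma> i x $ c - g x $ c\<bar> \<le> e / 2" using unif[of "e / 2"] by auto
      then have "unif_dist X (\<sigma> i) g \<le> e / 2" if "i \<ge> N" for i
        using that by (intro unif_dist_le \<sigma> g ne) auto
      then show "\<exists>N. \<forall>i\<ge>N. \<sigma> i \<in> cube_maps X \<and> unif_dist X (\<sigma> i) g < e"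
      proof (intro exI[of _ N] allI impI conjI \<sigma>)
        fix i assume "N \<le> i"
        then have "unif_dist X (\<sigma> i) g \<le> e / 2" using \<open>\<And>i. N \<le> i \<Longrightarrow> unif_dist X (\<sigma> i) g \<le> e / 2\<close> by blast
        then show "unif_dist X (\<sigma> i) g < e" using e by linarith
      qed
    qed
    then show "\<exists>g. limitin mtopology \<sigma> g sequentially" by blast
  qed
qed

section \<open>Openness of the set of separating maps\<close>

definition separating_maps :: "'a topology \<Rightarrow> ('a \<Rightarrow> 'a) \<Rightarrow> 'a set set \<Rightarrow> ('a \<Rightarrow> real ^ 'n) set" where
  "separating_maps X T \<U> = {f \<in> cube_maps X. \<forall>x\<in>topspace X. \<forall>y\<in>topspace X.
     orbit_map X T f x = orbit_map X T f y \<longrightarrow> (\<exists>U\<in>\<U>. x \<in> U \<and> y \<in> U)}"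

text \<open>The pairs without a common member of \<open>\<U>\<close> form a compact set, and
  \<open>f\<close> separates each of them at some time and coordinate. The increasing open sets
  \<open>Ob i\<close> turn this into a uniform gap \<open>1 / Suc i\<close>. A map closer than half
  the gap still separates, since each of the two points loses less than half.\<close>

lemma openin_separating_maps:
  assumes tds: "tds X T" and U: "\<And>U. U \<in> \<U> \<Longrightarrow> openin X U"
  shows "openin (unif_topology X) (separating_maps X T \<U> :: ('a \<Rightarrow> real ^ 'n) set)"
proof -
  have ne: "topspace X \<noteq> {}" and comp: "compact_space X" using tds by (auto simp: tds_def)
  interpret Metric_space "cube_maps X" "unif_dist X :: ('a \<Rightarrow> real ^ 'n) \<Rightarrow> _"
    using ne by (rule Metric_space_cube_maps)
  have "\<exists>r>0. mball f r \<subseteq> separating_maps X T \<U>"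
    if f: "f \<in> separating_maps X T \<U>" for f :: "'a \<Rightarrow> real ^ 'n"
  proof -
    have fc: "f \<in> cube_maps X" using f by (simp add: separating_maps_def)
    define E where "E = topspace X \<times> topspace X - (\<Union>U\<in>\<U>. U \<times> U)"
    have "openin (prod_topology X X) (\<Union>U\<in>\<U>. U \<times> U)"
      using U by (intro openin_Union) (auto simp: openin_prod_Times_iff)
    then have "closedin (prod_topology X X) E"
      unfolding E_def by (simp add: closedin_diff flip: topspace_prod_topology)
    then have E: "compactin (prod_topology X X) E"
      using comp by (intro closedin_compact_space) (simp add: compact_space_prod_topology)
    define h where "h k c p = \<bar>f (ziter X T k (fst p)) $ c - f (ziter X T k (snd p)) $ c\<bar>" for k c p
    define Ob where "Ob i = (\<Union>k. \<Union>c. {p \<in> topspace (prod_topology X X). h k c p \<in> {1 / real (Suc i) <..}})" for i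
    have hc: "continuous_map (prod_topology X X) euclideanreal (h k c)" for k c
    proof -
      have "continuous_map X euclideanreal (\<lambda>x. f (ziter X T k x) $ c)"
        using continuous_map_compose[OF continuous_map_ziter[OF tds, of k], of euclideanreal "\<lambda>x. f x $ c"] fc
        by (simp add: cube_maps_iff o_def)
      then have "continuous_map (prod_topology X X) euclideanreal ((\<lambda>x. f (ziter X T k x) $ c) \<circ> fst)"
        "continuous_map (prod_topology X X) euclideanreal ((\<lambda>x. f (ziter X T k x) $ c) \<circ> snd)"
        by (auto intro: continuous_map_compose continuous_map_fst continuous_map_snd)
      then show ?thesis unfolding h_def o_def
        by (intro continuous_map_real_abs continuous_map_diff) auto
    qed
    have Ob_open: "openin (prod_topology X X) (Ob i)" for i
      unfolding Ob_def by (intro openin_Union ballI; clarsimp)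
        (use openin_continuous_map_preimage[OF hc, of "{1 / real (Suc i) <..}" for i] in \<open>auto\<close>)
    have Ob_mono: "Ob i \<subseteq> Ob j" if "i \<le> j" for i j
    proof -
      have "1 / real (Suc j) \<le> 1 / real (Suc i)" using that by (simp add: frac_le)
      then show ?thesis unfolding Ob_def by (auto intro: le_less_trans)
    qed
    have cover: "E \<subseteq> (\<Union>i. Ob i)"
    proof
      fix p assume p: "p \<in> E"
      obtain x y where xy: "p = (x, y)" by (cases p)
      have "x \<in> topspace X" "y \<in> topspace X" "\<not> (\<exists>U\<in>\<U>. x \<in> U \<and> y \<in> U)"
        using p by (auto simp: E_def xy)
      then have "orbit_map X T f x \<noteq> orbit_map X T f y" using f by (auto simp: separating_maps_def)
      then obtain k where "f (ziter X T k x) \<noteq> f (ziter X T k y)" by (auto simp: orbit_map_def)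
      then obtain c where "f (ziter X T k x) $ c \<noteq> f (ziter X T k y) $ c" by (auto simp: vec_eq_iff)
      then have "0 < h k c p" by (simp add: h_def xy)
      then obtain i where "1 / real (Suc i) < h k c p" using nat_approx_posE by blast
      moreover have "p \<in> topspace (prod_topology X X)" using p by (auto simp: E_def)
      ultimately show "p \<in> (\<Union>i. Ob i)" unfolding Ob_def by blast
    qed
    obtain \<F> where \<F>: "finite \<F>" "\<F> \<subseteq> range Ob" "E \<subseteq> \<Union>\<F>"
      using E cover Ob_open unfolding compactin_def by (metis (no_types, lifting) imageE)
    obtain I where I: "finite I" "\<F> = Ob ` I" using finite_subset_image[OF \<F>(1,2)] by blast
    define i where "i = Max (insert 0 I)"
    have i: "j \<le> i" if "j \<in> I" for j unfolding i_def using I(1) that by (intro Max_ge) auto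
    have Ei: "E \<subseteq> Ob i" using \<F>(3) I(2) Ob_mono[OF i] by blast
    define r where "r = 1 / (2 * real (Suc i))"
    have "mball f r \<subseteq> separating_maps X T \<U>"
    proof
      fix g assume "g \<in> mball f r"
      then have gc: "g \<in> cube_maps X" and d: "unif_dist X f g < r" by auto
      have "\<exists>U\<in>\<U>. x \<in> U \<and> y \<in> U"
        if x: "x \<in> topspace X" and y: "y \<in> topspace X" and eq: "orbit_map X T g x = orbit_map X T g y" for x y
      proof (rule ccontr)
        assume "\<not> ?thesis"
        then have "(x, y) \<in> E" using x y by (auto simp: E_def)
        then obtain k c where kc: "1 / real (Suc i) < h k c (x, y)" using Ei unfolding Ob_def by auto
        have "\<bar>f (ziter X T k x) $ c - g (ziter X T k x) $ c\<bar> < r"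
          using unif_dist_ge[OF fc gc ziter_in[OF tds x]] d by (meson le_less_trans)
        moreover have "\<bar>f (ziter X T k y) $ c - g (ziter X T k y) $ c\<bar> < r"
          using unif_dist_ge[OF fc gc ziter_in[OF tds y]] d by (meson le_less_trans)
        moreover have "g (ziter X T k x) $ c = g (ziter X T k y) $ c"
          using fun_cong[OF eq, of k] by (simp add: orbit_map_def)
        moreover have "2 * r = 1 / real (Suc i)" by (simp add: r_def field_simps)
        moreover have "1 / real (Suc i) < \<bar>f (ziter X T k x) $ c - f (ziter X T k y) $ c\<bar>"
          using kc unfolding h_def fst_conv snd_conv .
        ultimately show False by linarith
      qed
      then show "g \<in> separating_maps X T \<U>" using gc by (simp add: separating_maps_def)
    qed
    moreover have "0 < r" by (simp add: r_def)
    ultimately show ?thesis by blast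
  qed
  then show ?thesis
    unfolding unif_topology_def openin_mtopology by (auto simp: separating_maps_def)
qed

subsection \<open>Density of separating maps\<close>

text \<open>\<open>W\<close> is there for the induction: while the other members are shrunk, the new
  member \<open>V\<close> is part of \<open>W\<close>; afterwards \<open>V\<close> is shrunk around
  what the rest leaves uncovered.\<close>

lemma shrink_finite_cover:
  assumes normal: "normal_space X" and fin: "finite \<V>" and op: "\<And>V. V \<in> \<V> \<Longrightarrow> openin X V"
    and W: "openin X W" and cov: "\<Union>\<V> \<union> W = topspace X"
  shows "\<exists>Q. (\<forall>V\<in>\<V>. openin X (Q V) \<and> X closure_of (Q V) \<subseteq> V) \<and> (\<Union>V\<in>\<V>. Q V) \<union> W = topspace X"
  using fin op W cov
proof (induction \<V> arbitrary: W rule: finite_induct)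
  case (insert V \<V>)
  have "openin X (V \<union> W)" "\<Union>\<V> \<union> (V \<union> W) = topspace X"
    using insert.prems by auto
  then obtain Q where Q: "\<forall>V\<in>\<V>. openin X (Q V) \<and> X closure_of (Q V) \<subseteq> V"
      "(\<Union>V\<in>\<V>. Q V) \<union> (V \<union> W) = topspace X"
    using insert.IH[of "V \<union> W"] insert.prems by auto
  define S where "S = topspace X - ((\<Union>V\<in>\<V>. Q V) \<union> W)"
  have "openin X ((\<Union>V\<in>\<V>. Q V) \<union> W)" using Q(1) insert.prems by auto
  then have "closedin X S" unfolding S_def by (intro closedin_diff) auto
  moreover have "S \<subseteq> V" using Q(2) by (auto simp: S_def)
  moreover have "openin X V" using insert.prems by simp
  ultimately obtain O' where O': "openin X O'" "S \<subseteq> O'" "X closure_of O' \<subseteq> V"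
    using normal unfolding normal_space_alt by metis
  define Q' where "Q' = Q(V := O')"
  have Q'_eq: "Q' V' = Q V'" if "V' \<in> \<V>" for V' using that insert.hyps by (auto simp: Q'_def)
  have "(\<Union>V'\<in>\<V>. Q' V') = (\<Union>V\<in>\<V>. Q V)" using Q'_eq by (intro SUP_cong refl)
  moreover have "Q' V = O'" by (simp add: Q'_def)
  ultimately have "(\<Union>V'\<in>insert V \<V>. Q' V') = O' \<union> (\<Union>V\<in>\<V>. Q V)" by simp
  moreover have "O' \<union> (\<Union>V\<in>\<V>. Q V) \<union> W = topspace X"
  proof
    have "O' \<subseteq> topspace X" using O'(1) by (rule openin_subset)
    then show "O' \<union> (\<Union>V\<in>\<V>. Q V) \<union> W \<subseteq> topspace X" using Q(2) by blast
    show "topspace X \<subseteq> O' \<union> (\<Union>V\<in>\<V>. Q V) \<union> W" using O'(2) unfolding S_def by blast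
  qed
  ultimately have "(\<Union>V'\<in>insert V \<V>. Q' V') \<union> W = topspace X" by simp
  moreover have "\<forall>V'\<in>insert V \<V>. openin X (Q' V') \<and> X closure_of (Q' V') \<subseteq> V'"
    using Q(1) O' Q'_eq by (simp add: Q'_def)
  ultimately show ?case by blast
qed auto

text \<open>Besides the functions, closed sets \<open>C V\<close> inside \<open>V\<close> are
  needed, because orbit averages are controlled on closed sets. They come from shrinking twice: a
  Urysohn function is \<open>1\<close> on the inner sets, which still cover, and \<open>0\<close>
  off the outer sets, whose closures are the \<open>C V\<close>.\<close>

lemma exists_partition_of_unity:
  assumes normal: "normal_space X" and V: "\<V> \<in> open_covers X"
  obtains C \<phi> where "\<And>V. V \<in> \<V> \<Longrightarrow> closedin X (C V) \<and> C V \<subseteq> V"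
    and "\<And>V. V \<in> \<V> \<Longrightarrow> continuous_map X euclideanreal (\<phi> V)"
    and "\<And>V x. V \<in> \<V> \<Longrightarrow> x \<in> topspace X \<Longrightarrow> 0 \<le> \<phi> V x"
    and "\<And>V x. V \<in> \<V> \<Longrightarrow> x \<in> topspace X \<Longrightarrow> \<phi> V x \<noteq> 0 \<Longrightarrow> x \<in> C V"
    and "\<And>x. x \<in> topspace X \<Longrightarrow> (\<Sum>V\<in>\<V>. \<phi> V x) = 1"
proof -
  have fin: "finite \<V>" and op: "\<And>V. V \<in> \<V> \<Longrightarrow> openin X V" and un: "\<Union>\<V> = topspace X"
    using V by (auto simp: open_covers_def)
  obtain Q where Q: "\<forall>V\<in>\<V>. openin X (Q V) \<and> X closure_of (Q V) \<subseteq> V" "(\<Union>V\<in>\<V>. Q V) = topspace X"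
    using shrink_finite_cover[OF normal fin op, of "{}"] un by auto
  have "\<forall>V\<in>\<V>. \<exists>R. openin X R \<and> X closure_of (Q V) \<subseteq> R \<and> X closure_of R \<subseteq> V"
    using Q(1) op normal unfolding normal_space_alt by (metis closedin_closure_of)
  then obtain R where R: "\<And>V. V \<in> \<V> \<Longrightarrow> openin X (R V) \<and> X closure_of (Q V) \<subseteq> R V \<and> X closure_of (R V) \<subseteq> V"
    by metis
  have "\<forall>V\<in>\<V>. \<exists>\<theta>. continuous_map X euclideanreal \<theta> \<and> (\<forall>x\<in>topspace X. 0 \<le> \<theta> x) \<and>
      (\<forall>x\<in>Q V. \<theta> x = 1) \<and> (\<forall>x\<in>topspace X - R V. \<theta> x = 0)"
  proof
    fix V assume V: "V \<in> \<V>"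
    have "closedin X (topspace X - R V)" using R[OF V] by (intro closedin_diff) auto
    moreover have "disjnt (topspace X - R V) (X closure_of (Q V))" using R[OF V] by (auto simp: disjnt_def)
    ultimately obtain \<theta> where \<theta>: "continuous_map X (top_of_set {0..1::real}) \<theta>"
        "\<theta> ` (topspace X - R V) \<subseteq> {0}" "\<theta> ` (X closure_of (Q V)) \<subseteq> {1}"
      using Urysohn_lemma[OF normal, of "topspace X - R V" "X closure_of (Q V)" 0 1] by auto
    have "Q V \<subseteq> X closure_of (Q V)" using Q(1) V by (intro closure_of_subset openin_subset) auto
    moreover have "continuous_map X euclideanreal \<theta>" "\<forall>x\<in>topspace X. 0 \<le> \<theta> x"
      using \<theta>(1) by (auto simp: continuous_map_in_subtopology image_subset_iff)
    ultimately show "\<exists>\<theta>. continuous_map X euclideanreal \<theta> \<and> (\<forall>x\<in>topspace X. 0 \<le> \<theta> x) \<and>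
      (\<forall>x\<in>Q V. \<theta> x = 1) \<and> (\<forall>x\<in>topspace X - R V. \<theta> x = 0)"
      using \<theta>(2,3) by (intro exI[of _ \<theta>]) blast
  qed
  from bchoice[OF this] obtain \<theta> where \<theta>': "\<forall>V\<in>\<V>. continuous_map X euclideanreal (\<theta> V) \<and> (\<forall>x\<in>topspace X. 0 \<le> \<theta> V x) \<and>
      (\<forall>x\<in>Q V. \<theta> V x = 1) \<and> (\<forall>x\<in>topspace X - R V. \<theta> V x = 0)" ..
  then have \<theta>: "\<And>V. V \<in> \<V> \<Longrightarrow> continuous_map X euclideanreal (\<theta> V)"
      "\<And>V x. V \<in> \<V> \<Longrightarrow> x \<in> topspace X \<Longrightarrow> 0 \<le> \<theta> V x"
      "\<And>V x. V \<in> \<V> \<Longrightarrow> x \<in> Q V \<Longrightarrow> \<theta> V x = 1"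
      "\<And>V x. V \<in> \<V> \<Longrightarrow> x \<in> topspace X \<Longrightarrow> x \<notin> R V \<Longrightarrow> \<theta> V x = 0"
    by blast+
  define s where "s x = (\<Sum>V\<in>\<V>. \<theta> V x)" for x
  have s_pos: "0 < s x" if x: "x \<in> topspace X" for x
  proof -
    obtain V where V: "V \<in> \<V>" "x \<in> Q V" using Q(2) x by blast
    have "\<theta> V x \<le> s x" unfolding s_def using fin V \<theta>(2) x by (intro member_le_sum) auto
    then show ?thesis using \<theta>(3)[OF V] by linarith
  qed
  show thesis
  proof (rule that[of "\<lambda>V. X closure_of (R V)" "\<lambda>V x. \<theta> V x / s x"])
    fix V assume V: "V \<in> \<V>"
    show "closedin X (X closure_of (R V)) \<and> X closure_of (R V) \<subseteq> V" using R[OF V] by simp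
    show "continuous_map X euclideanreal (\<lambda>x. \<theta> V x / s x)"
    proof (rule continuous_map_real_divide)
      show "continuous_map X euclideanreal s" unfolding s_def using fin \<theta>(1) by (rule continuous_map_sum)
      show "s x \<noteq> 0" if "x \<in> topspace X" for x using s_pos[OF that] by simp
    qed (rule \<theta>(1)[OF V])
    fix x assume x: "x \<in> topspace X"
    show "0 \<le> \<theta> V x / s x" using \<theta>(2)[OF V x] s_pos[OF x] by simp
    show "x \<in> X closure_of (R V)" if "\<theta> V x / s x \<noteq> 0"
    proof -
      have "x \<in> R V" using \<theta>(4)[OF V x] that by fastforce
      moreover have "R V \<subseteq> X closure_of (R V)" using R[OF V] by (intro closure_of_subset openin_subset) auto
      ultimately show ?thesis by blast
    qed
  next
    fix x assume x: "x \<in> topspace X"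
    show "(\<Sum>V\<in>\<V>. \<theta> V x / s x) = 1"
      using s_pos[OF x] by (simp add: s_def flip: sum_divide_distrib)
  qed
qed

lemma exists_finite_open_cover:
  assumes comp: "compact_space X" and loc: "\<And>x. x \<in> topspace X \<Longrightarrow> \<exists>U. openin X U \<and> x \<in> U \<and> P U"
  shows "\<exists>\<U>\<in>open_covers X. \<forall>U\<in>\<U>. P U"
proof -
  define \<G> where "\<G> = {U. openin X U \<and> P U}"
  have "topspace X \<subseteq> \<Union>\<G>" using loc by (auto simp: \<G>_def)
  moreover have "openin X U" if "U \<in> \<G>" for U using that by (simp add: \<G>_def)
  moreover have "compactin X (topspace X)" using comp by (simp add: compact_space_def)
  ultimately obtain \<F> where \<F>: "finite \<F>" "\<F> \<subseteq> \<G>" "topspace X \<subseteq> \<Union>\<F>"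
    using compactinD[of X "topspace X" \<G>] by blast
  have "U \<subseteq> topspace X" if "U \<in> \<F>" for U
    using that \<F>(2) by (intro openin_subset) (auto simp: \<G>_def)
  then have "\<Union>\<F> \<subseteq> topspace X" by blast
  then have "\<F> \<in> open_covers X" using \<F> by (auto simp: open_covers_def \<G>_def)
  then show ?thesis using \<F>(2) by (auto simp: \<G>_def)
qed

lemma exists_small_oscillation_cover:
  fixes f :: "'a \<Rightarrow> real ^ 'n"
  assumes comp: "compact_space X" and f: "f \<in> cube_maps X" and d: "0 < d"
  shows "\<exists>\<O>\<in>open_covers X. \<forall>V\<in>\<O>. \<forall>x\<in>V. \<forall>y\<in>V. \<forall>c. \<bar>f x $ c - f y $ c\<bar> < d"
proof (rule exists_finite_open_cover[OF comp])
  fix x assume x: "x \<in> topspace X"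
  define U where "U = topspace X \<inter> (\<Inter>c. {y \<in> topspace X. f y $ c \<in> ball (f x $ c) (d / 2)})"
  have "openin X U" unfolding U_def
  proof (rule openin_Int_Inter[of "range (\<lambda>c. {y \<in> topspace X. f y $ c \<in> ball (f x $ c) (d / 2)})", simplified image_image])
    show "finite (range (\<lambda>c. {y \<in> topspace X. f y $ c \<in> ball (f x $ c) (d / 2)}))" by simp
    fix V assume "V \<in> range (\<lambda>c. {y \<in> topspace X. f y $ c \<in> ball (f x $ c) (d / 2)})"
    then obtain c where V: "V = {y \<in> topspace X. f y $ c \<in> ball (f x $ c) (d / 2)}" by blast
    have "continuous_map X euclideanreal (\<lambda>x. f x $ c)" using f by (simp add: cube_maps_iff)
    from openin_continuous_map_preimage[OF this, of "ball (f x $ c) (d / 2)"] show "openin X V" unfolding V by simp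
  qed simp
  moreover have "x \<in> U" using x d by (simp add: U_def)
  moreover have "\<bar>f y $ c - f z $ c\<bar> < d" if "y \<in> U" "z \<in> U" for y z c
  proof -
    have "\<bar>f x $ c - f y $ c\<bar> < d / 2" "\<bar>f x $ c - f z $ c\<bar> < d / 2"
      using that by (auto simp: U_def dist_real_def)
    then show ?thesis by linarith
  qed
  ultimately show "\<exists>U. openin X U \<and> x \<in> U \<and> (\<forall>x\<in>U. \<forall>y\<in>U. \<forall>c. \<bar>f x $ c - f y $ c\<bar> < d)" by blast
qed

lemma exists_refinement:
  assumes dim: "dyn_dim X T < b" and U: "\<U> \<in> open_covers X"
  shows "\<exists>\<V>\<in>open_covers X. refines \<V> \<U> \<and> cover_ord_dyn X T \<V> < b"
proof -
  have "cover_dim X T \<U> \<le> dyn_dim X T" unfolding dyn_dim_def using U by (rule SUP_upper)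
  then have "cover_dim X T \<U> < b" using dim by simp
  then show ?thesis unfolding cover_dim_def INF_less_iff by auto
qed

lemma open_covers_Int:
  assumes "\<U> \<in> open_covers X" "\<V> \<in> open_covers X"
  shows "(\<lambda>(U, V). U \<inter> V) ` (\<U> \<times> \<V>) \<in> open_covers X"
proof -
  have "\<Union>((\<lambda>(U, V). U \<inter> V) ` (\<U> \<times> \<V>)) = topspace X"
  proof (intro set_eqI iffI)
    fix x assume "x \<in> \<Union>((\<lambda>(U, V). U \<inter> V) ` (\<U> \<times> \<V>))"
    then obtain U V where "U \<in> \<U>" "x \<in> U" by auto
    then show "x \<in> topspace X" using assms(1) unfolding open_covers_def by blast
  next
    fix x assume "x \<in> topspace X"
    then have "x \<in> \<Union>\<U>" "x \<in> \<Union>\<V>" using assms by (simp_all add: open_covers_def)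
    then obtain U V where "U \<in> \<U>" "x \<in> U" "V \<in> \<V>" "x \<in> V" by blast
    then show "x \<in> \<Union>((\<lambda>(U, V). U \<inter> V) ` (\<U> \<times> \<V>))"
      by (intro UnionI[of "U \<inter> V"] image_eqI[of _ _ "(U, V)"]) auto
  qed
  moreover have "finite ((\<lambda>(U, V). U \<inter> V) ` (\<U> \<times> \<V>))"
    using assms by (simp add: open_covers_def)
  moreover have "openin X W" if "W \<in> (\<lambda>(U, V). U \<inter> V) ` (\<U> \<times> \<V>)" for W
    using that assms unfolding open_covers_def by auto
  ultimately show ?thesis unfolding open_covers_def by blast
qed

lemma filter_coeff_bounds: "0 \<le> filter_coeff n m l c i" "filter_coeff n m l c i \<le> 1"
proof -
  have "1 / (8 * real m) \<le> 1"
  proof (cases "m = 0")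
    case False
    then have "1 \<le> real m" by simp
    then have "1 \<le> 8 * real m" by linarith
    then show ?thesis by (simp add: divide_le_eq_1)
  qed simp
  then show "filter_coeff n m l c i \<le> 1" unfolding filter_coeff_def by (intro power_le_one) auto
  show "0 \<le> filter_coeff n m l c i" by (simp add: filter_coeff_def)
qed

lemma separating_maps_dense:
  fixes f :: "'a \<Rightarrow> real ^ 'n"
  assumes tds: "tds X T" and dim: "dyn_dim X T < ennreal (real CARD('n) / 2)"
    and U: "\<U> \<in> open_covers X" and f: "f \<in> cube_maps X" and e: "0 < e"
  shows "\<exists>g\<in>separating_maps X T \<U>. unif_dist X f g < e"
proof -
  have ne: "topspace X \<noteq> {}" and comp: "compact_space X" and metr: "metrizable_space X"
    using tds by (auto simp: tds_def)
  have normal: "normal_space X" using metr by (rule metrizable_imp_normal_space)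
  define n where "n = CARD('n)"
  have n: "n \<ge> 1" by (simp add: n_def Suc_le_eq)
  obtain \<iota> where \<iota>: "bij_betw \<iota> (UNIV :: 'n set) {0..<n}"
    using ex_bij_betw_finite_nat[of "UNIV :: 'n set"] by (auto simp: n_def)
  define \<iota>' where "\<iota>' = inv_into UNIV \<iota>"
  have \<iota>'\<iota>: "\<iota>' (\<iota> c) = c" for c using \<iota> by (simp add: \<iota>'_def bij_betw_def)
  have \<iota>\<iota>': "\<iota> (\<iota>' c) = c" if "c < n" for c
    using \<iota> that by (simp add: \<iota>'_def bij_betw_def f_inv_into_f)
  \<comment> \<open>The error budget is \<open>3 * \<delta>\<close>: oscillation of \<open>f\<close>
    on a member of \<open>\<O>\<close>, the scaling by \<open>1 - \<delta>\<close>, and the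
    perturbation.\<close>
  define \<delta> where "\<delta> = min (e / 4) (1 / 2)"
  have \<delta>: "0 < \<delta>" "\<delta> \<le> 1 / 2" "3 * \<delta> < e" using e by (auto simp: \<delta>_def min_def)
  obtain \<O> where \<O>: "\<O> \<in> open_covers X" "\<forall>V\<in>\<O>. \<forall>x\<in>V. \<forall>y\<in>V. \<forall>c. \<bar>f x $ c - f y $ c\<bar> < \<delta>"
    using exists_small_oscillation_cover[OF comp f \<delta>(1)] by blast
  obtain \<V> where \<V>': "\<V> \<in> open_covers X"
      "refines \<V> ((\<lambda>(U, V). U \<inter> V) ` (\<U> \<times> \<O>)) \<and> cover_ord_dyn X T \<V> < ennreal (real CARD('n) / 2)"
    by (rule bexE[OF exists_refinement[OF dim open_covers_Int[OF U \<O>(1)]]])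
  then have \<V>: "\<V> \<in> open_covers X" "refines \<V> ((\<lambda>(U, V). U \<inter> V) ` (\<U> \<times> \<O>))"
      "cover_ord_dyn X T \<V> < ennreal (real n / 2)"
    by (simp_all add: n_def)
  have sub: "\<exists>U\<in>\<U>. \<exists>Q\<in>\<O>. V \<subseteq> U \<and> V \<subseteq> Q" if "V \<in> \<V>" for V
  proof -
    have "\<exists>W\<in>(\<lambda>(U, V). U \<inter> V) ` (\<U> \<times> \<O>). V \<subseteq> W"
      using \<V>(2)[unfolded refines_def] that by (rule bspec)
    then obtain W where W: "W \<in> (\<lambda>(U, V). U \<inter> V) ` (\<U> \<times> \<O>)" "V \<subseteq> W" by (rule bexE)
    from W(1) obtain p where p: "W = (\<lambda>(U, V). U \<inter> V) p" "p \<in> \<U> \<times> \<O>" by (rule imageE)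
    obtain U Q where "p = (U, Q)" by (cases p)
    then have "U \<in> \<U>" "Q \<in> \<O>" "V \<subseteq> U" "V \<subseteq> Q" using p W(2) by simp_all
    then show ?thesis by blast
  qed
  obtain C \<phi> where C: "\<And>V. V \<in> \<V> \<Longrightarrow> closedin X (C V) \<and> C V \<subseteq> V"
    and \<phi>: "\<And>V. V \<in> \<V> \<Longrightarrow> continuous_map X euclideanreal (\<phi> V)"
      "\<And>V x. V \<in> \<V> \<Longrightarrow> x \<in> topspace X \<Longrightarrow> 0 \<le> \<phi> V x"
      "\<And>V x. V \<in> \<V> \<Longrightarrow> x \<in> topspace X \<Longrightarrow> \<phi> V x \<noteq> 0 \<Longrightarrow> x \<in> C V"
      "\<And>x. x \<in> topspace X \<Longrightarrow> (\<Sum>V\<in>\<V>. \<phi> V x) = 1"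
    using exists_partition_of_unity[OF normal \<V>(1)] by blast
  have C_cov: "topspace X \<subseteq> (\<Union>V\<in>\<V>. C V)"
  proof
    fix x assume x: "x \<in> topspace X"
    have "\<exists>V\<in>\<V>. \<phi> V x \<noteq> 0" using \<phi>(4)[OF x] by (metis sum.neutral zero_neq_one)
    then show "x \<in> (\<Union>V\<in>\<V>. C V)" using \<phi>(3) x by blast
  qed
  have fin\<V>: "finite \<V>" using \<V>(1) by (simp add: open_covers_def)
  obtain N where N: "N \<ge> 1" "\<And>x. x \<in> topspace X \<Longrightarrow>
      real (\<Sum>k<N. card {V\<in>\<V>. (T ^^ k) x \<in> C V} - 1) < real n / 2 * real N"
    using cover_ord_average_less[OF tds \<V>(1) C C_cov \<V>(3)] by auto
  define m where "m = card \<V>"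
  obtain h where h: "bij_betw h {0..<m} \<V>"
    using ex_bij_betw_nat_finite[OF fin\<V>] by (auto simp: m_def)
  have h_in: "h i \<in> \<V>" if "i < m" for i using h that by (auto simp: bij_betw_def)
  define P where "P x i = (if i < m then \<phi> (h i) x else 0)" for x i
  have P_nonneg: "0 \<le> P x i" if "x \<in> topspace X" for x i
    using \<phi>(2)[OF h_in that] by (simp add: P_def)
  have P_C: "i < m \<and> x \<in> C (h i)" if "x \<in> topspace X" "P x i \<noteq> 0" for x i
    using that \<phi>(3)[OF h_in] by (auto simp: P_def split: if_splits)
  have P_sum: "(\<Sum>i<m. P x i) = 1" if "x \<in> topspace X" for x
  proof -
    have "(\<Sum>i<m. P x i) = (\<Sum>i\<in>{0..<m}. \<phi> (h i) x)" by (intro sum.cong) (auto simp: P_def)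
    also have "\<dots> = (\<Sum>V\<in>\<V>. \<phi> V x)" using h by (rule sum.reindex_bij_betw)
    finally show ?thesis using \<phi>(4)[OF that] by simp
  qed
  have P_bary: "barycentric m (P x)" if "x \<in> topspace X" for x
    using P_sum[OF that] by (simp add: barycentric_def P_def)
  have P_cont: "continuous_map X euclideanreal (\<lambda>x. P x i)" for i
    using \<phi>(1)[OF h_in] by (simp add: P_def)
  define L where "L = N * (2 * m * N + 1)"
  \<comment> \<open>An arbitrary value if \<open>h i\<close> is empty; \<open>pt i\<close> is
    evaluated only against a nonzero \<open>P x i\<close>, and then \<open>x\<close> itself lies in
    \<open>h i\<close>.\<close>
  define pt where "pt i = (SOME y. y \<in> h i)" for i
  \<comment> \<open>The factor \<open>1 - \<delta>\<close> leaves room of size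
    \<open>\<delta>\<close> below \<open>1\<close>, so that adding the nonnegative perturbation
    stays in the cube.\<close>
  define a where "a c i = (1 - \<delta>) * f (pt i) $ \<iota>' c" for c i
  have pt: "pt i \<in> topspace X" "\<bar>f (pt i) $ c - f x $ c\<bar> < \<delta>"
    if x: "x \<in> topspace X" "P x i \<noteq> 0" for x i c
  proof -
    have hi: "h i \<in> \<V>" "x \<in> h i" using P_C[OF x] h_in C by auto
    have "pt i \<in> h i" unfolding pt_def using hi(2) by (rule someI)
    moreover have "h i \<subseteq> topspace X" using \<V>(1) hi(1) by (auto simp: open_covers_def)
    ultimately show "pt i \<in> topspace X" by blast
    obtain Q where "Q \<in> \<O>" "h i \<subseteq> Q" using sub[OF hi(1)] by blast
    then show "\<bar>f (pt i) $ c - f x $ c\<bar> < \<delta>" using \<O>(2) \<open>pt i \<in> h i\<close> hi(2) by blast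
  qed
  have f01: "0 \<le> f x $ c" "f x $ c \<le> 1" if "x \<in> topspace X" for x c
    using f that by (auto simp: cube_maps_iff)
  define main where "main x c = (\<Sum>i<m. a c i * P x i)" for x c
  define pert where "pert x c = (\<Sum>l\<le>L. \<Sum>i<m. filter_coeff n m l c i * P (ziter X T (int l) x) i)" for x c
  have main: "0 \<le> main x (\<iota> c)" "main x (\<iota> c) \<le> 1 - \<delta>" "\<bar>main x (\<iota> c) - f x $ c\<bar> \<le> 2 * \<delta>"
    if x: "x \<in> topspace X" for x c
  proof -
    have summand: "0 \<le> a (\<iota> c) i * P x i \<and> a (\<iota> c) i * P x i \<le> (1 - \<delta>) * P x i \<and>
        \<bar>(a (\<iota> c) i - f x $ c) * P x i\<bar> \<le> 2 * \<delta> * P x i" for i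
    proof (cases "P x i = 0")
      case False
      define y where "y = f (pt i) $ c"
      have y: "0 \<le> y" "y \<le> 1" "\<bar>y - f x $ c\<bar> < \<delta>"
        using pt[OF x False] f01[of "pt i" c] by (auto simp: y_def)
      have aa: "a (\<iota> c) i = (1 - \<delta>) * y" by (simp add: a_def \<iota>'\<iota> y_def)
      have "0 \<le> (1 - \<delta>) * y" using y \<delta> by (intro mult_nonneg_nonneg) auto
      moreover have "(1 - \<delta>) * y \<le> (1 - \<delta>) * 1" using y \<delta> by (intro mult_left_mono) auto
      moreover have "\<bar>(1 - \<delta>) * y - f x $ c\<bar> \<le> 2 * \<delta>"
      proof -
        have "0 \<le> \<delta> * y" "\<delta> * y \<le> \<delta> * 1" using y \<delta> by (auto intro: mult_left_mono)
        moreover have "(1 - \<delta>) * y - f x $ c = (y - f x $ c) - \<delta> * y" by (simp add: algebra_simps)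
        ultimately show ?thesis using y(3) by linarith
      qed
      ultimately show ?thesis unfolding aa abs_mult using P_nonneg[OF x, of i]
        by (auto intro: mult_right_mono mult_nonneg_nonneg)
    qed simp
    show "0 \<le> main x (\<iota> c)" unfolding main_def using summand by (intro sum_nonneg) blast
    have "main x (\<iota> c) \<le> (\<Sum>i<m. (1 - \<delta>) * P x i)" unfolding main_def using summand by (intro sum_mono) blast
    then show "main x (\<iota> c) \<le> 1 - \<delta>" using P_sum[OF x] by (simp flip: sum_distrib_left)
    have "main x (\<iota> c) - f x $ c = (\<Sum>i<m. a (\<iota> c) i * P x i) - f x $ c * (\<Sum>i<m. P x i)"
      using P_sum[OF x] by (simp add: main_def)
    also have "\<dots> = (\<Sum>i<m. (a (\<iota> c) i - f x $ c) * P x i)"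
      by (simp add: sum_distrib_left sum_subtractf[symmetric] left_diff_distrib)
    finally have "\<bar>main x (\<iota> c) - f x $ c\<bar> \<le> (\<Sum>i<m. \<bar>(a (\<iota> c) i - f x $ c) * P x i\<bar>)"
      by (simp add: sum_abs)
    also have "\<dots> \<le> (\<Sum>i<m. 2 * \<delta> * P x i)" using summand by (intro sum_mono) blast
    also have "\<dots> = 2 * \<delta>" using P_sum[OF x] by (simp flip: sum_distrib_left)
    finally show "\<bar>main x (\<iota> c) - f x $ c\<bar> \<le> 2 * \<delta>" .
  qed
  have pert: "0 \<le> pert x c" "pert x c \<le> real L + 1" if x: "x \<in> topspace X" for x c
  proof -
    have inner: "0 \<le> (\<Sum>i<m. filter_coeff n m l c i * P (ziter X T (int l) x) i)"
        "(\<Sum>i<m. filter_coeff n m l c i * P (ziter X T (int l) x) i) \<le> 1" for l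
    proof -
      let ?z = "ziter X T (int l) x"
      have z: "?z \<in> topspace X" by (rule ziter_in[OF tds x])
      show "0 \<le> (\<Sum>i<m. filter_coeff n m l c i * P ?z i)"
        using P_nonneg[OF z] filter_coeff_bounds by (intro sum_nonneg mult_nonneg_nonneg) auto
      have "(\<Sum>i<m. filter_coeff n m l c i * P ?z i) \<le> (\<Sum>i<m. 1 * P ?z i)"
        using P_nonneg[OF z] filter_coeff_bounds by (intro sum_mono mult_right_mono) auto
      then show "(\<Sum>i<m. filter_coeff n m l c i * P ?z i) \<le> 1" using P_sum[OF z] by simp
    qed
    show "0 \<le> pert x c" unfolding pert_def by (rule sum_nonneg) (rule inner(1))
    have "pert x c \<le> (\<Sum>l\<le>L. 1)" unfolding pert_def by (rule sum_mono) (rule inner(2))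
    then show "pert x c \<le> real L + 1" by simp
  qed
  define Bad where "Bad = {\<tau>. \<exists>S S' W R. (\<forall>k<W. S k \<subseteq> {..<m} \<and> S' k \<subseteq> {..<m}) \<and>
    finite (singular_parameters a n m L S S' W R) \<and> \<tau> \<in> singular_parameters a n m L S S' W R}"
  have "countable Bad" unfolding Bad_def by (rule countable_singular_parameters)
  \<comment> \<open>The perturbation is a sum of \<open>L + 1\<close> terms in
    \<open>[0, 1]\<close>, so these \<open>\<tau>\<close> keep it below
    \<open>\<delta>\<close>.\<close>
  moreover have "uncountable {0<..<\<delta> / (real L + 1)}" using \<delta> by (simp add: uncountable_open_interval)
  ultimately obtain \<tau> where \<tau>: "0 < \<tau>" "\<tau> < \<delta> / (real L + 1)" "\<tau> \<notin> Bad"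
    by (metis countable_subset greaterThanLessThan_iff subsetI)
  have \<tau>pert: "0 \<le> \<tau> * pert x c" "\<tau> * pert x c \<le> \<delta>" if x: "x \<in> topspace X" for x c
  proof -
    show "0 \<le> \<tau> * pert x c" using \<tau>(1) pert(1)[OF x] by simp
    have "\<tau> * pert x c \<le> \<tau> * (real L + 1)" using \<tau>(1) pert(2)[OF x] by (intro mult_left_mono) auto
    also have "\<dots> \<le> \<delta>" using \<tau>(2) by (simp add: pos_less_divide_eq less_imp_le)
    finally show "\<tau> * pert x c \<le> \<delta>" .
  qed
  define g where "g = restrict (\<lambda>x. \<chi> c. main x (\<iota> c) + \<tau> * pert x (\<iota> c)) (topspace X)"
  have g_eq: "g x $ c = main x (\<iota> c) + \<tau> * pert x (\<iota> c)" if "x \<in> topspace X" for x c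
    using that by (simp add: g_def)
  have gc: "g \<in> cube_maps X"
    unfolding cube_maps_iff
  proof (intro conjI allI ballI)
    show "g \<in> extensional (topspace X)" by (simp add: g_def)
    fix c
    have Pz: "continuous_map X euclideanreal (\<lambda>x. P (ziter X T k x) i)" for k i
      using continuous_map_compose[OF continuous_map_ziter[OF tds, of k] P_cont[of i]] by (simp add: o_def)
    show "continuous_map X euclideanreal (\<lambda>x. g x $ c)"
    proof (rule continuous_map_eq)
      show "continuous_map X euclideanreal (\<lambda>x. main x (\<iota> c) + \<tau> * pert x (\<iota> c))"
        unfolding main_def pert_def
        by (intro continuous_map_add continuous_map_real_mult_left continuous_map_sum finite_lessThan finite_atMost P_cont Pz)
    qed (simp add: g_eq)
    fix x assume x: "x \<in> topspace X"
    show "0 \<le> g x $ c" "g x $ c \<le> 1"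
      using main(1,2)[OF x, of c] \<tau>pert[OF x, of "\<iota> c"] g_eq[OF x] by auto
  qed
  have "unif_dist X f g \<le> 3 * \<delta>"
  proof (rule unif_dist_le[OF f gc ne])
    fix x c assume x: "x \<in> topspace X"
    show "\<bar>f x $ c - g x $ c\<bar> \<le> 3 * \<delta>"
      using main(3)[OF x, of c] \<tau>pert[OF x, of "\<iota> c"] g_eq[OF x, of c] by linarith
  qed
  then have dist: "unif_dist X f g < e" using \<delta>(3) by simp
  have "\<exists>U\<in>\<U>. x \<in> U \<and> y \<in> U"
    if x: "x \<in> topspace X" and y: "y \<in> topspace X" and eq: "orbit_map X T g x = orbit_map X T g y" for x y
  proof -
    define u where "u k = P (ziter X T k x)" for k
    define v where "v k = P (ziter X T k y)" for k
    have card_le: "card {i. P z i \<noteq> 0} \<le> card {V\<in>\<V>. z \<in> C V}" if z: "z \<in> topspace X" for z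
    proof (rule card_inj_on_le[of h])
      show "inj_on h {i. P z i \<noteq> 0}" using h P_C[OF z] by (auto simp: bij_betw_def inj_on_def)
      show "h ` {i. P z i \<noteq> 0} \<subseteq> {V\<in>\<V>. z \<in> C V}" using P_C[OF z] h_in by auto
      show "finite {V\<in>\<V>. z \<in> C V}" using fin\<V> by simp
    qed
    \<comment> \<open>Each of the two points stays below \<open>n / 2\<close> on average; added up
      they stay below \<open>n\<close>, as the pair argument requires.\<close>
    have half: "real (\<Sum>j<N. card {i. P (ziter X T (k + int j) z) i \<noteq> 0} - 1) < real n / 2 * real N"
      if z: "z \<in> topspace X" for z k
    proof -
      have zk: "ziter X T k z \<in> topspace X" by (rule ziter_in[OF tds z])
      have "(\<Sum>j<N. card {i. P (ziter X T (k + int j) z) i \<noteq> 0} - 1)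
          \<le> (\<Sum>j<N. card {V\<in>\<V>. (T ^^ j) (ziter X T k z) \<in> C V} - 1)"
      proof (intro sum_mono diff_le_mono)
        fix j
        show "card {i. P (ziter X T (k + int j) z) i \<noteq> 0} \<le> card {V\<in>\<V>. (T ^^ j) (ziter X T k z) \<in> C V}"
          using card_le[OF ziter_in[OF tds z, of "k + int j"]] unfolding ziter_add_nat[OF tds z] .
      qed
      then have "real (\<Sum>j<N. card {i. P (ziter X T (k + int j) z) i \<noteq> 0} - 1)
          \<le> real (\<Sum>j<N. card {V\<in>\<V>. (T ^^ j) (ziter X T k z) \<in> C V} - 1)" by (simp only: of_nat_le_iff)
      then show ?thesis using N(2)[OF zk] by linarith
    qed
    have "u 0 = v 0"
    proof (rule ccontr)
      assume neq: "u 0 \<noteq> v 0"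
      have "\<exists>S S' W R. (\<forall>k<W. S k \<subseteq> {..<m} \<and> S' k \<subseteq> {..<m}) \<and>
        finite (singular_parameters a n m L S S' W R) \<and> \<tau> \<in> singular_parameters a n m L S S' W R"
      proof (rule pair_singular_parameter[where u = u and v = v and N = N])
        show "n \<ge> 1" "N \<ge> 1" "u 0 \<noteq> v 0" by fact+
        show "N * (2 * m * N + 1) \<le> L" by (simp add: L_def)
        show "barycentric m (u k)" "barycentric m (v k)" for k
          unfolding u_def v_def by (intro P_bary ziter_in[OF tds] x y)+
        show "(\<Sum>j<N. (card {i. u (k + int j) i \<noteq> 0} - 1) + (card {i. v (k + int j) i \<noteq> 0} - 1)) < n * N" for k
        proof -
          have "real ((\<Sum>j<N. card {i. u (k + int j) i \<noteq> 0} - 1) + (\<Sum>j<N. card {i. v (k + int j) i \<noteq> 0} - 1)) < real (n * N)"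
            using half[OF x, of k] half[OF y, of k] unfolding u_def v_def of_nat_add of_nat_mult by linarith
          then show ?thesis unfolding sum.distrib by (simp only: of_nat_less_iff)
        qed
        fix k c assume c: "c < n"
        have kx: "ziter X T k x \<in> topspace X" and ky: "ziter X T k y \<in> topspace X"
          using x y by (auto intro: ziter_in[OF tds])
        have shift: "ziter X T (int l) (ziter X T k z) = ziter X T (k + int l) z" if "z \<in> topspace X" for l z
          using ziter_add_nat[OF tds that, of k l] ziter_add_nat[OF tds ziter_in[OF tds that], of 0 l k] by simp
        have "g (ziter X T k x) $ \<iota>' c = g (ziter X T k y) $ \<iota>' c"
          using fun_cong[OF eq, of k] by (simp add: orbit_map_def)
        then have "main (ziter X T k x) c + \<tau> * pert (ziter X T k x) c = main (ziter X T k y) c + \<tau> * pert (ziter X T k y) c"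
          unfolding g_eq[OF kx] g_eq[OF ky] \<iota>\<iota>'[OF c] .
        then have "(main (ziter X T k x) c - main (ziter X T k y) c)
            + \<tau> * (pert (ziter X T k x) c - pert (ziter X T k y) c) = 0"
          by (simp add: algebra_simps)
        moreover have "main (ziter X T k x) c - main (ziter X T k y) c = (\<Sum>i<m. a c i * (u k i - v k i))"
          by (simp add: main_def u_def v_def sum_subtractf right_diff_distrib)
        moreover have "pert (ziter X T k x) c - pert (ziter X T k y) c
            = (\<Sum>l\<le>L. \<Sum>i<m. filter_coeff n m l c i * (u (k + int l) i - v (k + int l) i))"
          unfolding pert_def u_def v_def shift[OF x] shift[OF y]
          by (simp only: sum_subtractf right_diff_distrib)
        ultimately show "(\<Sum>i<m. a c i * (u k i - v k i))
            + \<tau> * (\<Sum>l\<le>L. \<Sum>i<m. filter_coeff n m l c i * (u (k + int l) i - v (k + int l) i)) = 0"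
          by simp
      qed
      then show False using \<tau>(3) by (simp add: Bad_def)
    qed
    then have Pxy: "P x = P y" by (simp add: u_def v_def)
    have "\<exists>i. P x i \<noteq> 0" using P_sum[OF x] by (metis sum.neutral zero_neq_one)
    then obtain i where i: "P x i \<noteq> 0" by blast
    then have "i < m \<and> x \<in> C (h i)" "y \<in> C (h i)" using P_C[OF x] P_C[OF y] Pxy by auto
    moreover obtain U where "U \<in> \<U>" "h i \<subseteq> U" using sub[OF h_in[of i]] P_C[OF x i] by blast
    ultimately show ?thesis using C[OF h_in[of i]] by blast
  qed
  then have "g \<in> separating_maps X T \<U>" using gc by (simp add: separating_maps_def)
  then show ?thesis using dist by blast
qed

section \<open>Embeddings as a countable intersection of separating conditions\<close>

lemma exists_separating_covers:
  assumes "tds X T"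
  obtains \<U> :: "nat \<Rightarrow> 'a set set" where "\<And>j. \<U> j \<in> open_covers X"
    and "\<And>x y. x \<in> topspace X \<Longrightarrow> y \<in> topspace X \<Longrightarrow> x \<noteq> y \<Longrightarrow> \<exists>j. \<forall>U\<in>\<U> j. \<not> (x \<in> U \<and> y \<in> U)"
proof -
  have comp: "compact_space X" and "metrizable_space X" using assms by (auto simp: tds_def)
  then obtain M d where M: "Metric_space M d" and X: "X = Metric_space.mtopology M d"
    unfolding metrizable_space_def by blast
  interpret Metric_space M d by (rule M)
  \<comment> \<open>Covers with mesh tending to zero: a countable family already distinguishes all
    points, so that Baire's theorem can be applied.\<close>
  have "\<exists>\<U>\<in>open_covers X. \<forall>U\<in>\<U>. \<forall>x\<in>U. \<forall>y\<in>U. d x y < 1 / real (Suc j)" for j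
  proof (rule exists_finite_open_cover[OF comp])
    fix z assume z: "z \<in> topspace X"
    define r where "r = 1 / (2 * real (Suc j))"
    have r: "0 < r" "r + r = 1 / real (Suc j)" by (simp_all add: r_def field_simps)
    have "d x y < 1 / real (Suc j)" if "x \<in> mball z r" "y \<in> mball z r" for x y
    proof -
      have "x \<in> M" "y \<in> M" "z \<in> M" "d z x < r" "d z y < r" using that by auto
      then have "d x y \<le> d x z + d z y" by (intro triangle)
      then show ?thesis using \<open>d z x < r\<close> \<open>d z y < r\<close> r(2) commute[of x z] by linarith
    qed
    moreover have "openin X (mball z r)" unfolding X by (rule openin_mball)
    moreover have "z \<in> mball z r" using z r(1) unfolding X by simp
    ultimately show "\<exists>U. openin X U \<and> z \<in> U \<and> (\<forall>x\<in>U. \<forall>y\<in>U. d x y < 1 / real (Suc j))" by blast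
  qed
  then have "\<forall>j. \<exists>\<U>. \<U> \<in> open_covers X \<and> (\<forall>U\<in>\<U>. \<forall>x\<in>U. \<forall>y\<in>U. d x y < 1 / real (Suc j))" by blast
  from choice[OF this] obtain \<U> where
    \<U>: "\<forall>j. \<U> j \<in> open_covers X \<and> (\<forall>U\<in>\<U> j. \<forall>x\<in>U. \<forall>y\<in>U. d x y < 1 / real (Suc j))" ..
  show thesis
  proof
    show "\<U> j \<in> open_covers X" for j using \<U> by blast
    fix x y assume xy: "x \<in> topspace X" "y \<in> topspace X" "x \<noteq> y"
    then have "0 < d x y" unfolding X by simp
    then obtain j where j: "1 / real (Suc j) < d x y" using nat_approx_posE by blast
    have "\<not> (x \<in> U \<and> y \<in> U)" if U: "U \<in> \<U> j" for U
    proof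
      assume "x \<in> U \<and> y \<in> U"
      then have "d x y < 1 / real (Suc j)" using \<U> U by blast
      then show False using j by simp
    qed
    then show "\<exists>j. \<forall>U\<in>\<U> j. \<not> (x \<in> U \<and> y \<in> U)" by blast
  qed
qed

text \<open>A continuous map from a compact space to a Hausdorff space is closed, so injectivity is
  the only condition.\<close>

lemma embedding_map_orbit_map:
  fixes f :: "'a \<Rightarrow> real ^ 'n"
  assumes tds: "tds X T" and f: "f \<in> cube_maps X"
  shows "embedding_map X cube_shift_space (orbit_map X T f) \<longleftrightarrow> inj_on (orbit_map X T f) (topspace X)"
proof
  show "inj_on (orbit_map X T f) (topspace X)" if "embedding_map X cube_shift_space (orbit_map X T f)"
    using that by (simp add: embedding_map_def homeomorphic_imp_injective_map)
next
  assume inj: "inj_on (orbit_map X T f) (topspace X)"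
  have "continuous_map X (top_of_set cube) (\<lambda>x. orbit_map X T f x k)" for k
    using continuous_map_compose[OF continuous_map_ziter[OF tds, of k], of "top_of_set cube" f] f
    by (simp add: orbit_map_def cube_maps_def o_def)
  then have cont: "continuous_map X cube_shift_space (orbit_map X T f)"
    unfolding cube_shift_space_def by (simp add: continuous_map_componentwise_UNIV)
  have "compact_space X" using tds by (simp add: tds_def)
  moreover have "Hausdorff_space (cube_shift_space :: (int \<Rightarrow> real ^ 'n) topology)"
    unfolding cube_shift_space_def by (simp add: Hausdorff_space_product_topology Hausdorff_space_subtopology)
  ultimately have "closed_map X cube_shift_space (orbit_map X T f)"
    using cont by (rule T1_Spaces.continuous_imp_closed_map[rotated])
  then show "embedding_map X cube_shift_space (orbit_map X T f)"
    using cont inj by (intro injective_closed_imp_embedding_map)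
qed

theorem theorem1p1:
  fixes X :: "'a topology" and T :: "'a \<Rightarrow> 'a"
  assumes "tds X T"
    and "dyn_dim X T < ennreal (real CARD('n::finite) / 2)"
  shows "gdelta_in (unif_topology X)
           {f \<in> cube_maps X. embedding_map X (cube_shift_space :: (int \<Rightarrow> real ^ 'n) topology)
                                (orbit_map X T f)} \<and>
         unif_topology X closure_of
           {f \<in> cube_maps X. embedding_map X (cube_shift_space :: (int \<Rightarrow> real ^ 'n) topology)
                                (orbit_map X T f)} = topspace (unif_topology X) \<and>
         (\<exists>F. embedding_map X (cube_shift_space :: (int \<Rightarrow> real ^ 'n) topology) F \<and>
              (\<forall>x\<in>topspace X. F (T x) = zshift (F x)))"
proof -
  note tds = assms(1)
  have ne: "topspace X \<noteq> {}" using tds by (simp add: tds_def)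
  interpret Metric_space "cube_maps X" "unif_dist X :: ('a \<Rightarrow> real ^ 'n) \<Rightarrow> _"
    using ne by (rule Metric_space_cube_maps)
  have top: "(unif_topology X :: ('a \<Rightarrow> real ^ 'n) topology) = mtopology" by (simp add: unif_topology_def)
  let ?E = "{f \<in> cube_maps X. embedding_map X (cube_shift_space :: (int \<Rightarrow> real ^ 'n) topology) (orbit_map X T f)}"
  obtain \<U> where \<U>: "\<And>j :: nat. \<U> j \<in> open_covers X"
      "\<And>x y. x \<in> topspace X \<Longrightarrow> y \<in> topspace X \<Longrightarrow> x \<noteq> y \<Longrightarrow> \<exists>j. \<forall>U\<in>\<U> j. \<not> (x \<in> U \<and> y \<in> U)"
    using exists_separating_covers[OF tds] by blast
  define G where "G j = (separating_maps X T (\<U> j) :: ('a \<Rightarrow> real ^ 'n) set)" for j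
  have E_eq: "?E = \<Inter>(range G)"
  proof (intro set_eqI iffI)
    fix f assume f: "f \<in> ?E"
    then have fc: "f \<in> cube_maps X" and inj: "inj_on (orbit_map X T f) (topspace X)"
      using embedding_map_orbit_map[OF tds, of f] by auto
    have "f \<in> G j" for j
      unfolding G_def separating_maps_def
    proof (intro CollectI conjI ballI impI fc)
      fix x y assume xy: "x \<in> topspace X" "y \<in> topspace X" "orbit_map X T f x = orbit_map X T f y"
      have "x = y" by (rule inj_onD[OF inj xy(3,1,2)])
      have "\<Union>(\<U> j) = topspace X" using \<U>(1)[of j] by (simp add: open_covers_def)
      then have "x \<in> \<Union>(\<U> j)" using xy(1) by simp
      then obtain U where "U \<in> \<U> j" "x \<in> U" by (rule UnionE)
      then show "\<exists>U\<in>\<U> j. x \<in> U \<and> y \<in> U" using \<open>x = y\<close> by (intro bexI[of _ U]) simp_all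
    qed
    then show "f \<in> \<Inter>(range G)" by blast
  next
    fix f assume f: "f \<in> \<Inter>(range G)"
    then have fG: "f \<in> G j" for j by blast
    have fc: "f \<in> cube_maps X" using fG[of 0] by (simp add: G_def separating_maps_def)
    have "inj_on (orbit_map X T f) (topspace X)"
    proof (rule inj_onI, rule ccontr)
      fix x y assume xy: "x \<in> topspace X" "y \<in> topspace X" "orbit_map X T f x = orbit_map X T f y" "x \<noteq> y"
      obtain j where "\<forall>U\<in>\<U> j. \<not> (x \<in> U \<and> y \<in> U)" using \<U>(2)[OF xy(1,2,4)] by blast
      moreover have "\<exists>U\<in>\<U> j. x \<in> U \<and> y \<in> U"
        using fG[of j] xy(1-3) by (simp add: G_def separating_maps_def)
      ultimately show False by blast
    qed
    then show "f \<in> ?E" using fc embedding_map_orbit_map[OF tds fc] by simp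
  qed
  have G_open: "openin mtopology (G j)" for j
  proof -
    have "openin X U" if "U \<in> \<U> j" for U using \<U>(1)[of j] that by (simp add: open_covers_def)
    then have "openin (unif_topology X) (G j)" unfolding G_def by (rule openin_separating_maps[OF tds])
    then show ?thesis unfolding top .
  qed
  have G_dense: "mtopology closure_of G j = cube_maps X" for j
    unfolding metric_closure_of
  proof (intro set_eqI iffI)
    fix f :: "'a \<Rightarrow> real ^ 'n" assume "f \<in> cube_maps X"
    moreover have "\<exists>g\<in>G j. g \<in> mball f r" if r: "0 < r" for r
    proof -
      obtain g where "g \<in> G j" "unif_dist X f g < r"
        using separating_maps_dense[OF tds assms(2) \<U>(1)[of j] \<open>f \<in> cube_maps X\<close> r] unfolding G_def by blast
      moreover have "g \<in> cube_maps X" using \<open>g \<in> G j\<close> by (simp add: G_def separating_maps_def)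
      ultimately show ?thesis using \<open>f \<in> cube_maps X\<close> by (intro bexI[of _ g]) simp_all
    qed
    ultimately show "f \<in> {f \<in> cube_maps X. \<forall>r>0. \<exists>g\<in>G j. g \<in> mball f r}" by blast
  qed simp
  have "gdelta_in mtopology (\<Inter>(range G))"
    using G_open by (intro gdelta_in_Inter) (auto intro: open_imp_gdelta_in)
  moreover have dense: "mtopology closure_of \<Inter>(range G) = cube_maps X"
    using G_open G_dense by (intro metric_Baire_category mcomplete_cube_maps ne) auto
  moreover have "\<exists>F. embedding_map X (cube_shift_space :: (int \<Rightarrow> real ^ 'n) topology) F \<and>
      (\<forall>x\<in>topspace X. F (T x) = zshift (F x))"
  proof -
    \<comment> \<open>The zero map shows that there are maps at all, so the dense set is nonempty
      and provides the equivariant embedding.\<close>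
    have "restrict (\<lambda>_. 0 :: real ^ 'n) (topspace X) \<in> cube_maps X"
    proof -
      have "continuous_map X euclideanreal (\<lambda>x. restrict (\<lambda>_. 0 :: real ^ 'n) (topspace X) x $ c)" for c
        by (rule continuous_map_eq[of _ _ "\<lambda>_. 0"]) auto
      then show ?thesis by (simp add: cube_maps_iff)
    qed
    then have "\<Inter>(range G) \<noteq> {}" using dense by fastforce
    then obtain f where f: "f \<in> ?E" using E_eq by blast
    have "orbit_map X T f (T x) = zshift (orbit_map X T f x)" if "x \<in> topspace X" for x
      unfolding orbit_map_def zshift_def ziter_Suc(2)[OF tds that] ..
    then show ?thesis using f by blast
  qed
  ultimately show ?thesis unfolding top E_eq by simp
qed

end
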